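(* Let $a,b>0$ and $m\ge0$, and let $H_{a,b}$ be the Dirac operator of mass $m$ with infinite-mass boundary conditions on $\Omega_{a,b}=(-\frac a2,\frac a2)\times(-\frac b2,\frac b2)$. Let $\lambda$ be an eigenvalue of $H_{a,b}$ and let $u=(u_1,u_2)$ be a corresponding eigenfunction. Then neither $u_1$ nor $u_2$ has separated variables, i.e., for neither $j=1$ nor $j=2$ do there exist functions $\varphi\in W^{2,2}((-\frac a2,\frac a2))$ and $\chi\in W^{2,2}((-\frac b2,\frac b2))$ such that $u_j(x_1,x_2)=\varphi(x_1)\chi(x_2)$ in $\Omega_{a,b}$.
   Context: For $a,b>0$ and $m\ge0$, $H_{a,b}$ is the operator in $L^2(\Omega_{a,b};\mathbb{C}^2)$ acting as $$H_{a,b}=\begin{pmatrix} m & -i(\partial_1-i\partial_2)\\ -i(\partial_1+i\partial_2) & -m\end{pmatrix}$$ on the domain $\mathsf{D}(H_{a,b})=\{u=(u_1,u_2)\in W^{1,2}(\Omega_{a,b};\mathbb{C}^2): u_2=i(n_1+in_2)u_1 \text{ on }\partial\Omega_{a,b}\}$, where $n=(n_1,n_2)$ is the outward unit normal and boundary values are in the sense of traces. Explicitly: $u_2=-u_1$ on the top side $x_2=\frac b2$, $u_2=u_1$ on the bottom side $x_2=-\frac b2$, $u_2=iu_1$ on the right side $x_1=\frac a2$, $u_2=-iu_1$ on the left side $x_1=-\frac a2$. An eigenfunction is a non-zero $u\in\mathsf{D}(H_{a,b})$ with $H_{a,b}u=\lambda u$. Functions $\varphi,\chi$ are complex-valued.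 *)

theory Defs
  imports "HOL-Analysis.Analysis"
begin

text \<open>
  Elements of \<open>L\<^sup>2(\<Omega>)\<close> and of the Sobolev spaces are represented by Lebesgue measurable functions;
  equality of elements is equality almost everywhere, and values outside \<open>\<Omega>\<close> are irrelevant.
\<close>

definition square_integrable_on :: "('a::euclidean_space \<Rightarrow> complex) \<Rightarrow> 'a set \<Rightarrow> bool" where
  "square_integrable_on f \<Omega> \<longleftrightarrow>
     f \<in> borel_measurable (lebesgue_on \<Omega>) \<and>
     integrable (lebesgue_on \<Omega>) (\<lambda>x. (norm (f x))\<^sup>2)"

definition L2_dist_sq :: "'a::euclidean_space set \<Rightarrow> ('a \<Rightarrow> complex) \<Rightarrow> ('a \<Rightarrow> complex) \<Rightarrow> ennreal" where
  "L2_dist_sq \<Omega> f g = (\<integral>\<^sup>+x. ennreal ((norm (f x - g x))\<^sup>2) \<partial>lebesgue_on \<Omega>)"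

primrec Ck :: "nat \<Rightarrow> ('a::euclidean_space \<Rightarrow> 'b::real_normed_vector) \<Rightarrow> bool" where
  "Ck 0 f \<longleftrightarrow> continuous_on UNIV f"
| "Ck (Suc k) f \<longleftrightarrow> f differentiable_on UNIV \<and> (\<forall>v. Ck k (\<lambda>x. frechet_derivative f (at x) v))"

definition smooth :: "('a::euclidean_space \<Rightarrow> 'b::real_normed_vector) \<Rightarrow> bool" where
  "smooth f \<longleftrightarrow> (\<forall>k. Ck k f)"

definition test_function :: "'a::euclidean_space set \<Rightarrow> ('a \<Rightarrow> real) \<Rightarrow> bool" where
  "test_function \<Omega> \<eta> \<longleftrightarrow>
     smooth \<eta> \<and> compact (closure {x. \<eta> x \<noteq> 0}) \<and> closure {x. \<eta> x \<noteq> 0} \<subseteq> \<Omega>"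

definition has_L2_weak_partial ::
  "'a::euclidean_space set \<Rightarrow> 'a \<Rightarrow> ('a \<Rightarrow> complex) \<Rightarrow> ('a \<Rightarrow> complex) \<Rightarrow> bool" where
  "has_L2_weak_partial \<Omega> e f g \<longleftrightarrow>
     square_integrable_on f \<Omega> \<and> square_integrable_on g \<Omega> \<and>
     (\<forall>\<eta>. test_function \<Omega> \<eta> \<longrightarrow>
        (\<integral>x. frechet_derivative \<eta> (at x) e *\<^sub>R f x \<partial>lebesgue_on \<Omega>) =
        - (\<integral>x. \<eta> x *\<^sub>R g x \<partial>lebesgue_on \<Omega>))"

text \<open>A representative of the (almost everywhere unique) weak partial derivative, if there is one.\<close>

definition weak_partial :: "'a::euclidean_space set \<Rightarrow> 'a \<Rightarrow> ('a \<Rightarrow> complex) \<Rightarrow> ('a \<Rightarrow> complex)" where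
  "weak_partial \<Omega> e f = (SOME g. has_L2_weak_partial \<Omega> e f g)"

text \<open>\<open>W2 k \<Omega> f\<close> means that \<open>f\<close> belongs to the Sobolev space \<open>W\<^bsup>k,2\<^esup>(\<Omega>)\<close>, for open \<open>\<Omega>\<close>.\<close>

primrec W2 :: "nat \<Rightarrow> 'a::euclidean_space set \<Rightarrow> ('a \<Rightarrow> complex) \<Rightarrow> bool" where
  "W2 0 \<Omega> f \<longleftrightarrow> square_integrable_on f \<Omega>"
| "W2 (Suc k) \<Omega> f \<longleftrightarrow>
     square_integrable_on f \<Omega> \<and> (\<forall>e\<in>Basis. \<exists>g. has_L2_weak_partial \<Omega> e f g \<and> W2 k \<Omega> g)"

definition interval :: "real \<Rightarrow> real set" where
  "interval l = {- l/2 <..< l/2}"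

definition rectangle :: "real \<Rightarrow> real \<Rightarrow> (real \<times> real) set" where
  "rectangle a b = interval a \<times> interval b"

datatype side = Top | Bottom | Right | Left

text \<open>Arc-length parametrisations of the open sides, so that the surface measure on the boundary
  of the rectangle is Lebesgue measure in the parameter (the corners are a null set).\<close>

fun side_dom :: "real \<Rightarrow> real \<Rightarrow> side \<Rightarrow> real set" where
  "side_dom a b Top = interval a"
| "side_dom a b Bottom = interval a"
| "side_dom a b Right = interval b"
| "side_dom a b Left = interval b"

fun side_param :: "real \<Rightarrow> real \<Rightarrow> side \<Rightarrow> real \<Rightarrow> real \<times> real" where
  "side_param a b Top t = (t, b/2)"
| "side_param a b Bottom t = (t, - b/2)"
| "side_param a b Right t = (a/2, t)"
| "side_param a b Left t = (- a/2, t)"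

fun normal :: "side \<Rightarrow> real \<times> real" where
  "normal Top = (0, 1)"
| "normal Bottom = (0, - 1)"
| "normal Right = (1, 0)"
| "normal Left = (- 1, 0)"

text \<open>The trace of \<open>f \<in> W\<^bsup>1,2\<^esup>\<close> on the boundary, as the continuous extension of the restriction map
  from the dense subspace of functions smooth up to the boundary. Only the values of \<open>g\<close> on the
  four open sides matter.\<close>

definition has_trace ::
  "real \<Rightarrow> real \<Rightarrow> (real \<times> real \<Rightarrow> complex) \<Rightarrow> (real \<times> real \<Rightarrow> complex) \<Rightarrow> bool" where
  "has_trace a b f g \<longleftrightarrow>
     W2 1 (rectangle a b) f \<and>
     (\<forall>s. square_integrable_on (\<lambda>t. g (side_param a b s t)) (side_dom a b s)) \<and>
     (\<exists>v :: nat \<Rightarrow> real \<times> real \<Rightarrow> complex.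
        (\<forall>k. smooth (v k)) \<and>
        (\<lambda>k. L2_dist_sq (rectangle a b) (v k) f) \<longlonglongrightarrow> 0 \<and>
        (\<forall>e\<in>Basis. (\<lambda>k. L2_dist_sq (rectangle a b) (\<lambda>x. frechet_derivative (v k) (at x) e)
                              (weak_partial (rectangle a b) e f)) \<longlonglongrightarrow> 0) \<and>
        (\<forall>s. (\<lambda>k. L2_dist_sq (side_dom a b s) (\<lambda>t. v k (side_param a b s t))
                                              (\<lambda>t. g (side_param a b s t))) \<longlonglongrightarrow> 0))"

definition bc_factor :: "side \<Rightarrow> complex" where
  "bc_factor s = (case normal s of (n1, n2) \<Rightarrow> \<i> * (complex_of_real n1 + \<i> * complex_of_real n2))"

lemma bc_factor_simps:
  "bc_factor Top = - 1" "bc_factor Bottom = 1" "bc_factor Right = \<i>" "bc_factor Left = - \<i>"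
  by (simp_all add: bc_factor_def)

definition dirac_domain :: "real \<Rightarrow> real \<Rightarrow> (real \<times> real \<Rightarrow> complex \<times> complex) set" where
  "dirac_domain a b = {u.
     W2 1 (rectangle a b) (\<lambda>x. fst (u x)) \<and> W2 1 (rectangle a b) (\<lambda>x. snd (u x)) \<and>
     (\<exists>g1 g2. has_trace a b (\<lambda>x. fst (u x)) g1 \<and> has_trace a b (\<lambda>x. snd (u x)) g2 \<and>
        (\<forall>s. AE t in lebesgue_on (side_dom a b s).
           g2 (side_param a b s t) = bc_factor s * g1 (side_param a b s t)))}"

definition dirac_op ::
  "real \<Rightarrow> real \<Rightarrow> real \<Rightarrow> (real \<times> real \<Rightarrow> complex \<times> complex) \<Rightarrow> real \<times> real \<Rightarrow> complex \<times> complex" where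
  "dirac_op a b m u x =
     (let u1 = (\<lambda>y. fst (u y)); u2 = (\<lambda>y. snd (u y));
          D1 = weak_partial (rectangle a b) (1, 0); D2 = weak_partial (rectangle a b) (0, 1)
      in (complex_of_real m * u1 x - \<i> * (D1 u2 x - \<i> * D2 u2 x),
          - \<i> * (D1 u1 x + \<i> * D2 u1 x) - complex_of_real m * u2 x))"

definition eigenfunction ::
  "real \<Rightarrow> real \<Rightarrow> real \<Rightarrow> complex \<Rightarrow> (real \<times> real \<Rightarrow> complex \<times> complex) \<Rightarrow> bool" where
  "eigenfunction a b m ev u \<longleftrightarrow>
     u \<in> dirac_domain a b \<and>
     \<not> (AE x in lebesgue_on (rectangle a b). u x = (0, 0)) \<and>
     (AE x in lebesgue_on (rectangle a b). dirac_op a b m u x = (ev * fst (u x), ev * snd (u x)))"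

definition eigenvalue :: "real \<Rightarrow> real \<Rightarrow> real \<Rightarrow> complex \<Rightarrow> bool" where
  "eigenvalue a b m ev \<longleftrightarrow> (\<exists>u. eigenfunction a b m ev u)"

definition separated_variables :: "real \<Rightarrow> real \<Rightarrow> (real \<times> real \<Rightarrow> complex) \<Rightarrow> bool" where
  "separated_variables a b f \<longleftrightarrow>
     (\<exists>\<phi> \<psi> :: real \<Rightarrow> complex. W2 2 (interval a) \<phi> \<and> W2 2 (interval b) \<psi> \<and>
        (AE x in lebesgue_on (rectangle a b). f x = \<phi> (fst x) * \<psi> (snd x)))"

end

theory Submission
  imports Defs
begin

text \<open>
  Idea. Functions with a trace are absolutely continuous on almost every line parallel to an axis, with the
  trace as boundary values. If \<open>u1 = \<phi>\<psi>\<close> and \<open>ev \<noteq> - m\<close>, then \<open>u2\<close> is a multiple of \<open>\<phi>'\<psi> + i\<phi>\<psi>'\<close>. If \<open>\<psi>\<close> is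
  nonzero at an end point, the boundary condition there forces \<open>\<phi>' = k\<phi>\<close>, so \<open>\<phi>\<close> is an exponential; as it has no
  zeros, the boundary condition on the vertical sides forces \<open>\<psi>' = l\<psi>\<close>. Hence \<open>u2 = K u1\<close>, and the top and
  bottom sides give \<open>K = -1\<close> and \<open>K = 1\<close>. The roles of \<open>\<phi>\<close> and \<open>\<psi>\<close> can be exchanged; otherwise \<open>u\<close> has zero
  traces, and then \<open>u = 0\<close>, because testing the system with exponentials \<open>exp (\<alpha>x + \<beta>y)\<close> shows that \<open>u\<close> is orthogonal to
  a dense set. The values \<open>ev = m\<close> and \<open>ev = - m\<close> are excluded by integrating the system against \<open>u1\<close>: the integral of
  \<open>|u1|\<^sup>2\<close> over the boundary would be at most zero, so that \<open>u\<close> would again have zero traces.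
\<close>

section \<open>Lebesgue measure on a closed rectangle\<close>

text \<open>Elements of the domain are classes of functions, so neither boundary values nor
  derivatives along a single line can be read off from \<open>u\<close> directly. They are extracted
  from the approximating sequence in \<open>has_trace\<close>: its convergence in square mean,
  together with the partial derivatives and the restrictions to the sides, yields a Green formula on
  the rectangle and, on almost every line, a primitive with prescribed end values. Both facts are
  proved for one direction and transferred by exchanging the coordinates. The factors
  \<open>\<phi>\<close> and \<open>\<psi>\<close> are likewise known only almost everywhere. They
  are replaced by multiples of sections of the separated component along well chosen lines, and all
  later identities compare primitives on lines. Real exponentials are convenient test functions:
  with zero traces, differentiation becomes multiplication by a number. Small exponents must be
  avoided, since the determinant of the transformed system may vanish there; factoring out one fixed
  large exponential still leaves an algebra that separates points.\<close>

text \<open>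
  The closed interval is used instead of \<open>interval l\<close>, so that continuous functions are bounded on the
  space; the two differ by a null set.
\<close>

definition ivl :: "real \<Rightarrow> real measure" where
  "ivl l = restrict_space lborel {- l/2..l/2}"

definition rct :: "real \<Rightarrow> real \<Rightarrow> (real \<times> real) measure" where
  "rct a b = ivl a \<Otimes>\<^sub>M ivl b"

lemma space_ivl [simp]: "space (ivl l) = {- l/2..l/2}"
  by (simp add: ivl_def space_restrict_space)

lemma finite_measure_ivl: "finite_measure (ivl l)"
  by (rule finite_measureI) (auto simp: ivl_def emeasure_restrict_space space_restrict_space emeasure_lborel_Icc_eq)

interpretation ivl: finite_measure "ivl l" for l
  by (rule finite_measure_ivl)

interpretation rct: pair_sigma_finite "ivl a" "ivl b" for a b ..

lemma emeasure_ivl: "l > 0 \<Longrightarrow> emeasure (ivl l) (space (ivl l)) = ennreal l"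
  by (auto simp: ivl_def emeasure_restrict_space space_restrict_space emeasure_lborel_Icc_eq)

text \<open>The product form serves Fubini; the restricted form serves the comparison with
  \<open>lebesgue_on (rectangle a b)\<close> and bounds by compactness.\<close>

lemma rct_eq_restrict: "rct a b = restrict_space lborel (cbox (-a/2,-b/2) (a/2,b/2))"
  unfolding rct_def
proof (rule pair_measure_eqI)
  show "sigma_finite_measure (ivl a)" "sigma_finite_measure (ivl b)" by unfold_locales
  have eq: "cbox (-a/2,-b/2) (a/2,b/2) = {-a/2..a/2} \<times> {-b/2..b/2::real}"
    by (auto simp: cbox_Pair_eq)
  show "sets (ivl a \<Otimes>\<^sub>M ivl b) = sets (restrict_space lborel (cbox (- a / 2, - b / 2) (a / 2, b / 2)))"
  proof
    show "sets (ivl a \<Otimes>\<^sub>M ivl b) \<subseteq> sets (restrict_space lborel (cbox (- a / 2, - b / 2) (a / 2, b / 2)))"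
      by (rule sets_pair_in_sets) (auto simp: ivl_def sets_restrict_space_iff eq intro!: borel_Times)
    \<comment> \<open>Measurability of the identity into the Borel sets of the plane puts the trace
      of every Borel set into the product sigma-algebra.\<close>
    have "(\<lambda>p. (fst p, snd p)) \<in> borel_measurable (ivl a \<Otimes>\<^sub>M ivl b)"
      by (intro borel_measurable_Pair measurable_compose[OF measurable_fst] measurable_compose[OF measurable_snd])
        (auto simp: ivl_def intro!: measurable_restrict_space1)
    hence m: "(\<lambda>p. p) \<in> borel_measurable (ivl a \<Otimes>\<^sub>M ivl b)" by simp
    show "sets (restrict_space lborel (cbox (- a / 2, - b / 2) (a / 2, b / 2))) \<subseteq> sets (ivl a \<Otimes>\<^sub>M ivl b)"
    proof
      fix C assume "C \<in> sets (restrict_space lborel (cbox (- a / 2, - b / 2) (a / 2, b / 2)))"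
      then obtain D where "D \<in> sets borel" "C = D \<inter> ({-a/2..a/2} \<times> {-b/2..b/2})"
        unfolding eq sets_restrict_space sets_lborel by blast
      thus "C \<in> sets (ivl a \<Otimes>\<^sub>M ivl b)"
        using measurable_sets[OF m, of D] by (simp add: space_pair_measure)
    qed
  qed
next
  have eq: "cbox (-a/2,-b/2) (a/2,b/2) = {-a/2..a/2} \<times> {-b/2..b/2::real}"
    by (auto simp: cbox_Pair_eq)
  fix A B assume AB: "A \<in> sets (ivl a)" "B \<in> sets (ivl b)"
  hence s: "A \<in> sets borel" "B \<in> sets borel" "A \<subseteq> {-a/2..a/2}" "B \<subseteq> {-b/2..b/2}"
    by (auto simp: ivl_def sets_restrict_space_iff)
  thus "emeasure (ivl a) A * emeasure (ivl b) B =
      emeasure (restrict_space lborel (cbox (- a / 2, - b / 2) (a / 2, b / 2))) (A \<times> B)"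
  proof -
    have "A \<times> B \<subseteq> {-a/2..a/2} \<times> {-b/2..b/2}" using s by blast
    thus ?thesis using s
      unfolding ivl_def eq
      by (subst (1 2 3) emeasure_restrict_space)
        (auto simp flip: lborel_prod simp: lborel.emeasure_pair_measure_Times)
  qed
qed

lemma measurable_ivl: "f \<in> borel_measurable borel \<Longrightarrow> f \<in> borel_measurable (ivl l)"
  unfolding ivl_def by (rule measurable_restrict_space1) simp

lemma measurable_rct: "f \<in> borel_measurable borel \<Longrightarrow> f \<in> borel_measurable (rct a b)"
  unfolding rct_eq_restrict by (rule measurable_restrict_space1) simp

lemma finite_measure_rct: "finite_measure (rct a b)"
  using emeasure_lborel_cbox_finite[of "(-a/2,-b/2)" "(a/2,b/2)"]
  by (intro finite_measureI) 
   (simp add: rct_eq_restrict emeasure_restrict_space space_restrict_space less_top)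

interpretation rctf: finite_measure "rct a b" for a b
  by (rule finite_measure_rct)

text \<open>Sections of a Lebesgue measurable function of two variables need not be measurable, so
  functions are replaced by Borel ones before Fubini is used. Real and imaginary parts are treated
  separately because \<open>completion_ex_borel_measurable_real\<close> is about real
  functions.\<close>

lemma borel_representative:
  fixes f :: "'a::euclidean_space \<Rightarrow> complex"
  assumes "f \<in> borel_measurable (lebesgue_on S)" "S \<in> sets lebesgue"
  obtains g where "g \<in> borel_measurable borel" "AE x in lebesgue_on S. f x = g x"
proof -
  have m: "(\<lambda>x. if x \<in> S then f x else 0) \<in> borel_measurable lebesgue"
    using assms by (simp add: borel_measurable_if)
  have "(\<lambda>x. Re (if x \<in> S then f x else 0)) \<in> borel_measurable (completion lborel)"
    "(\<lambda>x. Im (if x \<in> S then f x else 0)) \<in> borel_measurable (completion lborel)"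
    using m by (auto intro!: measurable_compose[OF m])
  from this[THEN completion_ex_borel_measurable_real] obtain r i where ri: "r \<in> borel_measurable lborel" "i \<in> borel_measurable lborel"
    "AE x in lborel. Re (if x \<in> S then f x else 0) = r x"
    "AE x in lborel. Im (if x \<in> S then f x else 0) = i x"
    by blast
  let ?g = "\<lambda>x. Complex (r x) (i x)"
  have "AE x in lborel. (if x \<in> S then f x else 0) = ?g x"
    using ri(3,4) by eventually_elim (simp add: complex_eq_iff)
  hence "AE x in lebesgue. (if x \<in> S then f x else 0) = ?g x"
    by (simp add: AE_completion_iff)
  hence "AE x in lebesgue_on S. f x = ?g x"
    using assms(2) by (subst AE_restrict_space_iff) (auto elim!: eventually_mono)
  moreover have "?g \<in> borel_measurable borel"
    using ri unfolding Complex_eq by simp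
  ultimately show ?thesis using that by blast
qed

lemma AE_lebesgue_interval_iff:
  "(AE x in lebesgue_on (interval l). P x) \<longleftrightarrow> (AE x in ivl l. P x)"
proof -
  have "AE x in lborel. x \<noteq> -l/2 \<and> x \<noteq> l/2" 
    by (intro AE_conjI AE_lborel_singleton)
  hence "(AE x in lborel. x \<in> interval l \<longrightarrow> P x) \<longleftrightarrow> (AE x in lborel. x \<in> {-l/2..l/2} \<longrightarrow> P x)"
    by (intro iffI; elim eventually_rev_mp; elim eventually_mono; auto simp: interval_def)
  thus ?thesis
    unfolding ivl_def by (simp add: AE_restrict_space_iff AE_completion_iff interval_def)
qed

lemma rectangle_eq_box: "rectangle a b = box (-a/2,-b/2) (a/2,b/2)"
  by (auto simp: rectangle_def interval_def box_def Basis_prod_def)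

lemma AE_lebesgue_rectangle_iff:
  "(AE x in lebesgue_on (rectangle a b). P x) \<longleftrightarrow> (AE x in rct a b. P x)"
proof -
  have "negligible (cbox (-a/2,-b/2) (a/2,b/2) - box (-a/2,-b/2) (a/2,b/2::real))"
    by (rule negligible_frontier_interval)
  hence "AE x in lebesgue. \<not> x \<in> cbox (-a/2,-b/2) (a/2,b/2) - box (-a/2,-b/2) (a/2,b/2::real)"
    by (intro AE_not_in) (simp only: negligible_iff_null_sets)
  hence "(AE x in lebesgue. x \<in> rectangle a b \<longrightarrow> P x) \<longleftrightarrow> 
      (AE x in lebesgue. x \<in> cbox (-a/2,-b/2) (a/2,b/2) \<longrightarrow> P x)"
    unfolding rectangle_eq_box
    using box_subset_cbox[of "(-a/2,-b/2)" "(a/2,b/2::real)"]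
    by (intro iffI; elim eventually_rev_mp; elim eventually_mono; blast)
  moreover have "rectangle a b \<in> sets lebesgue" unfolding rectangle_eq_box by simp
  ultimately show ?thesis
    unfolding rct_eq_restrict
    by (simp add: AE_restrict_space_iff AE_completion_iff)
qed

lemma nn_integral_lebesgue_interval:
  "(\<integral>\<^sup>+x. F x \<partial>lebesgue_on (interval l)) = (\<integral>\<^sup>+x. F x \<partial>ivl l)"
proof -
  have "AE x in lborel. x \<noteq> -l/2 \<and> x \<noteq> l/2" 
    by (intro AE_conjI AE_lborel_singleton)
  hence "(\<integral>\<^sup>+x. F x * indicator (interval l) x \<partial>lborel) = (\<integral>\<^sup>+x. F x * indicator {-l/2..l/2} x \<partial>lborel)"
    by (intro nn_integral_cong_AE, elim eventually_mono) (auto simp: interval_def indicator_def)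
  thus ?thesis unfolding ivl_def
    by (simp add: nn_integral_restrict_space interval_def nn_integral_completion)
qed

lemma nn_integral_lebesgue_rectangle:
  "(\<integral>\<^sup>+x. F x \<partial>lebesgue_on (rectangle a b)) = (\<integral>\<^sup>+x. F x \<partial>rct a b)"
proof -
  have "negligible (cbox (-a/2,-b/2) (a/2,b/2) - box (-a/2,-b/2) (a/2,b/2::real))"
    by (rule negligible_frontier_interval)
  hence *: "AE x in lebesgue. \<not> x \<in> cbox (-a/2,-b/2) (a/2,b/2) - box (-a/2,-b/2) (a/2,b/2::real)"
    by (intro AE_not_in) (simp only: negligible_iff_null_sets)
  have "(\<integral>\<^sup>+x. F x * indicator (rectangle a b) x \<partial>lebesgue) = 
     (\<integral>\<^sup>+x. F x * indicator (cbox (-a/2,-b/2) (a/2,b/2)) x \<partial>lebesgue)"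
    using box_subset_cbox[of "(-a/2,-b/2)" "(a/2,b/2::real)"] *
    by (intro nn_integral_cong_AE, elim eventually_mono) 
      (auto simp: indicator_def rectangle_eq_box)
  moreover have "rectangle a b \<in> sets lebesgue" unfolding rectangle_eq_box by simp
  ultimately show ?thesis
    unfolding rct_eq_restrict
    by (simp add: nn_integral_restrict_space nn_integral_completion)
qed

lemma AE_rct: "AE p in rct a b. P p \<Longrightarrow> AE x in ivl a. AE y in ivl b. P (x,y)"
  unfolding rct_def by (rule rct.AE_pair)

lemma distr_rct_swap: "rct a b = distr (rct b a) (rct a b) prod.swap"
  unfolding rct_def prod.swap_def using rct.distr_pair_swap[of a b] by (simp add: case_prod_unfold)

lemma measurable_swap_rct: "prod.swap \<in> measurable (rct b a) (rct a b)"
  unfolding rct_def prod.swap_def by measurable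

lemma AE_rct_swap: 
  assumes "AE p in rct a b. P p" shows "AE p in rct b a. P (prod.swap p)"
proof -
  have "AE p in distr (rct b a) (rct a b) prod.swap. P p"
    using assms by (subst (asm) distr_rct_swap)
  thus ?thesis by (rule AE_distrD[OF measurable_swap_rct])
qed

lemma nn_integral_rct_swap:
  "F \<in> borel_measurable (rct a b) \<Longrightarrow> (\<integral>\<^sup>+p. F (prod.swap p) \<partial>rct b a) = (\<integral>\<^sup>+p. F p \<partial>rct a b)"
  by (subst (2) distr_rct_swap, subst nn_integral_distr[OF measurable_swap_rct]) auto

lemma integral_rct_swap:
  fixes F :: "real \<times> real \<Rightarrow> complex"
  shows "F \<in> borel_measurable (rct a b) \<Longrightarrow> (\<integral>p. F (prod.swap p) \<partial>rct b a) = (\<integral>p. F p \<partial>rct a b)"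
  by (subst (2) distr_rct_swap, subst integral_distr[OF measurable_swap_rct]) auto

section \<open>Limits in the square mean and the Green formula\<close>

text \<open>The nonnegative integral gives a meaning without integrability and matches
  \<open>L2_dist_sq\<close>; finiteness for the limit is derived in
  \<open>l2_lim_finite\<close>.\<close>

definition l2_lim :: "'a measure \<Rightarrow> (nat \<Rightarrow> 'a \<Rightarrow> complex) \<Rightarrow> ('a \<Rightarrow> complex) \<Rightarrow> bool" where
  "l2_lim M v f \<longleftrightarrow> (\<lambda>k. \<integral>\<^sup>+x. ennreal ((norm (v k x - f x))\<^sup>2) \<partial>M) \<longlonglongrightarrow> 0"

text \<open>Cauchy-Schwarz bounds the square of an L1 norm; comparing with the square of the
  threshold avoids roots in \<open>ennreal\<close>.\<close>

lemma ennreal_square_tendsto_0: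
  fixes X :: "nat \<Rightarrow> ennreal"
  assumes "\<And>k. (X k)\<^sup>2 \<le> A k * B" "A \<longlonglongrightarrow> 0" "B < \<infinity>"
  shows "X \<longlonglongrightarrow> 0"
proof -
  have AB: "(\<lambda>k. A k * B) \<longlonglongrightarrow> 0 * B"
    using assms by (intro tendsto_mult_ennreal tendsto_const) auto
  show ?thesis
    unfolding order_tendsto_iff
  proof safe
    fix e :: ennreal assume e: "0 < e"
    hence "0 < e\<^sup>2" by (simp add: power2_eq_square ennreal_zero_less_mult_iff)
    hence "\<forall>\<^sub>F k in sequentially. A k * B < e\<^sup>2"
      using AB by (auto simp: order_tendsto_iff)
    thus "\<forall>\<^sub>F k in sequentially. X k < e"
    proof eventually_elim
      case (elim k)
      show ?case
      proof (rule ccontr)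
        assume "\<not> X k < e"
        hence "e\<^sup>2 \<le> (X k)\<^sup>2" by (intro power_mono) auto
        with elim assms(1)[of k] show False by simp
      qed
    qed
  qed auto
qed

lemma l2_product_tendsto_0:
  fixes p q :: "nat \<Rightarrow> 'a \<Rightarrow> complex"
  assumes "\<And>k. p k \<in> borel_measurable M" "\<And>k. q k \<in> borel_measurable M"
    and "(\<lambda>k. \<integral>\<^sup>+x. ennreal ((norm (p k x))\<^sup>2) \<partial>M) \<longlonglongrightarrow> 0"
    and "\<And>k. (\<integral>\<^sup>+x. ennreal ((norm (q k x))\<^sup>2) \<partial>M) \<le> B" "B < \<infinity>"
  shows "(\<lambda>k. \<integral>\<^sup>+x. ennreal (norm (p k x * q k x)) \<partial>M) \<longlonglongrightarrow> 0"
proof (rule ennreal_square_tendsto_0[OF _ assms(3,5)])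
  fix k
  note [measurable] = assms(1,2)
  have "(\<integral>\<^sup>+x. ennreal (norm (p k x * q k x)) \<partial>M)\<^sup>2
      = (\<integral>\<^sup>+x. ennreal (norm (p k x)) * ennreal (norm (q k x)) \<partial>M)\<^sup>2"
    by (simp add: norm_mult ennreal_mult)
  also have "\<dots> \<le> (\<integral>\<^sup>+x. ennreal (norm (p k x))^2 \<partial>M) * (\<integral>\<^sup>+x. ennreal (norm (q k x))^2 \<partial>M)"
    by (rule Cauchy_Schwarz_nn_integral) auto
  also have "\<dots> \<le> (\<integral>\<^sup>+x. ennreal ((norm (p k x))\<^sup>2) \<partial>M) * B"
    using assms(4)[of k] by (intro mult_mono) (auto simp: ennreal_power)
  finally show "(\<integral>\<^sup>+x. ennreal (norm (p k x * q k x)) \<partial>M)\<^sup>2 \<le> (\<integral>\<^sup>+x. ennreal ((norm (p k x))\<^sup>2) \<partial>M) * B" .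
qed

lemma norm_sum_square_le: "(norm (x + y))\<^sup>2 \<le> 2 * (norm x)\<^sup>2 + 2 * (norm (y::complex))\<^sup>2"
proof -
  have "(norm (x+y))\<^sup>2 \<le> (norm x + norm y)\<^sup>2" by (simp add: norm_triangle_ineq)
  also have "\<dots> \<le> 2 * (norm x)\<^sup>2 + 2 * (norm y)\<^sup>2"
    using sum_squares_bound[of "norm x" "norm y"] by (simp add: power2_sum)
  finally show ?thesis .
qed

text \<open>A single index with distance below 1 suffices, since \<open>f\<close> is
  \<open>v k\<close> plus a difference of finite square norm.\<close>

lemma l2_lim_finite:
  assumes "\<And>k. v k \<in> borel_measurable M" "f \<in> borel_measurable M"
    and "l2_lim M v f" "\<And>k. (\<integral>\<^sup>+x. ennreal ((norm (v k x))\<^sup>2) \<partial>M) < \<infinity>"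
  shows "(\<integral>\<^sup>+x. ennreal ((norm (f x))\<^sup>2) \<partial>M) < \<infinity>"
proof -
  note [measurable] = assms(1,2)
  have "\<forall>\<^sub>F k in sequentially. (\<integral>\<^sup>+x. ennreal ((norm (v k x - f x))\<^sup>2) \<partial>M) < 1"
    using assms(3) unfolding l2_lim_def order_tendsto_iff by simp
  then obtain k where k: "(\<integral>\<^sup>+x. ennreal ((norm (v k x - f x))\<^sup>2) \<partial>M) < 1"
    by (auto simp: eventually_sequentially)
  have "(\<integral>\<^sup>+x. ennreal ((norm (f x))\<^sup>2) \<partial>M) \<le>
     (\<integral>\<^sup>+x. 2 * ennreal ((norm (v k x - f x))\<^sup>2) + 2 * ennreal ((norm (v k x))\<^sup>2) \<partial>M)"
  proof (rule nn_integral_mono)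
    fix x
    have "(norm (f x))\<^sup>2 \<le> 2 * (norm (v k x - f x))\<^sup>2 + 2 * (norm (v k x))\<^sup>2"
      using norm_sum_square_le[of "f x - v k x" "v k x"] by (simp add: norm_minus_commute)
    hence "ennreal ((norm (f x))\<^sup>2) \<le> ennreal (2 * (norm (v k x - f x))\<^sup>2 + 2 * (norm (v k x))\<^sup>2)"
      by (rule ennreal_leI)
    thus "ennreal ((norm (f x))\<^sup>2) \<le> 2 * ennreal ((norm (v k x - f x))\<^sup>2) + 2 * ennreal ((norm (v k x))\<^sup>2)"
      by (simp add: ennreal_mult)
  qed
  also have "\<dots> = 2 * (\<integral>\<^sup>+x. ennreal ((norm (v k x - f x))\<^sup>2) \<partial>M) + 2 * (\<integral>\<^sup>+x. ennreal ((norm (v k x))\<^sup>2) \<partial>M)"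
    by (subst nn_integral_add) (auto simp: nn_integral_cmult)
  also have "\<dots> < \<infinity>" using k assms(4)[of k]
    by (auto simp: ennreal_mult_eq_top_iff less_top[symmetric])
  finally show ?thesis .
qed

lemma l2_pairing_integrable:
  fixes f g :: "'a \<Rightarrow> complex"
  assumes "f \<in> borel_measurable M" "g \<in> borel_measurable M"
    and "(\<integral>\<^sup>+x. ennreal ((norm (f x))\<^sup>2) \<partial>M) < \<infinity>" "(\<integral>\<^sup>+x. ennreal ((norm (g x))\<^sup>2) \<partial>M) < \<infinity>"
  shows "integrable M (\<lambda>x. f x * g x)"
proof -
  note [measurable] = assms(1,2)
  have "(\<integral>\<^sup>+x. ennreal (norm (f x * g x)) \<partial>M) \<le>
    (\<integral>\<^sup>+x. ennreal ((norm (f x))\<^sup>2) + ennreal ((norm (g x))\<^sup>2) \<partial>M)"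
  proof (rule nn_integral_mono)
    fix x
    have "norm (f x * g x) \<le> (norm (f x))\<^sup>2 + (norm (g x))\<^sup>2"
      using sum_squares_bound[of "norm (f x)" "norm (g x)"] 
        mult_nonneg_nonneg[OF norm_ge_zero[of "f x"] norm_ge_zero[of "g x"]]
      unfolding norm_mult by linarith
    thus "ennreal (norm (f x * g x)) \<le> ennreal ((norm (f x))\<^sup>2) + ennreal ((norm (g x))\<^sup>2)"
      by (simp flip: ennreal_plus add: ennreal_leI)
  qed
  also have "\<dots> < \<infinity>" using assms(3,4) by (subst nn_integral_add) auto
  finally show ?thesis by (intro integrableI_bounded) auto
qed

text \<open>The difference of the products splits into two terms linear in the errors and one
  quadratic term; Cauchy-Schwarz sends each of them to zero in L1.\<close>

lemma l2_pairing_tendsto: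
  fixes f g :: "'a \<Rightarrow> complex"
  assumes mv: "\<And>k. v k \<in> borel_measurable M" and mw: "\<And>k. w k \<in> borel_measurable M" 
    and mf: "f \<in> borel_measurable M" and mg: "g \<in> borel_measurable M"
    and l: "l2_lim M v f" "l2_lim M w g" 
    and fv: "\<And>k. (\<integral>\<^sup>+x. ennreal ((norm (v k x))\<^sup>2) \<partial>M) < \<infinity>"
    and fw: "\<And>k. (\<integral>\<^sup>+x. ennreal ((norm (w k x))\<^sup>2) \<partial>M) < \<infinity>"
  shows "(\<lambda>k. \<integral>x. v k x * w k x \<partial>M) \<longlonglongrightarrow> (\<integral>x. f x * g x \<partial>M)"
proof -
  note [measurable] = mv mw mf mg
  have ff: "(\<integral>\<^sup>+x. ennreal ((norm (f x))\<^sup>2) \<partial>M) < \<infinity>" by (rule l2_lim_finite[OF mv mf l(1) fv])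
  have fg: "(\<integral>\<^sup>+x. ennreal ((norm (g x))\<^sup>2) \<partial>M) < \<infinity>" by (rule l2_lim_finite[OF mw mg l(2) fw])
  note l' = l[unfolded l2_lim_def]
  have t1: "(\<lambda>k. \<integral>\<^sup>+x. ennreal (norm ((v k x - f x) * g x)) \<partial>M) \<longlonglongrightarrow> 0"
    by (rule l2_product_tendsto_0[OF _ _ l'(1) order_refl fg]) auto
  have t2: "(\<lambda>k. \<integral>\<^sup>+x. ennreal (norm ((w k x - g x) * f x)) \<partial>M) \<longlonglongrightarrow> 0"
    by (rule l2_product_tendsto_0[OF _ _ l'(2) order_refl ff]) auto
  have "\<forall>\<^sub>F k in sequentially. (\<integral>\<^sup>+x. ennreal ((norm (w k x - g x))\<^sup>2) \<partial>M) < 1"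
    using l'(2) unfolding order_tendsto_iff by simp
  then obtain K where K: "\<And>k. k \<ge> K \<Longrightarrow> (\<integral>\<^sup>+x. ennreal ((norm (w k x - g x))\<^sup>2) \<partial>M) < 1"
    by (auto simp: eventually_sequentially)
  \<comment> \<open>In the quadratic term the second factor is known to be bounded by 1 only from
    \<open>K\<close> on, so the sequence is shifted; \<open>LIMSEQ_offset\<close> undoes the
    shift.\<close>
  have t3: "(\<lambda>k. \<integral>\<^sup>+x. ennreal (norm ((v (k + K) x - f x) * (w (k + K) x - g x))) \<partial>M) \<longlonglongrightarrow> 0"
  proof (rule l2_product_tendsto_0[where B = 1])
    show "(\<lambda>k. \<integral>\<^sup>+x. ennreal ((norm (v (k + K) x - f x))\<^sup>2) \<partial>M) \<longlonglongrightarrow> 0"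
      by (rule LIMSEQ_ignore_initial_segment[OF l'(1)])
    show "(\<integral>\<^sup>+x. ennreal ((norm (w (k + K) x - g x))\<^sup>2) \<partial>M) \<le> 1" for k
      using K[of "k + K"] by simp
  qed auto
  let ?S = "\<lambda>k. (\<integral>\<^sup>+x. ennreal (norm ((v k x - f x) * g x)) \<partial>M) + (\<integral>\<^sup>+x. ennreal (norm ((w k x - g x) * f x)) \<partial>M)
     + (\<integral>\<^sup>+x. ennreal (norm ((v k x - f x) * (w k x - g x))) \<partial>M)"
  have "?S \<longlonglongrightarrow> 0 + 0 + 0"
    by (intro tendsto_add t1 t2 LIMSEQ_offset[OF t3])
  hence S: "?S \<longlonglongrightarrow> 0" by simp
  have "(\<integral>\<^sup>+x. ennreal (norm (v k x * w k x - f x * g x)) \<partial>M) \<le> ?S k" for k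
  proof -
    have "ennreal (norm (v k x * w k x - f x * g x)) \<le> ennreal (norm ((v k x - f x) * g x)) + 
       ennreal (norm ((w k x - g x) * f x)) + ennreal (norm ((v k x - f x) * (w k x - g x)))" for x
    proof -
      have "v k x * w k x - f x * g x = (v k x - f x) * g x + (w k x - g x) * f x + (v k x - f x) * (w k x - g x)"
        by (simp add: algebra_simps)
      hence "norm (v k x * w k x - f x * g x) \<le> norm ((v k x - f x) * g x) + 
         norm ((w k x - g x) * f x) + norm ((v k x - f x) * (w k x - g x))"
        by (metis norm_triangle_ineq norm_triangle_mono order_refl)
      thus ?thesis by (simp flip: ennreal_plus add: ennreal_leI del: norm_mult)
    qed
    hence "(\<integral>\<^sup>+x. ennreal (norm (v k x * w k x - f x * g x)) \<partial>M) \<le> 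
       (\<integral>\<^sup>+x. ennreal (norm ((v k x - f x) * g x)) + 
       ennreal (norm ((w k x - g x) * f x)) + ennreal (norm ((v k x - f x) * (w k x - g x))) \<partial>M)"
      by (rule nn_integral_mono)
    also have "\<dots> = ?S k"
      by (subst nn_integral_add, simp, simp, subst nn_integral_add) auto
    finally show ?thesis .
  qed
  hence "(\<lambda>k. \<integral>\<^sup>+x. ennreal (norm (v k x * w k x - f x * g x)) \<partial>M) \<longlonglongrightarrow> 0"
    by (intro tendsto_sandwich[OF _ _ tendsto_const S]) auto
  thus ?thesis
    by (intro tendsto_L1_int l2_pairing_integrable mv mw fv fw mf mg ff fg)
qed

text \<open>
  \<open>f\<close> is a limit of functions that are C1 in the second variable, \<open>D\<close> is the limit of their derivatives in
  that variable, and \<open>g0\<close>, \<open>g1\<close> are the limits of their values at its end points. Statements in the first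
  variable are obtained by composing with \<open>prod.swap\<close>.
\<close>

definition line_limit :: "real \<Rightarrow> real \<Rightarrow> (real \<times> real \<Rightarrow> complex) \<Rightarrow> (real \<times> real \<Rightarrow> complex) \<Rightarrow> 
    (real \<Rightarrow> complex) \<Rightarrow> (real \<Rightarrow> complex) \<Rightarrow> bool" where
  "line_limit a b f D g0 g1 \<longleftrightarrow>
     f \<in> borel_measurable borel \<and> D \<in> borel_measurable borel \<and>
     g0 \<in> borel_measurable borel \<and> g1 \<in> borel_measurable borel \<and>
     (\<exists>v dv. (\<forall>k. continuous_on UNIV (v k)) \<and> (\<forall>k. continuous_on UNIV (dv k)) \<and> 
        (\<forall>k x y. ((\<lambda>t. v k (x, t)) has_vector_derivative dv k (x, y)) (at y)) \<and>
        l2_lim (rct a b) v f \<and> l2_lim (rct a b) dv D \<and>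
        l2_lim (ivl a) (\<lambda>k x. v k (x, - b/2)) g0 \<and> l2_lim (ivl a) (\<lambda>k x. v k (x, b/2)) g1)"

section \<open>Continuous functions on the closed sets and the Green formula\<close>

lemma continuous_bounded_rct:
  fixes v :: "real \<times> real \<Rightarrow> complex"
  assumes "continuous_on UNIV v"
  obtains B where "\<And>p. p \<in> space (rct a b) \<Longrightarrow> norm (v p) \<le> B"
proof -
  have "compact (v ` cbox (-a/2,-b/2) (a/2,b/2))"
    by (intro compact_continuous_image continuous_on_subset[OF assms]) auto
  hence "bounded (v ` cbox (-a/2,-b/2) (a/2,b/2))" by (rule compact_imp_bounded)
  thus ?thesis using that unfolding bounded_iff
    by (auto simp: rct_eq_restrict space_restrict_space)
qed

lemma continuous_bounded_ivl:
  fixes v :: "real \<Rightarrow> complex"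
  assumes "continuous_on UNIV v"
  obtains B where "\<And>p. p \<in> space (ivl l) \<Longrightarrow> norm (v p) \<le> B"
proof -
  have "compact (v ` {- l/2..l/2})"
    by (intro compact_continuous_image continuous_on_subset[OF assms]) auto
  hence "bounded (v ` {-l/2..l/2})" by (rule compact_imp_bounded)
  then obtain B where "\<forall>x\<in>{-l/2..l/2}. norm (v x) \<le> B" unfolding bounded_iff by blast
  thus ?thesis by (intro that[of B]) (auto simp: space_ivl simp del: atLeastAtMost_iff)
qed

lemma continuous_integrable_rct:
  fixes v :: "real \<times> real \<Rightarrow> complex"
  assumes "continuous_on UNIV v" shows "integrable (rct a b) v"
proof -
  obtain B where B: "\<And>p. p \<in> space (rct a b) \<Longrightarrow> norm (v p) \<le> B" 
    using continuous_bounded_rct[OF assms] by blast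
  show ?thesis
    by (rule rctf.integrable_const_bound[of _ B])
       (auto intro!: AE_I2 B measurable_rct borel_measurable_continuous_onI assms)
qed

lemma continuous_integrable_ivl:
  fixes v :: "real \<Rightarrow> complex"
  assumes "continuous_on UNIV v" shows "integrable (ivl l) v"
proof -
  obtain B where B: "\<And>p. p \<in> space (ivl l) \<Longrightarrow> norm (v p) \<le> B" 
    using continuous_bounded_ivl[OF assms] by blast
  show ?thesis
    by (rule ivl.integrable_const_bound[of _ B])
       (use B in \<open>auto intro!: AE_I2 measurable_ivl borel_measurable_continuous_onI assms\<close>)
qed

lemma integrable_imp_square_nn:
  fixes v :: "'a \<Rightarrow> complex"
  assumes "integrable M (\<lambda>x. v x * cnj (v x))" 
  shows "(\<integral>\<^sup>+x. ennreal ((norm (v x))\<^sup>2) \<partial>M) < \<infinity>"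
  using assms by (simp add: integrable_iff_bounded norm_mult power2_eq_square)

lemma continuous_l2_rct:
  fixes v :: "real \<times> real \<Rightarrow> complex"
  assumes "continuous_on UNIV v" shows "(\<integral>\<^sup>+x. ennreal ((norm (v x))\<^sup>2) \<partial>rct a b) < \<infinity>"
  by (intro integrable_imp_square_nn continuous_integrable_rct continuous_intros assms)

lemma continuous_l2_ivl:
  fixes v :: "real \<Rightarrow> complex"
  assumes "continuous_on UNIV v" shows "(\<integral>\<^sup>+x. ennreal ((norm (v x))\<^sup>2) \<partial>ivl l) < \<infinity>"
  by (intro integrable_imp_square_nn continuous_integrable_ivl continuous_intros assms)

lemma integral_ivl_derivative:
  fixes F :: "real \<Rightarrow> complex"
  assumes "l \<ge> 0" "\<And>y. (F has_vector_derivative f y) (at y)" "continuous_on UNIV f"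
  shows "(\<integral>y. f y \<partial>ivl l) = F (l/2) - F (-l/2)"
proof -
  have "(\<integral>y. f y \<partial>ivl l) = (\<integral>y. indicator {- l/2..l/2} y *\<^sub>R f y \<partial>lborel)"
    unfolding ivl_def by (subst integral_restrict_space) auto
  also have "\<dots> = F (l/2) - F (-l/2)"
    using assms by (intro integral_FTC_Icc) 
      (auto intro: has_vector_derivative_at_within continuous_on_subset)
  finally show ?thesis .
qed

text \<open>For the approximants this is the product rule, the fundamental theorem of calculus on
  each line, and Fubini. Every term is a pairing of two sequences that converge in square mean, so
  the identity survives the limit. The pairing carries no conjugation, so that it can be used with
  exponentials as well as with conjugated fields.\<close>

lemma line_limit_green:
  assumes b: "b \<ge> 0" and 1: "line_limit a b f D g0 g1" and 2: "line_limit a b f' D' g0' g1'"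
  shows "(\<integral>p. D p * f' p \<partial>rct a b) + (\<integral>p. f p * D' p \<partial>rct a b) =
     (\<integral>x. g1 x * g1' x \<partial>ivl a) - (\<integral>x. g0 x * g0' x \<partial>ivl a)"
proof -
  obtain v dv where v: "\<And>k. continuous_on UNIV (v k)" "\<And>k. continuous_on UNIV (dv k)"
        "\<And>k x y. ((\<lambda>t. v k (x, t)) has_vector_derivative dv k (x, y)) (at y)"
        "l2_lim (rct a b) v f" "l2_lim (rct a b) dv D"
        "l2_lim (ivl a) (\<lambda>k x. v k (x, - b/2)) g0" "l2_lim (ivl a) (\<lambda>k x. v k (x, b/2)) g1"
    using 1 unfolding line_limit_def by blast
  obtain w dw where w: "\<And>k. continuous_on UNIV (w k)" "\<And>k. continuous_on UNIV (dw k)"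
        "\<And>k x y. ((\<lambda>t. w k (x, t)) has_vector_derivative dw k (x, y)) (at y)"
        "l2_lim (rct a b) w f'" "l2_lim (rct a b) dw D'"
        "l2_lim (ivl a) (\<lambda>k x. w k (x, - b/2)) g0'" "l2_lim (ivl a) (\<lambda>k x. w k (x, b/2)) g1'"
    using 2 unfolding line_limit_def by blast
  have m: "f \<in> borel_measurable borel" "D \<in> borel_measurable borel" 
     "g0 \<in> borel_measurable borel" "g1 \<in> borel_measurable borel"
     "f' \<in> borel_measurable borel" "D' \<in> borel_measurable borel" 
     "g0' \<in> borel_measurable borel" "g1' \<in> borel_measurable borel"
    using 1 2 unfolding line_limit_def by auto
  have c: "continuous_on UNIV (\<lambda>x. v k (x, t))" "continuous_on UNIV (\<lambda>x. w k (x, t))" for k t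
    using v(1)[of k] w(1)[of k]
    by (auto intro!: continuous_on_compose2[of UNIV _ UNIV "\<lambda>x. (x,t)"] continuous_intros)
  note mm = measurable_rct measurable_ivl borel_measurable_continuous_onI
  have "(\<integral>p. dv k p * w k p \<partial>rct a b) + (\<integral>p. v k p * dw k p \<partial>rct a b) =
     (\<integral>x. v k (x, b/2) * w k (x, b/2) \<partial>ivl a) - (\<integral>x. v k (x, -b/2) * w k (x, -b/2) \<partial>ivl a)" for k
  proof -
    have cc: "continuous_on UNIV (\<lambda>p. dv k p * w k p + v k p * dw k p)"
      by (intro continuous_intros v w)
    have "(\<integral>p. dv k p * w k p \<partial>rct a b) + (\<integral>p. v k p * dw k p \<partial>rct a b) = 
        (\<integral>p. dv k p * w k p + v k p * dw k p \<partial>rct a b)"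
      by (intro Bochner_Integration.integral_add[symmetric] continuous_integrable_rct continuous_intros v w)
    also have "\<dots> = (\<integral>x. \<integral>y. dv k (x,y) * w k (x,y) + v k (x,y) * dw k (x,y) \<partial>ivl b \<partial>ivl a)"
      unfolding rct_def
      by (intro rct.integral_fst'[symmetric] continuous_integrable_rct[unfolded rct_def] cc)
    also have "\<dots> = (\<integral>x. v k (x, b/2) * w k (x, b/2) - v k (x, -b/2) * w k (x, -b/2) \<partial>ivl a)"
    proof (intro Bochner_Integration.integral_cong refl integral_ivl_derivative b)
      fix x
      show "((\<lambda>y. v k (x, y) * w k (x, y)) has_vector_derivative
           dv k (x, y) * w k (x, y) + v k (x, y) * dw k (x, y)) (at y)" for y
        using has_vector_derivative_mult[OF v(3)[of k x y] w(3)[of k x y]] by (simp add: algebra_simps)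
      show "continuous_on UNIV (\<lambda>y. dv k (x, y) * w k (x, y) + v k (x, y) * dw k (x, y))"
        by (intro continuous_on_compose2[OF cc, of UNIV "\<lambda>y. (x,y)"] continuous_intros) auto
    qed
    also have "\<dots> = (\<integral>x. v k (x, b/2) * w k (x, b/2) \<partial>ivl a) - (\<integral>x. v k (x, -b/2) * w k (x, -b/2) \<partial>ivl a)"
      by (intro Bochner_Integration.integral_diff continuous_integrable_ivl continuous_intros c)
    finally show ?thesis .
  qed
  moreover have "(\<lambda>k. (\<integral>p. dv k p * w k p \<partial>rct a b) + (\<integral>p. v k p * dw k p \<partial>rct a b)) 
     \<longlonglongrightarrow> (\<integral>p. D p * f' p \<partial>rct a b) + (\<integral>p. f p * D' p \<partial>rct a b)"
    by (intro tendsto_add l2_pairing_tendsto mm v w m continuous_l2_rct)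
  moreover have "(\<lambda>k. (\<integral>x. v k (x, b/2) * w k (x, b/2) \<partial>ivl a) - (\<integral>x. v k (x, -b/2) * w k (x, -b/2) \<partial>ivl a))
     \<longlonglongrightarrow> (\<integral>x. g1 x * g1' x \<partial>ivl a) - (\<integral>x. g0 x * g0' x \<partial>ivl a)"
    by (intro tendsto_diff l2_pairing_tendsto mm v w m continuous_l2_ivl c)
  ultimately show ?thesis by (simp add: LIMSEQ_unique)
qed

section \<open>Absolute continuity on almost every line\<close>

text \<open>The end values are arguments because \<open>h\<close> matters only up to null sets, so
  that \<open>h (- b/2)\<close> carries no information. The gauge integral is used for the
  primitive, as in the fundamental theorem of calculus; \<open>integrable\<close> makes it agree
  with the Lebesgue integral.\<close>

definition ac_path :: "real \<Rightarrow> (real \<Rightarrow> complex) \<Rightarrow> (real \<Rightarrow> complex) \<Rightarrow> complex \<Rightarrow> complex \<Rightarrow> bool" where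
  "ac_path b h d h0 h1 \<longleftrightarrow> integrable (ivl b) d \<and> 
     (AE y in ivl b. h y = h0 + integral {- b/2..y} d) \<and> h1 = h0 + integral {- b/2..b/2} d"

lemma integrable_ivl_imp_set_integrable:
  fixes d :: "real \<Rightarrow> complex"
  assumes "integrable (ivl b) d" "y \<le> b/2"
  shows "set_integrable lborel {- b/2..y} d"
proof -
  have "set_integrable lborel {- b/2..b/2} d"
    using assms(1) unfolding ivl_def set_integrable_def by (subst (asm) integrable_restrict_space) auto
  thus ?thesis by (rule set_integrable_subset) (use assms in auto)
qed

lemma integral_ivl_atMost:
  fixes d :: "real \<Rightarrow> complex"
  assumes "integrable (ivl b) d" "y \<le> b/2"
  shows "(\<integral>t. indicator {..y} t *\<^sub>R d t \<partial>ivl b) = integral {- b/2..y} d"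
proof -
  have "(\<integral>t. indicator {..y} t *\<^sub>R d t \<partial>ivl b) = (\<integral>t. indicator {-b/2..b/2} t *\<^sub>R indicator {..y} t *\<^sub>R d t \<partial>lborel)"
    unfolding ivl_def by (subst integral_restrict_space) auto
  also have "\<dots> = (LINT t:{- b/2..y}|lborel. d t)"
    unfolding set_lebesgue_integral_def using assms(2)
    by (intro Bochner_Integration.integral_cong) (auto simp: indicator_def)
  also have "\<dots> = integral {- b/2..y} d"
    by (rule set_borel_integral_eq_integral(2)[OF integrable_ivl_imp_set_integrable[OF assms]])
  finally show ?thesis .
qed

lemma integrable_on_ivl:
  fixes d :: "real \<Rightarrow> complex"
  assumes "integrable (ivl b) d" "y \<le> b/2"
  shows "d integrable_on {- b/2..y}"
  by (rule set_borel_integral_eq_integral(1)[OF integrable_ivl_imp_set_integrable[OF assms]])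

lemma continuous_on_ivl_primitive:
  fixes d :: "real \<Rightarrow> complex"
  assumes "integrable (ivl b) d"
  shows "continuous_on {- b/2..b/2} (\<lambda>y. integral {- b/2..y} d)"
  by (rule indefinite_integral_continuous_1[OF integrable_on_ivl[OF assms order_refl]])

lemma borel_measurable_ivl_continuous:
  fixes F :: "real \<Rightarrow> complex"
  assumes "continuous_on {- b/2..b/2} F"
  shows "F \<in> borel_measurable (ivl b)"
  using borel_measurable_continuous_on_restrict[OF assms] unfolding ivl_def
  by (simp cong: measurable_cong_sets add: sets_restrict_space_cong[OF sets_lborel])

text \<open>Cauchy-Schwarz against the constant 1 on an interval of length \<open>b\<close>: square
  mean control of a derivative gives uniform control of its primitive.\<close>

lemma norm_primitive_square_le:
  fixes d :: "real \<Rightarrow> complex"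
  assumes "b > 0" "integrable (ivl b) d" "y \<le> b/2" "e \<ge> 0" 
    "(\<integral>\<^sup>+t. ennreal ((norm (d t))\<^sup>2) \<partial>ivl b) \<le> ennreal e"
  shows "(norm (integral {- b/2..y} d))\<^sup>2 \<le> e * b"
proof -
  have [measurable]: "d \<in> borel_measurable (ivl b)" using assms(2) by auto
  have [measurable]: "(\<lambda>t. indicator {..y} t :: real) \<in> borel_measurable (ivl b)" 
    by (rule measurable_ivl) simp
  have i: "integrable (ivl b) (\<lambda>t. indicator {..y} t *\<^sub>R d t)"
  proof (rule Bochner_Integration.integrable_bound[OF assms(2)])
    show "(\<lambda>t. indicator {..y} t *\<^sub>R d t) \<in> borel_measurable (ivl b)" by measurable
  qed (auto simp: indicator_def)
  have "ennreal (norm (integral {- b/2..y} d)) \<le> (\<integral>\<^sup>+t. ennreal (norm (indicator {..y} t *\<^sub>R d t)) \<partial>ivl b)"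
    unfolding integral_ivl_atMost[OF assms(2,3), symmetric] by (rule integral_norm_bound_ennreal[OF i])
  also have "\<dots> \<le> (\<integral>\<^sup>+t. ennreal (norm (d t)) * 1 \<partial>ivl b)"
    by (intro nn_integral_mono) (auto simp: indicator_def)
  finally have "(ennreal (norm (integral {- b/2..y} d)))\<^sup>2 \<le> (\<integral>\<^sup>+t. ennreal (norm (d t)) * 1 \<partial>ivl b)\<^sup>2"
    by (rule power_mono) simp
  also have "\<dots> \<le> (\<integral>\<^sup>+t. ennreal (norm (d t)) ^ 2 \<partial>ivl b) * (\<integral>\<^sup>+t. 1 ^ 2 \<partial>ivl b)"
    by (rule Cauchy_Schwarz_nn_integral) auto
  also have "\<dots> \<le> ennreal e * ennreal b"
    using assms(5) emeasure_ivl[OF assms(1)] by (intro mult_mono) (auto simp: ennreal_power)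
  finally have "ennreal ((norm (integral {- b/2..y} d))\<^sup>2) \<le> ennreal (e * b)"
    using assms by (simp add: ennreal_power ennreal_mult)
  thus ?thesis using assms by (simp add: ennreal_le_iff)
qed

text \<open>For a C1 approximant \<open>v\<close>, the deviation of \<open>h y\<close> from the
  claimed primitive is \<open>h y - v y\<close>, plus \<open>v (-b/2) - h0\<close>, plus the
  integral of \<open>dv - d\<close>, by the fundamental theorem for \<open>v\<close>. All three are
  small, so the square norm of the deviation is below every positive number; the end value
  \<open>h1\<close> is treated in the same way.\<close>

lemma ac_path_of_approximations:
  fixes h d :: "real \<Rightarrow> complex"
  assumes b: "b > 0" and m: "h \<in> borel_measurable (ivl b)" "d \<in> borel_measurable (ivl b)"
    and ex: "\<And>e. e > 0 \<Longrightarrow> \<exists>v dv. continuous_on UNIV dv \<and> (\<forall>y. (v has_vector_derivative dv y) (at y)) \<and>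
        (\<integral>\<^sup>+y. ennreal ((norm (v y - h y))\<^sup>2) \<partial>ivl b) \<le> ennreal e \<and>
        (\<integral>\<^sup>+y. ennreal ((norm (dv y - d y))\<^sup>2) \<partial>ivl b) \<le> ennreal e \<and>
        (norm (v (-b/2) - h0))\<^sup>2 \<le> e \<and> (norm (v (b/2) - h1))\<^sup>2 \<le> e"
  shows "ac_path b h d h0 h1"
proof -
  note [measurable] = m
  have int_d: "integrable (ivl b) d"
  proof -
    obtain v dv where v: "continuous_on UNIV dv" "(\<integral>\<^sup>+y. ennreal ((norm (dv y - d y))\<^sup>2) \<partial>ivl b) \<le> ennreal 1"
      using ex[of 1] by auto
    have [measurable]: "dv \<in> borel_measurable (ivl b)"
      by (intro measurable_ivl borel_measurable_continuous_onI v)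
    have "integrable (ivl b) (\<lambda>y. dv y - d y)"
    proof (rule integrableI_bounded)
      have "(\<integral>\<^sup>+y. ennreal (norm (dv y - d y)) \<partial>ivl b) \<le> (\<integral>\<^sup>+y. 1 + ennreal ((norm (dv y - d y))\<^sup>2) \<partial>ivl b)"
      proof (rule nn_integral_mono)
        fix y
        have "norm (dv y - d y) \<le> 1 + (norm (dv y - d y))\<^sup>2"
          using sum_squares_bound[of "norm (dv y - d y)" 1] norm_ge_zero[of "dv y - d y"]
          by (simp only: mult_1_right power_one)
        hence "ennreal (norm (dv y - d y)) \<le> ennreal (1 + (norm (dv y - d y))\<^sup>2)" by (rule ennreal_leI)
        thus "ennreal (norm (dv y - d y)) \<le> 1 + ennreal ((norm (dv y - d y))\<^sup>2)" by simp
      qed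
      also have "\<dots> < \<infinity>" using v(2) emeasure_ivl[OF b]
        by (subst nn_integral_add) (auto simp: less_top[symmetric] top_unique)
      finally show "(\<integral>\<^sup>+y. ennreal (norm (dv y - d y)) \<partial>ivl b) < \<infinity>" .
    qed auto
    from Bochner_Integration.integrable_diff[OF continuous_integrable_ivl[OF v(1)] this]
    show ?thesis by simp
  qed
  define R where "R y = h y - (h0 + integral {- b/2..y} d)" for y
  have [measurable]: "R \<in> borel_measurable (ivl b)"
    unfolding R_def using borel_measurable_ivl_continuous[OF continuous_on_ivl_primitive[OF int_d]] by measurable
  \<comment> \<open>\<open>h\<close> is quantified anew: the bound is integrated for the given
    \<open>h\<close> and later evaluated at \<open>b/2\<close> for the constant function
    \<open>h1\<close>. The constants 2 and 4 come from using \<open>norm_sum_square_le\<close>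
    twice.\<close>
  have bound: "(norm (h y - (h0 + integral {- b/2..y} d)))\<^sup>2 \<le> 2 * (norm (h y - v y))\<^sup>2 + (4 * e + 4 * (e * b))"
    if y: "y \<in> {- b/2..b/2}" and v: "continuous_on UNIV dv" "\<And>y. (v has_vector_derivative dv y) (at y)"
      "(\<integral>\<^sup>+y. ennreal ((norm (dv y - d y))\<^sup>2) \<partial>ivl b) \<le> ennreal e"
      "(norm (v (-b/2) - h0))\<^sup>2 \<le> e" "e > 0" for y v dv e h
  proof -
    have int_dv: "integrable (ivl b) dv" by (rule continuous_integrable_ivl[OF v(1)])
    have "(dv has_integral (v y - v (- b/2))) {- b/2..y}"
      using v(2) y by (intro fundamental_theorem_of_calculus) (auto intro: has_vector_derivative_at_within)
    hence vy: "integral {- b/2..y} dv = v y - v (-b/2)" by (rule integral_unique)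
    have "integral {- b/2..y} (\<lambda>y. dv y - d y) = (v y - v (-b/2)) - integral {- b/2..y} d"
      using Henstock_Kurzweil_Integration.integral_diff[OF integrable_on_ivl[OF int_dv, of y] 
          integrable_on_ivl[OF int_d, of y]] y vy by simp
    hence eq: "h y - (h0 + integral {- b/2..y} d) = (h y - v y) + ((v (-b/2) - h0) + integral {- b/2..y} (\<lambda>y. dv y - d y))"
      by simp
    have "(norm (integral {- b/2..y} (\<lambda>y. dv y - d y)))\<^sup>2 \<le> e * b"
      using y v by (intro norm_primitive_square_le b Bochner_Integration.integrable_diff int_dv int_d) auto
    thus ?thesis
      unfolding eq using v(4)
        norm_sum_square_le[of "h y - v y" "(v (-b/2) - h0) + integral {- b/2..y} (\<lambda>y. dv y - d y)"]
        norm_sum_square_le[of "v (-b/2) - h0" "integral {- b/2..y} (\<lambda>y. dv y - d y)"] by linarith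
  qed
  have "(\<integral>\<^sup>+y. ennreal ((norm (R y))\<^sup>2) \<partial>ivl b) \<le> 0"
  proof (rule ennreal_le_epsilon)
    fix e :: real assume e: "e > 0"
    \<comment> \<open>Integrating \<open>bound\<close> over length \<open>b\<close> costs
      \<open>2 * e'\<close> for its first term and \<open>(4 * e' + 4 * (e' * b)) * b\<close> for
      its constant term; the denominator makes the total \<open>e\<close>.\<close>
    define e' where "e' = e / (2 + (4 + 4 * b) * b)"
    have pos: "2 + (4 + 4 * b) * b > 0" using b by (simp add: add_pos_nonneg)
    have e': "e' > 0" unfolding e'_def using e pos by simp
    obtain v dv where v: "continuous_on UNIV dv" "\<And>y. (v has_vector_derivative dv y) (at y)"
        "(\<integral>\<^sup>+y. ennreal ((norm (v y - h y))\<^sup>2) \<partial>ivl b) \<le> ennreal e'"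
        "(\<integral>\<^sup>+y. ennreal ((norm (dv y - d y))\<^sup>2) \<partial>ivl b) \<le> ennreal e'"
        "(norm (v (-b/2) - h0))\<^sup>2 \<le> e'" using ex[OF e'] by blast
    have "continuous_on UNIV v" using v(2) 
      by (meson continuous_at_imp_continuous_on has_vector_derivative_continuous)
    hence [measurable]: "v \<in> borel_measurable (ivl b)"
      by (intro measurable_ivl borel_measurable_continuous_onI)
    have "(\<integral>\<^sup>+y. ennreal ((norm (R y))\<^sup>2) \<partial>ivl b) \<le> 
       (\<integral>\<^sup>+y. 2 * ennreal ((norm (v y - h y))\<^sup>2) + ennreal (4 * e' + 4 * (e' * b)) \<partial>ivl b)"
    proof (rule nn_integral_mono)
      fix y assume "y \<in> space (ivl b)"
      hence "ennreal ((norm (R y))\<^sup>2) \<le> ennreal (2 * (norm (h y - v y))\<^sup>2 + (4 * e' + 4 * (e' * b)))"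
        unfolding R_def by (intro ennreal_leI bound[OF _ v(1,2,4,5) e']) simp
      thus "ennreal ((norm (R y))\<^sup>2) \<le> 2 * ennreal ((norm (v y - h y))\<^sup>2) + ennreal (4 * e' + 4 * (e' * b))"
        using e' b by (simp add: ennreal_plus ennreal_mult norm_minus_commute del: ennreal_plus[symmetric])
    qed
    also have "\<dots> = 2 * (\<integral>\<^sup>+y. ennreal ((norm (v y - h y))\<^sup>2) \<partial>ivl b) + ennreal (4 * e' + 4 * (e' * b)) * ennreal b"
      using emeasure_ivl[OF b] by (subst nn_integral_add) (auto simp: nn_integral_cmult)
    also have "\<dots> \<le> 2 * ennreal e' + ennreal (4 * e' + 4 * (e' * b)) * ennreal b"
      by (intro add_mono mult_mono v) auto
    also have "\<dots> = ennreal (2 * e' + (4 * e' + 4 * (e' * b)) * b)"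
      using e' b by (simp add: ennreal_plus ennreal_mult)
    also have "2 * e' + (4 * e' + 4 * (e' * b)) * b = e' * (2 + (4 + 4 * b) * b)"
      by (simp add: algebra_simps)
    also have "\<dots> = e" unfolding e'_def using pos by simp
    finally show "(\<integral>\<^sup>+y. ennreal ((norm (R y))\<^sup>2) \<partial>ivl b) \<le> 0 + ennreal e" by simp
  qed
  hence "AE y in ivl b. ennreal ((norm (R y))\<^sup>2) = 0"
    by (subst nn_integral_0_iff_AE[symmetric]) auto
  hence 1: "AE y in ivl b. h y = h0 + integral {- b/2..y} d"
    by eventually_elim (auto simp: R_def)
  have "(norm (h1 - (h0 + integral {- b/2..b/2} d)))\<^sup>2 \<le> 0"
  proof (rule field_le_epsilon)
    fix e :: real assume e: "e > 0"
    \<comment> \<open>The same count at one point, hence without the factor \<open>b\<close> from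
      integration.\<close>
    define e' where "e' = e / (2 + (4 + 4 * b))"
    have e': "e' > 0" unfolding e'_def using e b by simp
    obtain v dv where v: "continuous_on UNIV dv" "\<And>y. (v has_vector_derivative dv y) (at y)"
        "(\<integral>\<^sup>+y. ennreal ((norm (dv y - d y))\<^sup>2) \<partial>ivl b) \<le> ennreal e'"
        "(norm (v (-b/2) - h0))\<^sup>2 \<le> e'" "(norm (v (b/2) - h1))\<^sup>2 \<le> e'" using ex[OF e'] by blast
    have "(norm (h1 - (h0 + integral {- b/2..b/2} d)))\<^sup>2 \<le> 2 * (norm (h1 - v (b/2)))\<^sup>2 + (4 * e' + 4 * (e' * b))"
      using bound[OF _ v(1-4) e', of "b/2" "\<lambda>_. h1"] b by simp
    also have "\<dots> \<le> 2 * e' + (4 * e' + 4 * (e' * b))" using v(5) by (simp add: norm_minus_commute)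
    also have "\<dots> = e' * (2 + (4 + 4 * b))" by (simp add: algebra_simps)
    also have "\<dots> = e" unfolding e'_def using b by simp
    finally show "(norm (h1 - (h0 + integral {- b/2..b/2} d)))\<^sup>2 \<le> 0 + e" by simp
  qed
  hence "h1 = h0 + integral {- b/2..b/2} d" by simp
  with 1 int_d show ?thesis unfolding ac_path_def by blast
qed

text \<open>
  By Fatou's lemma the lower limit of the approximation error on the line through \<open>x\<close> vanishes for almost
  every \<open>x\<close>, so on such a line the C1 functions come arbitrarily close, without passing to a subsequence.
\<close>

lemma line_limit_ac_path:
  assumes b: "b > 0" and 1: "line_limit a b f D g0 g1"
  shows "AE x in ivl a. ac_path b (\<lambda>y. f (x,y)) (\<lambda>y. D (x,y)) (g0 x) (g1 x)"
proof -
  obtain v dv where v: "\<And>k. continuous_on UNIV (v k)" "\<And>k. continuous_on UNIV (dv k)"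
        "\<And>k x y. ((\<lambda>t. v k (x, t)) has_vector_derivative dv k (x, y)) (at y)"
        "l2_lim (rct a b) v f" "l2_lim (rct a b) dv D"
        "l2_lim (ivl a) (\<lambda>k x. v k (x, - b/2)) g0" "l2_lim (ivl a) (\<lambda>k x. v k (x, b/2)) g1"
    using 1 unfolding line_limit_def by blast
  have m: "f \<in> borel_measurable borel" "D \<in> borel_measurable borel" 
     "g0 \<in> borel_measurable borel" "g1 \<in> borel_measurable borel"
    using 1 unfolding line_limit_def by auto
  note [measurable] = m(1,2)[THEN measurable_rct, where a = a and b = b, unfolded rct_def]
     m(3,4)[THEN measurable_ivl, where l = a]
     measurable_rct[OF borel_measurable_continuous_onI[OF v(1)], where a = a and b = b, unfolded rct_def]
     measurable_rct[OF borel_measurable_continuous_onI[OF v(2)], where a = a and b = b, unfolded rct_def]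
  have c: "continuous_on UNIV (\<lambda>x. v k (x, t))" for k t
    using v(1)[of k] 
    by (auto intro!: continuous_on_compose2[of UNIV _ UNIV "\<lambda>x. (x,t)"] continuous_intros)
  note [measurable] = measurable_ivl[OF borel_measurable_continuous_onI[OF c], where l = a]
  \<comment> \<open>The four errors are added so that one index makes all of them small on the line
    through \<open>x\<close> simultaneously.\<close>
  define E where "E k x = (\<integral>\<^sup>+y. ennreal ((norm (v k (x,y) - f (x,y)))\<^sup>2) \<partial>ivl b) + 
     (\<integral>\<^sup>+y. ennreal ((norm (dv k (x,y) - D (x,y)))\<^sup>2) \<partial>ivl b) +
     ennreal ((norm (v k (x, - b/2) - g0 x))\<^sup>2) + ennreal ((norm (v k (x, b/2) - g1 x))\<^sup>2)" for k x
  have mE [measurable]: "E k \<in> borel_measurable (ivl a)" for k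
    unfolding E_def by measurable
  have "(\<integral>\<^sup>+x. E k x \<partial>ivl a) = (\<integral>\<^sup>+p. ennreal ((norm (v k p - f p))\<^sup>2) \<partial>rct a b) + 
     (\<integral>\<^sup>+p. ennreal ((norm (dv k p - D p))\<^sup>2) \<partial>rct a b) +
     (\<integral>\<^sup>+x. ennreal ((norm (v k (x, - b/2) - g0 x))\<^sup>2) \<partial>ivl a) + 
     (\<integral>\<^sup>+x. ennreal ((norm (v k (x, b/2) - g1 x))\<^sup>2) \<partial>ivl a)" for k
  proof -
    have it: "(\<integral>\<^sup>+x. \<integral>\<^sup>+y. ennreal ((norm (v k (x,y) - f (x,y)))\<^sup>2) \<partial>ivl b \<partial>ivl a) = 
        (\<integral>\<^sup>+p. ennreal ((norm (v k p - f p))\<^sup>2) \<partial>(ivl a \<Otimes>\<^sub>M ivl b))"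
      "(\<integral>\<^sup>+x. \<integral>\<^sup>+y. ennreal ((norm (dv k (x,y) - D (x,y)))\<^sup>2) \<partial>ivl b \<partial>ivl a) = 
        (\<integral>\<^sup>+p. ennreal ((norm (dv k p - D p))\<^sup>2) \<partial>(ivl a \<Otimes>\<^sub>M ivl b))"
      by (rule ivl.nn_integral_fst, measurable)+
    show ?thesis unfolding E_def rct_def it[symmetric]
      by (simp add: nn_integral_add)
  qed
  moreover have "(\<lambda>k. (\<integral>\<^sup>+p. ennreal ((norm (v k p - f p))\<^sup>2) \<partial>rct a b) + 
     (\<integral>\<^sup>+p. ennreal ((norm (dv k p - D p))\<^sup>2) \<partial>rct a b) +
     (\<integral>\<^sup>+x. ennreal ((norm (v k (x, - b/2) - g0 x))\<^sup>2) \<partial>ivl a) + 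
     (\<integral>\<^sup>+x. ennreal ((norm (v k (x, b/2) - g1 x))\<^sup>2) \<partial>ivl a)) \<longlonglongrightarrow> 0 + 0 + 0 + 0"
    by (intro tendsto_add v(4-7)[unfolded l2_lim_def])
  ultimately have lim: "(\<lambda>k. \<integral>\<^sup>+x. E k x \<partial>ivl a) \<longlonglongrightarrow> 0" by simp
  have "(\<integral>\<^sup>+x. liminf (\<lambda>k. E k x) \<partial>ivl a) \<le> liminf (\<lambda>k. \<integral>\<^sup>+x. E k x \<partial>ivl a)"
    by (rule nn_integral_liminf) simp
  also have "\<dots> = 0" using lim_imp_Liminf[OF _ lim] by simp
  finally have "AE x in ivl a. liminf (\<lambda>k. E k x) = 0"
    by (subst nn_integral_0_iff_AE[symmetric]) auto
  moreover have "AE x in ivl a. x \<in> space (ivl a)" by (rule AE_space)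
  ultimately show ?thesis
  proof eventually_elim
    case (elim x)
    show ?case
    proof (rule ac_path_of_approximations[OF b])
      show "(\<lambda>y. f (x, y)) \<in> borel_measurable (ivl b)" "(\<lambda>y. D (x, y)) \<in> borel_measurable (ivl b)"
        using elim(2) by measurable
      fix e :: real assume e: "e > 0"
      have "\<exists>k. E k x < ennreal e"
      proof (rule ccontr)
        assume "\<not> (\<exists>k. E k x < ennreal e)"
        hence "ennreal e \<le> liminf (\<lambda>k. E k x)"
          by (intro Liminf_bounded) (auto simp: not_less)
        thus False using elim(1) e by simp
      qed
      then obtain k where k: "E k x < ennreal e" by blast
      have "(\<integral>\<^sup>+y. ennreal ((norm (v k (x,y) - f (x,y)))\<^sup>2) \<partial>ivl b) \<le> E k x"
        "(\<integral>\<^sup>+y. ennreal ((norm (dv k (x,y) - D (x,y)))\<^sup>2) \<partial>ivl b) \<le> E k x"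
        "ennreal ((norm (v k (x, - b/2) - g0 x))\<^sup>2) \<le> E k x" "ennreal ((norm (v k (x, b/2) - g1 x))\<^sup>2) \<le> E k x"
        unfolding E_def by (simp_all add: add_increasing add_increasing2)
      with k have kk: "(\<integral>\<^sup>+y. ennreal ((norm (v k (x,y) - f (x,y)))\<^sup>2) \<partial>ivl b) \<le> ennreal e"
        "(\<integral>\<^sup>+y. ennreal ((norm (dv k (x,y) - D (x,y)))\<^sup>2) \<partial>ivl b) \<le> ennreal e"
        "ennreal ((norm (v k (x, - b/2) - g0 x))\<^sup>2) \<le> ennreal e" "ennreal ((norm (v k (x, b/2) - g1 x))\<^sup>2) \<le> ennreal e"
        by auto
      have "continuous_on UNIV (\<lambda>y. dv k (x, y))"
        by (intro continuous_on_compose2[OF v(2), of UNIV "\<lambda>y. (x,y)"] continuous_intros) auto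
      with kk v(3) e show "\<exists>w dw. continuous_on UNIV dw \<and> (\<forall>y. (w has_vector_derivative dw y) (at y)) \<and>
        (\<integral>\<^sup>+y. ennreal ((norm (w y - f (x,y)))\<^sup>2) \<partial>ivl b) \<le> ennreal e \<and>
        (\<integral>\<^sup>+y. ennreal ((norm (dw y - D (x,y)))\<^sup>2) \<partial>ivl b) \<le> ennreal e \<and>
        (norm (w (-b/2) - g0 x))\<^sup>2 \<le> e \<and> (norm (w (b/2) - g1 x))\<^sup>2 \<le> e"
        by (intro exI[of _ "\<lambda>y. v k (x,y)"] exI[of _ "\<lambda>y. dv k (x,y)"]) (auto simp: ennreal_le_iff)
    qed
  qed
qed

section \<open>Linearity, uniqueness and the equation h' = k h on a single line\<close>

lemma ac_path_lincomb:
  assumes "ac_path b h d h0 h1" "ac_path b k e k0 k1"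
  shows "ac_path b (\<lambda>y. p * h y + q * k y) (\<lambda>y. p * d y + q * e y) (p * h0 + q * k0) (p * h1 + q * k1)"
proof -
  have i: "integrable (ivl b) d" "integrable (ivl b) e" 
    and ae: "AE y in ivl b. h y = h0 + integral {- b/2..y} d" "AE y in ivl b. k y = k0 + integral {- b/2..y} e"
    and e: "h1 = h0 + integral {- b/2..b/2} d" "k1 = k0 + integral {- b/2..b/2} e"
    using assms unfolding ac_path_def by auto
  have *: "integral {- b/2..y} (\<lambda>y. p * d y + q * e y) = p * integral {- b/2..y} d + q * integral {- b/2..y} e" 
    if "y \<le> b/2" for y
    using integrable_on_ivl[OF i(1) that] integrable_on_ivl[OF i(2) that]
    by (subst Henstock_Kurzweil_Integration.integral_add) (auto intro: integrable_on_mult_right)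
  have "AE y in ivl b. y \<in> space (ivl b)" by (rule AE_space)
  with ae have "AE y in ivl b. p * h y + q * k y = (p * h0 + q * k0) + integral {- b/2..y} (\<lambda>y. p * d y + q * e y)"
  proof eventually_elim
    case (elim y)
    thus ?case using *[of y] by (simp add: algebra_simps)
  qed
  thus ?thesis unfolding ac_path_def using i e *[OF order_refl]
    by (simp add: algebra_simps)
qed

text \<open>Inside the open interval the nonzero set is open and negligible, hence empty. The end
  points follow by closure, which is how an almost everywhere statement reaches boundary
  values.\<close>

lemma continuous_AE_zero:
  fixes F :: "real \<Rightarrow> complex"
  assumes "b > 0" "continuous_on {- b/2..b/2} F" "AE y in ivl b. F y = 0" "y \<in> {- b/2..b/2}"
  shows "F y = 0"
proof -
  define U where "U = {- b/2<..<b/2} \<inter> F -` (- {0})"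
  have "open U" unfolding U_def
    by (intro continuous_open_preimage continuous_on_subset[OF assms(2)]) auto
  have "negligible U"
  proof -
    have "AE y in lborel. y \<in> {- b/2..b/2} \<longrightarrow> F y = 0"
      using assms(3) unfolding ivl_def by (subst (asm) AE_restrict_space_iff) auto
    hence "AE y in lebesgue. y \<notin> U" 
      by (auto simp: AE_completion_iff U_def elim: eventually_mono)
    moreover have "U \<in> sets lebesgue" using \<open>open U\<close> by simp
    ultimately show ?thesis by (simp add: AE_iff_null_sets negligible_iff_null_sets)
  qed
  with \<open>open U\<close> have "U = {}" using open_not_negligible by blast
  hence "\<And>y. y \<in> {- b/2<..<b/2} \<Longrightarrow> F y = 0" unfolding U_def by blast
  moreover have "closure {- b/2<..<b/2} = {- b/2..b/2}" using assms(1) by simp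
  ultimately show ?thesis using assms(2,4)
    by (intro continuous_constant_on_closure[of "{- b/2<..<b/2}" F 0 y]) simp_all
qed

text \<open>The integral of \<open>d\<close> vanishes over the half-lines \<open>{..y}\<close>, an
  intersection-stable generator of the Borel sets. A Dynkin argument extends this to all Borel sets,
  and uniqueness of densities applies to the real and imaginary parts.\<close>

lemma AE_eq_0_if_primitive_0:
  fixes d :: "real \<Rightarrow> complex"
  assumes i: "integrable (ivl b) d" and z: "\<And>y. y \<le> b/2 \<Longrightarrow> integral {- b/2..y} d = 0"
  shows "AE y in ivl b. d y = 0"
proof -
  have [measurable]: "d \<in> borel_measurable (ivl b)" using i by auto
  let ?J = "\<lambda>A. \<integral>t. indicator A t *\<^sub>R d t \<partial>ivl b"
  have ii: "integrable (ivl b) (\<lambda>t. indicator A t *\<^sub>R d t)" if "A \<in> sets borel" for A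
  proof (rule Bochner_Integration.integrable_bound[OF i])
    have [measurable]: "(\<lambda>t. indicator A t :: real) \<in> borel_measurable (ivl b)" 
      by (rule measurable_ivl) (use that in simp)
    show "(\<lambda>t. indicator A t *\<^sub>R d t) \<in> borel_measurable (ivl b)" by measurable
  qed (auto simp: indicator_def)
  have atMost: "?J {..y} = 0" for y
  proof (cases "y \<le> b/2")
    case True thus ?thesis using integral_ivl_atMost[OF i True] z[OF True] by simp
  next
    case False
    hence "?J {..y} = ?J {..b/2}"
      by (intro Bochner_Integration.integral_cong) (auto simp: indicator_def)
    thus ?thesis using integral_ivl_atMost[OF i order_refl] z[OF order_refl] by simp
  qed
  have full: "?J UNIV = 0"
  proof -
    have "?J UNIV = ?J {..b/2}"
      by (intro Bochner_Integration.integral_cong) (auto simp: indicator_def)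
    thus ?thesis using atMost by simp
  qed
  have J: "?J A = 0" if "A \<in> sets borel" for A
  proof -
    have A: "A \<in> sigma_sets UNIV (range atMost)"
      using that by (simp add: borel_eq_atMost)
    have I: "Int_stable (range (atMost :: real \<Rightarrow> _))"
      by (auto simp: Int_stable_def)
    have P: "range (atMost :: real \<Rightarrow> _) \<subseteq> Pow UNIV" by simp
    from A show ?thesis
    proof (induction A rule: sigma_sets_induct_disjoint[OF I P, consumes 1, case_names basic empty compl union])
      case (compl A)
      hence A: "A \<in> sets borel" by (simp add: borel_eq_atMost)
      have U: "(UNIV :: real set) \<in> sets borel" by simp
      have "?J (UNIV - A) = ?J UNIV - ?J A"
        unfolding Bochner_Integration.integral_diff[OF ii[OF U] ii[OF A], symmetric]
        by (intro Bochner_Integration.integral_cong) (auto simp: indicator_def)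
      thus ?case using full compl by simp
    next
      case (union A)
      hence A: "\<And>i. A i \<in> sets borel" by (auto simp: borel_eq_atMost)
      \<comment> \<open>Extension by zero, so that countable additivity of set integrals is
        available over \<open>lborel\<close>.\<close>
      let ?d = "\<lambda>t. indicator {- b/2..b/2} t *\<^sub>R d t"
      have lb: "?J B = (LINT t:B|lborel. ?d t)" for B
        unfolding ivl_def set_lebesgue_integral_def
        by (subst integral_restrict_space) (auto intro!: Bochner_Integration.integral_cong simp: indicator_def)
      have "integrable lborel ?d"
        using i unfolding ivl_def by (subst (asm) integrable_restrict_space) auto
      hence "set_integrable lborel (\<Union>i. A i) ?d"
        unfolding set_integrable_def 
        by (rule integrable_mult_indicator[rotated]) (use A in \<open>simp add: sets.countable_UN\<close>)
      hence "(LINT t:(\<Union>i. A i)|lborel. ?d t) = (\<Sum>i. LINT t:A i|lborel. ?d t)"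
        using A union(1) by (intro lebesgue_integral_countable_add) (auto simp: disjoint_family_on_def)
      thus ?case using union(3) unfolding lb by simp
    qed (auto simp: atMost)
  qed
  have sets: "A \<in> sets borel" if "A \<in> sets (ivl b)" for A
    using that by (auto simp: ivl_def sets_restrict_space_iff)
  have s: "(\<integral>x\<in>A. c (d x) \<partial>ivl b) = 0" if "A \<in> sets (ivl b)" "bounded_linear c" for A and c :: "complex \<Rightarrow> real"
  proof -
    interpret bounded_linear c by fact
    have "(\<integral>x\<in>A. c (d x) \<partial>ivl b) = (\<integral>x. c (indicator A x *\<^sub>R d x) \<partial>ivl b)"
      by (simp add: set_lebesgue_integral_def scaleR)
    also have "\<dots> = c (?J A)" by (rule integral_bounded_linear[OF that(2) ii[OF sets[OF that(1)]]])
    finally show ?thesis using J[OF sets[OF that(1)]] zero by simp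
  qed
  have "AE x in ivl b. Re (d x) = 0" "AE x in ivl b. Im (d x) = 0"
    using i s[OF _ bounded_linear_Re] s[OF _ bounded_linear_Im]
    by (intro density_unique_real; auto simp: set_lebesgue_integral_def)+
  thus ?thesis by eventually_elim (simp add: complex_eq_iff)
qed

text \<open>The continuous representative of \<open>h\<close> vanishes almost everywhere, hence
  everywhere; its values at the end points are \<open>h0\<close> and \<open>h1\<close>, and the
  remaining primitive is zero.\<close>

lemma ac_path_zero:
  assumes b: "b > 0" and p: "ac_path b h d h0 h1" and z: "AE y in ivl b. h y = 0"
  shows "h0 = 0" "h1 = 0" "AE y in ivl b. d y = 0"
proof -
  have i: "integrable (ivl b) d" 
    and ae: "AE y in ivl b. h y = h0 + integral {- b/2..y} d"
    and e: "h1 = h0 + integral {- b/2..b/2} d"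
    using p unfolding ac_path_def by auto
  have c: "continuous_on {- b/2..b/2} (\<lambda>y. h0 + integral {- b/2..y} d)"
    by (intro continuous_intros continuous_on_ivl_primitive i)
  have "AE y in ivl b. h0 + integral {- b/2..y} d = 0"
    using ae z by eventually_elim simp
  note zero = continuous_AE_zero[OF b c this]
  show h0: "h0 = 0" using zero[of "-b/2"] b by simp
  show "h1 = 0" using zero[of "b/2"] b e by simp
  show "AE y in ivl b. d y = 0"
  proof (rule AE_eq_0_if_primitive_0[OF i])
    fix y assume "y \<le> b/2"
    thus "integral {- b/2..y} d = 0" 
      using zero[of y] h0 by (cases "- b/2 \<le> y") auto
  qed
qed

text \<open>The vehicle by which boundary values and derivatives are compared through almost
  everywhere identities; it applies \<open>ac_path_zero\<close> to the difference.\<close>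

lemma ac_path_unique:
  assumes b: "b > 0" and "ac_path b h d h0 h1" "ac_path b k e k0 k1" "AE y in ivl b. h y = k y"
  shows "h0 = k0" "h1 = k1" "AE y in ivl b. d y = e y"
proof -
  note l = ac_path_lincomb[OF assms(2,3), of 1 "-1"]
  have "AE y in ivl b. 1 * h y + - 1 * k y = 0" using assms(4) by eventually_elim simp
  from ac_path_zero[OF b l this] show "h0 = k0" "h1 = k1" "AE y in ivl b. d y = e y"
    by (auto elim: eventually_mono)
qed

text \<open>The continuous representative times \<open>exp (- k y)\<close> is constant, and a zero
  end value makes that constant zero. Used by contraposition: a nontrivial solution is nonzero at
  both ends.\<close>

lemma ac_path_exp:
  assumes b: "b > 0" and p: "ac_path b h d h0 h1" and d: "AE y in ivl b. d y = k * h y"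
    and z: "h0 = 0 \<or> h1 = 0"
  shows "AE y in ivl b. h y = 0"
proof -
  have i: "integrable (ivl b) d" 
    and ae: "AE y in ivl b. h y = h0 + integral {- b/2..y} d"
    and e: "h1 = h0 + integral {- b/2..b/2} d"
    using p unfolding ac_path_def by auto
  define H where "H y = h0 + integral {- b/2..y} d" for y
  have c: "continuous_on {- b/2..b/2} H"
    unfolding H_def by (intro continuous_intros continuous_on_ivl_primitive i)
  have d': "AE y in ivl b. d y = k * H y"
    using d ae unfolding H_def by eventually_elim simp
  have [measurable]: "d \<in> borel_measurable (ivl b)" "H \<in> borel_measurable (ivl b)"
    using i borel_measurable_ivl_continuous[OF c] by auto
  have iH: "integrable (ivl b) (\<lambda>y. k * H y)"
    by (rule iffD1[OF integrable_cong_AE[OF _ _ d'] i]) measurable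
  \<comment> \<open>Replacing \<open>d\<close> by \<open>k * H\<close> under the integral makes the
    integrand continuous, so \<open>H\<close> is differentiable at every point.\<close>
  have eq: "integral {- b/2..y} d = integral {- b/2..y} (\<lambda>y. k * H y)" if "y \<le> b/2" for y
  proof -
    have [measurable]: "(\<lambda>t. indicator {..y} t :: real) \<in> borel_measurable (ivl b)" 
      by (rule measurable_ivl) simp
    show ?thesis
      unfolding integral_ivl_atMost[OF i that, symmetric] integral_ivl_atMost[OF iH that, symmetric]
    proof (rule integral_cong_AE)
      show "AE t in ivl b. indicator {..y} t *\<^sub>R d t = indicator {..y} t *\<^sub>R (k * H t)"
        using d' by eventually_elim simp
      show "(\<lambda>t. indicator {..y} t *\<^sub>R d t) \<in> borel_measurable (ivl b)"
        "(\<lambda>t. indicator {..y} t *\<^sub>R (k * H t)) \<in> borel_measurable (ivl b)" by measurable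
    qed
  qed
  have deriv: "(H has_vector_derivative k * H y) (at y within {- b/2..b/2})" if "y \<in> {- b/2..b/2}" for y
  proof -
    have "((\<lambda>y. integral {- b/2..y} (\<lambda>y. k * H y)) has_vector_derivative k * H y) (at y within {- b/2..b/2})"
      by (intro integral_has_vector_derivative continuous_intros c that)
    hence "((\<lambda>y. h0 + integral {- b/2..y} (\<lambda>y. k * H y)) has_vector_derivative k * H y) (at y within {- b/2..b/2})"
      using has_vector_derivative_add[OF has_vector_derivative_const[of h0]] by (simp only: add_0)
    thus ?thesis
      by (rule has_vector_derivative_transform[rotated 2]) (use that eq in \<open>auto simp: H_def\<close>)
  qed
  obtain C where C: "\<And>y. y\<in>{- b/2..b/2} \<Longrightarrow> H y * exp (- (k * of_real y)) = C"
  proof (rule has_vector_derivative_zero_constant)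
    show "convex {- b/2..b/2}" by simp
    show "((\<lambda>y. H y * exp (- (k * of_real y))) has_vector_derivative 0) (at y within {- b/2..b/2})" if "y \<in> {- b/2..b/2}" for y
    proof -
      have "((\<lambda>y. exp (- (k * of_real y))) has_vector_derivative (- k) * exp (- (k * of_real y))) (at y within {- b/2..b/2})"
        by (intro has_vector_derivative_real_field) (auto intro!: derivative_eq_intros)
      from has_vector_derivative_mult[OF deriv[OF that] this] show ?thesis by (simp add: algebra_simps)
    qed
  qed blast
  have "H (-b/2) = h0" "H (b/2) = h1" unfolding H_def e using b by auto
  hence "C = 0" using z C[of "-b/2"] C[of "b/2"] b by auto
  hence "H y = 0" if "y \<in> {- b/2..b/2}" for y using C[OF that] by simp
  moreover have "AE y in ivl b. y \<in> space (ivl b)" by (rule AE_space)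
  ultimately show ?thesis using ae unfolding H_def by (auto elim: eventually_elim2)
qed

section \<open>Exponential transforms\<close>

text \<open>These are the real polynomials in \<open>exp x\<close> and \<open>exp y\<close>: natural
  exponents keep the class closed under products, as Stone-Weierstrass requires.\<close>

inductive exp_poly :: "(real \<times> real \<Rightarrow> real) \<Rightarrow> bool" where
  monomial: "exp_poly (\<lambda>p. c * exp (real j * fst p + real k * snd p))"
| add: "exp_poly f \<Longrightarrow> exp_poly g \<Longrightarrow> exp_poly (\<lambda>p. f p + g p)"

lemma exp_poly_const: "exp_poly (\<lambda>p. c)"
  using exp_poly.monomial[of c 0 0] by simp

lemma exp_poly_mult:
  assumes "exp_poly f" "exp_poly g" shows "exp_poly (\<lambda>p. f p * g p)"
  using assms
proof (induction f)
  case (monomial c j k)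
  from this show ?case
  proof (induction g)
    case (monomial c' j' k')
    have "(\<lambda>p. c * exp (real j * fst p + real k * snd p) * (c' * exp (real j' * fst p + real k' * snd p))) = 
       (\<lambda>p. (c * c') * exp (real (j + j') * fst p + real (k + k') * snd p))"
      by (auto simp: fun_eq_iff algebra_simps simp flip: exp_add)
    thus ?case using exp_poly.monomial by metis
  next
    case (add g h)
    thus ?case using exp_poly.add by (simp add: distrib_left)
  qed
next
  case (add f h)
  thus ?case using exp_poly.add by (simp add: distrib_right)
qed

lemma exp_poly_continuous: "exp_poly f \<Longrightarrow> continuous_on S f"
  by (induction rule: exp_poly.induct) (auto intro!: continuous_intros)

lemma exp_poly_approx:
  assumes "compact S" "continuous_on S c" "e > 0"
  shows "\<exists>g. exp_poly g \<and> (\<forall>p\<in>S. \<bar>c p - g p\<bar> < e)"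
proof (rule Stone_Weierstrass_HOL[where P = exp_poly])
  show "\<exists>f. exp_poly f \<and> f x \<noteq> f y" if "x \<in> S \<and> y \<in> S \<and> x \<noteq> y" for x y
  proof (cases "fst x = fst y")
    case False
    thus ?thesis by (intro exI[of _ "\<lambda>p. 1 * exp (real 1 * fst p + real 0 * snd p)"] conjI exp_poly.monomial) simp
  next
    case True
    hence "snd x \<noteq> snd y" using that by (simp add: prod_eq_iff)
    thus ?thesis by (intro exI[of _ "\<lambda>p. 1 * exp (real 0 * fst p + real 1 * snd p)"] conjI exp_poly.monomial) simp
  qed
qed (use assms exp_poly_const exp_poly_continuous exp_poly.add exp_poly_mult in auto)

lemma integrable_times_continuous:
  fixes f :: "real \<times> real \<Rightarrow> complex"
  assumes "integrable (rct a b) f" "continuous_on UNIV w"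
  shows "integrable (rct a b) (\<lambda>p. f p * w p)"
proof -
  obtain B where B: "\<And>p. p \<in> space (rct a b) \<Longrightarrow> norm (w p) \<le> B" 
    using continuous_bounded_rct[OF assms(2)] by blast
  have [measurable]: "f \<in> borel_measurable (rct a b)" "w \<in> borel_measurable (rct a b)"
    using assms by (auto intro: measurable_rct borel_measurable_continuous_onI)
  show ?thesis
  proof (rule Bochner_Integration.integrable_bound[of _ "\<lambda>p. of_real B * f p"])
    show "AE p in rct a b. norm (f p * w p) \<le> norm (of_real B * f p)"
    proof (rule AE_I2)
      fix p assume "p \<in> space (rct a b)"
      hence "norm (w p) \<le> \<bar>B\<bar>" using B by (meson abs_ge_self order_trans)
      hence "norm (w p) * norm (f p) \<le> \<bar>B\<bar> * norm (f p)" by (rule mult_right_mono) simp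
      thus "norm (f p * w p) \<le> norm (of_real B * f p)" by (simp add: norm_mult mult.commute)
    qed
  qed (use assms in auto)
qed

text \<open>Orthogonality passes from exponentials to continuous functions by uniform approximation,
  and then to the conjugate phase \<open>s\<close> of \<open>f\<close> by dominated convergence.
  Since \<open>f * s\<close> is the modulus of \<open>f\<close>, the L1 norm of \<open>f\<close> is
  zero.\<close>

lemma AE_eq_0_if_orthogonal_exp:
  fixes f :: "real \<times> real \<Rightarrow> complex"
  assumes m [measurable]: "f \<in> borel_measurable borel" and i: "integrable (rct a b) f"
    and orth: "\<And>j k :: nat. (\<integral>p. f p * of_real (exp (real j * fst p + real k * snd p)) \<partial>rct a b) = 0"
  shows "AE p in rct a b. f p = 0"
proof -
  note [measurable] = measurable_rct[OF m, of a b]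
  have cont: "continuous_on UNIV (\<lambda>p. complex_of_real (w p))" if "continuous_on UNIV w" for w :: "real \<times> real \<Rightarrow> real"
    by (intro continuous_intros that)
  have poly: "(\<integral>p. f p * of_real (g p) \<partial>rct a b) = 0" if "exp_poly g" for g
    using that
  proof (induction g)
    case (monomial c j k)
    have "(\<integral>p. f p * of_real (c * exp (real j * fst p + real k * snd p)) \<partial>rct a b) = 
       (\<integral>p. of_real c * (f p * of_real (exp (real j * fst p + real k * snd p))) \<partial>rct a b)"
      by (intro Bochner_Integration.integral_cong) auto
    thus ?case using orth by simp
  next
    case (add g h)
    thus ?case 
      by (simp add: distrib_left integrable_times_continuous[OF i cont[OF exp_poly_continuous]])
  qed
  have cts: "(\<integral>p. f p * of_real (c p) \<partial>rct a b) = 0" if c: "continuous_on UNIV c" for c :: "real \<times> real \<Rightarrow> real"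
  proof -
    let ?A = "\<integral>p. norm (f p) \<partial>rct a b"
    have "norm (\<integral>p. f p * of_real (c p) \<partial>rct a b) \<le> 0"
    proof (rule field_le_epsilon)
      fix e :: real assume e: "e > 0"
      have A: "?A \<ge> 0" by simp
      have frac: "x / (x + 1) \<le> 1" if "x \<ge> 0" for x :: real using that by simp
      \<comment> \<open>The \<open>+ 1\<close> keeps the tolerance positive when \<open>?A\<close>
        is zero; \<open>frac\<close> absorbs it at the end.\<close>
      obtain g where g: "exp_poly g" "\<And>p. p \<in> cbox (-a/2,-b/2) (a/2,b/2) \<Longrightarrow> \<bar>c p - g p\<bar> < e / (?A + 1)"
        using exp_poly_approx[OF compact_cbox continuous_on_subset[OF c], of "(-a/2,-b/2)" "(a/2,b/2)" "e / (?A + 1)"] e A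
        by auto
      have "(\<integral>p. f p * of_real (c p) \<partial>rct a b) = (\<integral>p. f p * of_real (c p) \<partial>rct a b) - (\<integral>p. f p * of_real (g p) \<partial>rct a b)"
        by (simp add: poly[OF g(1)])
      also have "\<dots> = (\<integral>p. f p * of_real (c p) - f p * of_real (g p) \<partial>rct a b)"
        by (intro Bochner_Integration.integral_diff[symmetric] integrable_times_continuous i cont c
              exp_poly_continuous g)
      also have "norm \<dots> \<le> (\<integral>p. e / (?A + 1) * norm (f p) \<partial>rct a b)"
      proof (rule Bochner_Integration.integral_norm_bound_integral)
        fix p assume "p \<in> space (rct a b)"
        hence "p \<in> cbox (-a/2,-b/2) (a/2,b/2)" by (simp add: rct_eq_restrict space_restrict_space)
        from g(2)[OF this] have "\<bar>c p - g p\<bar> * norm (f p) \<le> e / (?A + 1) * norm (f p)" 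
          by (intro mult_right_mono) auto
        thus "norm (f p * of_real (c p) - f p * of_real (g p)) \<le> e / (?A + 1) * norm (f p)"
          by (simp add: norm_mult mult.commute flip: right_diff_distrib of_real_diff)
      qed (use i in \<open>auto intro!: integrable_times_continuous cont c exp_poly_continuous g\<close>)
      also have "\<dots> = e * (?A / (?A + 1))" by simp
      also have "\<dots> \<le> e * 1" using e frac[OF A] by (intro mult_left_mono) auto
      finally show "norm (\<integral>p. f p * of_real (c p) \<partial>rct a b) \<le> 0 + e" by simp
    qed
    thus ?thesis by simp
  qed
  have ctsc: "(\<integral>p. f p * c p \<partial>rct a b) = 0" if c: "continuous_on UNIV c" for c
  proof -
    have "(\<integral>p. f p * c p \<partial>rct a b) = (\<integral>p. f p * of_real (Re (c p)) + \<i> * (f p * of_real (Im (c p))) \<partial>rct a b)"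
      by (intro Bochner_Integration.integral_cong refl) 
        (simp add: complex_eq_iff)
    also have "\<dots> = (\<integral>p. f p * of_real (Re (c p)) \<partial>rct a b) + \<i> * (\<integral>p. f p * of_real (Im (c p)) \<partial>rct a b)"
      using integrable_times_continuous[OF i cont[OF continuous_on_Re[OF c]]]
        integrable_times_continuous[OF i cont[OF continuous_on_Im[OF c]]] by simp
    also have "\<dots> = 0" by (simp add: cts continuous_intros c)
    finally show ?thesis .
  qed
  \<comment> \<open>Where \<open>f p = 0\<close>, division by zero gives \<open>s p = 0\<close>, so
    the product identity in \<open>s\<close> holds there too.\<close>
  define s where "s p = cnj (f p) / of_real (norm (f p))" for p
  have s: "norm (s p) \<le> 1" "f p * s p = of_real (norm (f p))" for p
    by (cases "f p = 0"; simp add: s_def norm_divide complex_norm_square[symmetric] power2_eq_square)+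
  have [measurable]: "cnj \<in> borel_measurable borel" 
    by (intro borel_measurable_continuous_onI continuous_intros)
  have "s \<in> borel_measurable borel"
    unfolding s_def by measurable
  hence "s \<in> borel_measurable lebesgue" by (intro measurable_completion) simp
  \<comment> \<open>\<open>measurable_on\<close> supplies continuous functions that converge to
    \<open>s\<close> off a negligible set.\<close>
  hence "s measurable_on UNIV"
    by (subst measurable_on_iff_borel_measurable) auto
  then obtain N g where N: "negligible N" and g: "\<And>n. continuous_on UNIV (g n)" "\<And>x. x \<notin> N \<Longrightarrow> (\<lambda>n. g n x) \<longlonglongrightarrow> s x"
    unfolding measurable_on_def by auto
  have "AE x in lebesgue. x \<notin> N"
    using N by (intro AE_not_in) (simp add: negligible_iff_null_sets)
  hence aeN: "AE x in rct a b. x \<notin> N"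
    unfolding rct_eq_restrict by (subst AE_restrict_space_iff) (auto simp: AE_completion_iff)
  \<comment> \<open>Radial truncation to the unit disc keeps continuity and gives the dominating
    function \<open>norm (f p)\<close>. It does not alter the limit, because \<open>s\<close>
    already takes values in the disc.\<close>
  define t where "t n x = g n x / of_real (max 1 (norm (g n x)))" for n x
  have pos: "max 1 (norm z) > 0" for z :: complex by (simp add: less_max_iff_disj)
  have t: "continuous_on UNIV (t n)" "norm (t n x) \<le> 1" for n x
    unfolding t_def using pos[of "g n _"]
    by (auto intro!: continuous_intros g(1) simp: norm_divide less_imp_neq[OF pos, symmetric])
  have "(\<lambda>n. \<integral>p. f p * t n p \<partial>rct a b) \<longlonglongrightarrow> (\<integral>p. of_real (norm (f p)) \<partial>rct a b)"
  proof (rule integral_dominated_convergence[where w = "\<lambda>p. norm (f p)"])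
    show "AE x in rct a b. (\<lambda>n. f x * t n x) \<longlonglongrightarrow> of_real (norm (f x))"
      using aeN
    proof eventually_elim
      case (elim x)
      have "(\<lambda>n. t n x) \<longlonglongrightarrow> s x / of_real (max 1 (norm (s x)))"
        unfolding t_def using pos[of "s x"] by (intro tendsto_intros g(2)[OF elim]) auto
      moreover have "max 1 (norm (s x)) = 1" using s(1)[of x] by simp
      ultimately have "(\<lambda>n. t n x) \<longlonglongrightarrow> s x" by (simp only: of_real_1 div_by_1)
      hence "(\<lambda>n. f x * t n x) \<longlonglongrightarrow> f x * s x"
        by (intro tendsto_intros)
      thus ?case by (simp add: s)
    qed
    show "(\<lambda>p. f p * t n p) \<in> borel_measurable (rct a b)" for n
      by (intro borel_measurable_times measurable_rct m borel_measurable_continuous_onI t)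
    show "AE x in rct a b. norm (f x * t n x) \<le> norm (f x)" for n
      using t(2)[of n] by (intro AE_I2) (simp add: norm_mult mult_left_le)
  qed (use i in auto)
  hence "(\<integral>p. complex_of_real (norm (f p)) \<partial>rct a b) = 0"
    by (simp add: ctsc[OF t(1)] LIMSEQ_const_iff)
  hence "(\<integral>p. norm (f p) \<partial>rct a b) = 0" by simp
  hence "AE p in rct a b. norm (f p) = 0"
    using i by (subst (asm) integral_nonneg_eq_0_iff_AE) auto
  thus ?thesis by simp
qed

text \<open>A Borel version of a field with its two partial derivatives and its traces. After the
  exchange of coordinates the left and right sides become the lower and upper ends of the lines, so
  one notion of line limit covers both directions.\<close>

definition trace_field :: "real \<Rightarrow> real \<Rightarrow> (real \<times> real \<Rightarrow> complex) \<Rightarrow> (real \<times> real \<Rightarrow> complex) \<Rightarrow> (real \<times> real \<Rightarrow> complex) \<Rightarrow>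
    (side \<Rightarrow> real \<Rightarrow> complex) \<Rightarrow> bool" where
  "trace_field a b f D1 D2 g \<longleftrightarrow> line_limit a b f D2 (g Bottom) (g Top) \<and>
     line_limit b a (\<lambda>p. f (prod.swap p)) (\<lambda>p. D1 (prod.swap p)) (g Left) (g Right)"

lemma line_limit_measurable:
  assumes "line_limit a b f D g0 g1"
  shows "f \<in> borel_measurable borel" "D \<in> borel_measurable borel" 
    "g0 \<in> borel_measurable borel" "g1 \<in> borel_measurable borel"
  using assms unfolding line_limit_def by auto

lemma line_limit_l2:
  assumes "line_limit a b f D g0 g1"
  shows "(\<integral>\<^sup>+p. ennreal ((norm (f p))\<^sup>2) \<partial>rct a b) < \<infinity>" "(\<integral>\<^sup>+p. ennreal ((norm (D p))\<^sup>2) \<partial>rct a b) < \<infinity>"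
    "(\<integral>\<^sup>+x. ennreal ((norm (g0 x))\<^sup>2) \<partial>ivl a) < \<infinity>" "(\<integral>\<^sup>+x. ennreal ((norm (g1 x))\<^sup>2) \<partial>ivl a) < \<infinity>"
proof -
  obtain v dv where v: "\<And>k. continuous_on UNIV (v k)" "\<And>k. continuous_on UNIV (dv k)"
        "l2_lim (rct a b) v f" "l2_lim (rct a b) dv D"
        "l2_lim (ivl a) (\<lambda>k x. v k (x, - b/2)) g0" "l2_lim (ivl a) (\<lambda>k x. v k (x, b/2)) g1"
    using assms unfolding line_limit_def by blast
  note m = line_limit_measurable[OF assms]
  note mm = measurable_rct measurable_ivl borel_measurable_continuous_onI
  have c: "continuous_on UNIV (\<lambda>x. v k (x, t))" for k t
    using v(1)[of k] 
    by (auto intro!: continuous_on_compose2[of UNIV _ UNIV "\<lambda>x. (x,t)"] continuous_intros)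
  show "(\<integral>\<^sup>+p. ennreal ((norm (f p))\<^sup>2) \<partial>rct a b) < \<infinity>" 
    by (rule l2_lim_finite[OF _ _ v(3)]) (intro mm m v continuous_l2_rct)+
  show "(\<integral>\<^sup>+p. ennreal ((norm (D p))\<^sup>2) \<partial>rct a b) < \<infinity>"
    by (rule l2_lim_finite[OF _ _ v(4)]) (intro mm m v continuous_l2_rct)+
  show "(\<integral>\<^sup>+x. ennreal ((norm (g0 x))\<^sup>2) \<partial>ivl a) < \<infinity>" 
    by (rule l2_lim_finite[OF _ _ v(5)]) (intro mm m c continuous_l2_ivl)+
  show "(\<integral>\<^sup>+x. ennreal ((norm (g1 x))\<^sup>2) \<partial>ivl a) < \<infinity>"
    by (rule l2_lim_finite[OF _ _ v(6)]) (intro mm m c continuous_l2_ivl)+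
qed

lemma line_limit_smooth:
  assumes "continuous_on UNIV w" "continuous_on UNIV dw" 
    "\<And>x y. ((\<lambda>t. w (x, t)) has_vector_derivative dw (x, y)) (at y)"
  shows "line_limit a b w dw (\<lambda>x. w (x, - b/2)) (\<lambda>x. w (x, b/2))"
proof -
  have c: "continuous_on UNIV (\<lambda>x. w (x, t))" for t
    using assms(1)
    by (auto intro!: continuous_on_compose2[of UNIV _ UNIV "\<lambda>x. (x,t)"] continuous_intros)
  show ?thesis unfolding line_limit_def l2_lim_def
    by (intro conjI borel_measurable_continuous_onI assms c exI[of _ "\<lambda>k. w"] exI[of _ "\<lambda>k. dw"])
      (use assms in auto)
qed

lemma line_limit_cnj:
  assumes "line_limit a b f D g0 g1"
  shows "line_limit a b (\<lambda>p. cnj (f p)) (\<lambda>p. cnj (D p)) (\<lambda>x. cnj (g0 x)) (\<lambda>x. cnj (g1 x))"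
proof -
  obtain v dv where v: "\<And>k. continuous_on UNIV (v k)" "\<And>k. continuous_on UNIV (dv k)"
        "\<And>k x y. ((\<lambda>t. v k (x, t)) has_vector_derivative dv k (x, y)) (at y)"
        "l2_lim (rct a b) v f" "l2_lim (rct a b) dv D"
        "l2_lim (ivl a) (\<lambda>k x. v k (x, - b/2)) g0" "l2_lim (ivl a) (\<lambda>k x. v k (x, b/2)) g1"
    using assms unfolding line_limit_def by blast
  have [measurable]: "f \<in> borel_measurable borel" "D \<in> borel_measurable borel" 
    "g0 \<in> borel_measurable borel" "g1 \<in> borel_measurable borel" by (rule line_limit_measurable[OF assms])+
  have n: "norm (cnj z - cnj w) = norm (z - w)" for z w by (metis complex_cnj_diff complex_mod_cnj)
  have d: "((\<lambda>t. cnj (v k (x, t))) has_vector_derivative cnj (dv k (x, y))) (at y)" for k x y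
    by (rule bounded_linear.has_vector_derivative[OF bounded_linear_cnj v(3)])
  have m: "cnj \<in> borel_measurable borel" 
    by (intro borel_measurable_continuous_onI continuous_intros)
  show ?thesis unfolding line_limit_def
    by (intro conjI exI[of _ "\<lambda>k p. cnj (v k p)"] exI[of _ "\<lambda>k p. cnj (dv k p)"])
      (use v d in \<open>auto simp: l2_lim_def n intro!: continuous_intros measurable_compose[OF _ m]\<close>)
qed

lemma measurable_swap_borel:
  "f \<in> borel_measurable borel \<Longrightarrow> (\<lambda>p. f (prod.swap p)) \<in> borel_measurable borel"
  for f :: "real \<times> real \<Rightarrow> complex"
  by (rule measurable_compose[of prod.swap borel borel])
    (auto intro!: borel_measurable_continuous_onI continuous_intros simp: prod.swap_def)

lemma trace_field_measurable:
  assumes "trace_field a b f D1 D2 g"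
  shows "f \<in> borel_measurable borel" "D1 \<in> borel_measurable borel" "D2 \<in> borel_measurable borel" 
    "g s \<in> borel_measurable borel"
proof -
  have 1: "line_limit a b f D2 (g Bottom) (g Top)" 
    and 2: "line_limit b a (\<lambda>p. f (prod.swap p)) (\<lambda>p. D1 (prod.swap p)) (g Left) (g Right)"
    using assms unfolding trace_field_def by auto
  show "f \<in> borel_measurable borel" "D2 \<in> borel_measurable borel" using line_limit_measurable[OF 1] by auto
  show "D1 \<in> borel_measurable borel" using measurable_swap_borel[OF line_limit_measurable(2)[OF 2]] by simp
  show "g s \<in> borel_measurable borel" using line_limit_measurable[OF 1] line_limit_measurable[OF 2] by (cases s) auto
qed

lemma nn_integral_norm_swap:
  fixes f :: "real \<times> real \<Rightarrow> complex"
  assumes "f \<in> borel_measurable borel"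
  shows "(\<integral>\<^sup>+p. ennreal ((norm (f (prod.swap p)))\<^sup>2) \<partial>rct b a) = (\<integral>\<^sup>+p. ennreal ((norm (f p))\<^sup>2) \<partial>rct a b)"
proof (rule nn_integral_rct_swap[of "\<lambda>p. ennreal ((norm (f p))\<^sup>2)"])
  have [measurable]: "f \<in> borel_measurable (rct a b)" by (rule measurable_rct[OF assms])
  show "(\<lambda>p. ennreal ((norm (f p))\<^sup>2)) \<in> borel_measurable (rct a b)" by measurable
qed

lemma trace_field_l2:
  assumes "trace_field a b f D1 D2 g"
  shows "(\<integral>\<^sup>+p. ennreal ((norm (f p))\<^sup>2) \<partial>rct a b) < \<infinity>" "(\<integral>\<^sup>+p. ennreal ((norm (D1 p))\<^sup>2) \<partial>rct a b) < \<infinity>"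
    "(\<integral>\<^sup>+p. ennreal ((norm (D2 p))\<^sup>2) \<partial>rct a b) < \<infinity>"
    "(\<integral>\<^sup>+x. ennreal ((norm (g Bottom x))\<^sup>2) \<partial>ivl a) < \<infinity>" "(\<integral>\<^sup>+x. ennreal ((norm (g Top x))\<^sup>2) \<partial>ivl a) < \<infinity>"
    "(\<integral>\<^sup>+x. ennreal ((norm (g Left x))\<^sup>2) \<partial>ivl b) < \<infinity>" "(\<integral>\<^sup>+x. ennreal ((norm (g Right x))\<^sup>2) \<partial>ivl b) < \<infinity>"
proof -
  have 1: "line_limit a b f D2 (g Bottom) (g Top)" 
    and 2: "line_limit b a (\<lambda>p. f (prod.swap p)) (\<lambda>p. D1 (prod.swap p)) (g Left) (g Right)"
    using assms unfolding trace_field_def by auto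
  show "(\<integral>\<^sup>+p. ennreal ((norm (f p))\<^sup>2) \<partial>rct a b) < \<infinity>"
    "(\<integral>\<^sup>+p. ennreal ((norm (D2 p))\<^sup>2) \<partial>rct a b) < \<infinity>"
    "(\<integral>\<^sup>+x. ennreal ((norm (g Bottom x))\<^sup>2) \<partial>ivl a) < \<infinity>" "(\<integral>\<^sup>+x. ennreal ((norm (g Top x))\<^sup>2) \<partial>ivl a) < \<infinity>"
    "(\<integral>\<^sup>+x. ennreal ((norm (g Left x))\<^sup>2) \<partial>ivl b) < \<infinity>" "(\<integral>\<^sup>+x. ennreal ((norm (g Right x))\<^sup>2) \<partial>ivl b) < \<infinity>"
    by (rule line_limit_l2[OF 1] line_limit_l2(3,4)[OF 2])+
  show "(\<integral>\<^sup>+p. ennreal ((norm (D1 p))\<^sup>2) \<partial>rct a b) < \<infinity>"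
    using line_limit_l2(2)[OF 2] nn_integral_norm_swap[OF trace_field_measurable(2)[OF assms]] by simp
qed

lemma trace_field_green:
  assumes pos: "a \<ge> 0" "b \<ge> 0" and 1: "trace_field a b f D1 D2 g" and 2: "trace_field a b f' D1' D2' g'"
  shows "(\<integral>p. D1 p * f' p \<partial>rct a b) + (\<integral>p. f p * D1' p \<partial>rct a b) = 
      (\<integral>y. g Right y * g' Right y \<partial>ivl b) - (\<integral>y. g Left y * g' Left y \<partial>ivl b)"
    "(\<integral>p. D2 p * f' p \<partial>rct a b) + (\<integral>p. f p * D2' p \<partial>rct a b) = 
      (\<integral>x. g Top x * g' Top x \<partial>ivl a) - (\<integral>x. g Bottom x * g' Bottom x \<partial>ivl a)"
proof -
  show "(\<integral>p. D2 p * f' p \<partial>rct a b) + (\<integral>p. f p * D2' p \<partial>rct a b) = 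
      (\<integral>x. g Top x * g' Top x \<partial>ivl a) - (\<integral>x. g Bottom x * g' Bottom x \<partial>ivl a)"
    using 1 2 line_limit_green[OF pos(2)] unfolding trace_field_def by blast
  note [measurable] = trace_field_measurable(1-3)[OF 1, THEN measurable_rct, of a b] 
    trace_field_measurable(1-3)[OF 2, THEN measurable_rct, of a b] 
  have "(\<integral>p. D1 (prod.swap p) * f' (prod.swap p) \<partial>rct b a) + (\<integral>p. f (prod.swap p) * D1' (prod.swap p) \<partial>rct b a) = 
      (\<integral>y. g Right y * g' Right y \<partial>ivl b) - (\<integral>y. g Left y * g' Left y \<partial>ivl b)"
    using 1 2 line_limit_green[OF pos(1)] unfolding trace_field_def by blast
  moreover have "(\<integral>p. D1 (prod.swap p) * f' (prod.swap p) \<partial>rct b a) = (\<integral>p. D1 p * f' p \<partial>rct a b)"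
    by (rule integral_rct_swap[of "\<lambda>p. D1 p * f' p"]) measurable
  moreover have "(\<integral>p. f (prod.swap p) * D1' (prod.swap p) \<partial>rct b a) = (\<integral>p. f p * D1' p \<partial>rct a b)"
    by (rule integral_rct_swap[of "\<lambda>p. f p * D1' p"]) measurable
  ultimately show "(\<integral>p. D1 p * f' p \<partial>rct a b) + (\<integral>p. f p * D1' p \<partial>rct a b) = 
      (\<integral>y. g Right y * g' Right y \<partial>ivl b) - (\<integral>y. g Left y * g' Left y \<partial>ivl b)" by simp
qed

lemma trace_field_cnj:
  "trace_field a b f D1 D2 g \<Longrightarrow> 
    trace_field a b (\<lambda>p. cnj (f p)) (\<lambda>p. cnj (D1 p)) (\<lambda>p. cnj (D2 p)) (\<lambda>s t. cnj (g s t))"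
  unfolding trace_field_def using line_limit_cnj by blast

section \<open>Real exponentials as test functions, and uniqueness for zero traces\<close>

definition cexp2 :: "real \<Rightarrow> real \<Rightarrow> real \<times> real \<Rightarrow> complex" where
  "cexp2 \<alpha> \<beta> p = exp (of_real (\<alpha> * fst p + \<beta> * snd p))"

lemma continuous_cexp2: "continuous_on UNIV (cexp2 \<alpha> \<beta>)"
  unfolding cexp2_def by (intro continuous_intros)

lemma line_limit_cexp2:
  "line_limit a b (cexp2 \<alpha> \<beta>) (\<lambda>p. of_real \<beta> * cexp2 \<alpha> \<beta> p) 
    (\<lambda>x. cexp2 \<alpha> \<beta> (x, - b/2)) (\<lambda>x. cexp2 \<alpha> \<beta> (x, b/2))"
proof (rule line_limit_smooth)
  have "((\<lambda>t. exp (of_real \<alpha> * of_real x + of_real \<beta> * of_real t)) has_vector_derivative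
        of_real \<beta> * exp (of_real \<alpha> * of_real x + of_real \<beta> * complex_of_real y)) (at y)" for x y
    by (intro has_vector_derivative_real_field) (auto intro!: derivative_eq_intros)
  thus "((\<lambda>t. cexp2 \<alpha> \<beta> (x, t)) has_vector_derivative of_real \<beta> * cexp2 \<alpha> \<beta> (x, y)) (at y)" for x y
    by (simp add: cexp2_def)
qed (intro continuous_intros continuous_cexp2)+

lemma trace_field_cexp2:
  "\<exists>g. trace_field a b (cexp2 \<alpha> \<beta>) (\<lambda>p. of_real \<alpha> * cexp2 \<alpha> \<beta> p) (\<lambda>p. of_real \<beta> * cexp2 \<alpha> \<beta> p) g"
proof -
  have eq: "(\<lambda>p. cexp2 \<alpha> \<beta> (prod.swap p)) = cexp2 \<beta> \<alpha>" by (simp add: cexp2_def fun_eq_iff add.commute)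
  have eq2: "(\<lambda>p. of_real \<alpha> * cexp2 \<alpha> \<beta> (prod.swap p)) = (\<lambda>p. of_real \<alpha> * cexp2 \<beta> \<alpha> p)" 
    by (simp add: cexp2_def fun_eq_iff add.commute)
  let ?g = "\<lambda>s. case s of Top \<Rightarrow> (\<lambda>x. cexp2 \<alpha> \<beta> (x, b/2)) | Bottom \<Rightarrow> (\<lambda>x. cexp2 \<alpha> \<beta> (x, - b/2)) 
    | Right \<Rightarrow> (\<lambda>x. cexp2 \<beta> \<alpha> (x, a/2)) | Left \<Rightarrow> (\<lambda>x. cexp2 \<beta> \<alpha> (x, - a/2))"
  show ?thesis unfolding trace_field_def eq eq2
    using line_limit_cexp2 by (intro exI[of _ ?g]) simp
qed

text \<open>The Green formula with an exponential as second factor: the boundary terms vanish with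
  the traces of \<open>f\<close>, so the partial derivatives turn into the multipliers
  \<open>- \<alpha>\<close> and \<open>- \<beta>\<close>.\<close>

lemma zero_trace_exp_transform:
  assumes pos: "a \<ge> 0" "b \<ge> 0" and f: "trace_field a b f D1 D2 g" 
    and z: "AE x in ivl a. g Top x = 0" "AE x in ivl a. g Bottom x = 0"
      "AE y in ivl b. g Right y = 0" "AE y in ivl b. g Left y = 0"
  shows "(\<integral>p. D1 p * cexp2 \<alpha> \<beta> p \<partial>rct a b) = - of_real \<alpha> * (\<integral>p. f p * cexp2 \<alpha> \<beta> p \<partial>rct a b)"
    "(\<integral>p. D2 p * cexp2 \<alpha> \<beta> p \<partial>rct a b) = - of_real \<beta> * (\<integral>p. f p * cexp2 \<alpha> \<beta> p \<partial>rct a b)"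
proof -
  obtain e where e: "trace_field a b (cexp2 \<alpha> \<beta>) (\<lambda>p. of_real \<alpha> * cexp2 \<alpha> \<beta> p) (\<lambda>p. of_real \<beta> * cexp2 \<alpha> \<beta> p) e"
    using trace_field_cexp2 by blast
  have "(\<integral>x. g Top x * e Top x \<partial>ivl a) = 0" "(\<integral>x. g Bottom x * e Bottom x \<partial>ivl a) = 0"
    "(\<integral>y. g Right y * e Right y \<partial>ivl b) = 0" "(\<integral>y. g Left y * e Left y \<partial>ivl b) = 0"
    by (rule integral_eq_zero_AE, rule eventually_mono[OF z(1)], simp)
      (rule integral_eq_zero_AE, rule eventually_mono[OF z(2)], simp,
       rule integral_eq_zero_AE, rule eventually_mono[OF z(3)], simp,
       rule integral_eq_zero_AE, rule eventually_mono[OF z(4)], simp)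
  moreover have "(\<integral>p. f p * (of_real c * cexp2 \<alpha> \<beta> p) \<partial>rct a b) = of_real c * (\<integral>p. f p * cexp2 \<alpha> \<beta> p \<partial>rct a b)" for c
  proof -
    have "(\<lambda>p. f p * (of_real c * cexp2 \<alpha> \<beta> p)) = (\<lambda>p. of_real c * (f p * cexp2 \<alpha> \<beta> p))"
      by (simp add: fun_eq_iff)
    thus ?thesis by simp
  qed
  ultimately show "(\<integral>p. D1 p * cexp2 \<alpha> \<beta> p \<partial>rct a b) = - of_real \<alpha> * (\<integral>p. f p * cexp2 \<alpha> \<beta> p \<partial>rct a b)"
    "(\<integral>p. D2 p * cexp2 \<alpha> \<beta> p \<partial>rct a b) = - of_real \<beta> * (\<integral>p. f p * cexp2 \<alpha> \<beta> p \<partial>rct a b)"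
    using trace_field_green[OF pos f e] by (simp_all add: add_eq_0_iff2)
qed

text \<open>Orthogonality is available only for exponents from \<open>N\<close> on. Moving the
  factor \<open>cexp2 N N\<close> to \<open>f\<close> reduces these to natural exponents, and this
  factor has no zeros.\<close>

lemma AE_eq_0_if_exp_transform_0:
  assumes m: "f \<in> borel_measurable borel" and l2: "(\<integral>\<^sup>+p. ennreal ((norm (f p))\<^sup>2) \<partial>rct a b) < \<infinity>"
    and orth: "\<And>\<alpha> \<beta>. \<alpha> \<ge> N \<Longrightarrow> \<beta> \<ge> N \<Longrightarrow> (\<integral>p. f p * cexp2 \<alpha> \<beta> p \<partial>rct a b) = 0"
  shows "AE p in rct a b. f p = 0"
proof -
  have "AE p in rct a b. f p * cexp2 N N p = 0"
  proof (rule AE_eq_0_if_orthogonal_exp)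
    show "(\<lambda>p. f p * cexp2 N N p) \<in> borel_measurable borel"
      by (intro borel_measurable_times m borel_measurable_continuous_onI continuous_cexp2)
    show "integrable (rct a b) (\<lambda>p. f p * cexp2 N N p)"
      by (intro l2_pairing_integrable measurable_rct m l2 borel_measurable_continuous_onI continuous_cexp2 continuous_l2_rct)
    fix j k :: nat
    have "cexp2 N N p * of_real (exp (real j * fst p + real k * snd p)) = cexp2 (N + j) (N + k) p" for p
      by (simp add: cexp2_def exp_of_real[symmetric] algebra_simps flip: exp_add)
    hence "(\<integral>p. f p * cexp2 N N p * of_real (exp (real j * fst p + real k * snd p)) \<partial>rct a b) = 
      (\<integral>p. f p * cexp2 (N + j) (N + k) p \<partial>rct a b)"
      by (simp only: mult.assoc)
    thus "(\<integral>p. f p * cexp2 N N p * of_real (exp (real j * fst p + real k * snd p)) \<partial>rct a b) = 0"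
      using orth by simp
  qed
  thus ?thesis by eventually_elim (simp add: cexp2_def)
qed

text \<open>The two first-order symbols multiply to \<open>x\<^sup>2 + y\<^sup>2\<close>;
  eliminating \<open>V\<close> mirrors the fact that the square of the Dirac operator acts as minus
  the Laplacian plus \<open>m\<^sup>2\<close>.\<close>

lemma dirac_symbol_factor:
  fixes x y e m U V :: complex
  assumes 1: "(\<i> * y - x) * V = \<i> * (e - m) * U" and 2: "(- \<i> * y - x) * U = \<i> * (e + m) * V"
  shows "(x\<^sup>2 + y\<^sup>2 + (e\<^sup>2 - m\<^sup>2)) * U = 0"
proof -
  have "(x\<^sup>2 + y\<^sup>2) * U = (\<i> * y - x) * ((- \<i> * y - x) * U)"
    by (simp add: algebra_simps power2_eq_square)
  also have "\<dots> = \<i> * (e + m) * ((\<i> * y - x) * V)" unfolding 2 by (simp only: mult_ac)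
  also have "\<dots> = - ((e\<^sup>2 - m\<^sup>2) * U)" unfolding 1 
    by (simp add: algebra_simps power2_eq_square)
  finally show ?thesis by (simp add: distrib_right)
qed

text \<open>
  Testing with \<open>exp (\<alpha>x + \<beta>y)\<close> turns the system into a linear one with determinant
  \<open>\<alpha>\<^sup>2 + \<beta>\<^sup>2 + ev\<^sup>2 - m\<^sup>2\<close>, which is nonzero for large \<open>\<alpha>\<close>, \<open>\<beta>\<close>.
\<close>

lemma dirac_zero_trace_unique:
  fixes ev :: complex and m :: real
  assumes pos: "a \<ge> 0" "b \<ge> 0" and f1: "trace_field a b u1 D1u1 D2u1 g1" and f2: "trace_field a b u2 D1u2 D2u2 g2" 
    and z1: "AE x in ivl a. g1 Top x = 0" "AE x in ivl a. g1 Bottom x = 0"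
      "AE y in ivl b. g1 Right y = 0" "AE y in ivl b. g1 Left y = 0"
    and z2: "AE x in ivl a. g2 Top x = 0" "AE x in ivl a. g2 Bottom x = 0"
      "AE y in ivl b. g2 Right y = 0" "AE y in ivl b. g2 Left y = 0"
    and e1: "AE p in rct a b. D1u2 p - \<i> * D2u2 p = \<i> * (ev - of_real m) * u1 p"
    and e2: "AE p in rct a b. D1u1 p + \<i> * D2u1 p = \<i> * (ev + of_real m) * u2 p"
  shows "AE p in rct a b. u1 p = 0" "AE p in rct a b. u2 p = 0"
proof -
  let ?T = "\<lambda>f \<alpha> \<beta>. \<integral>p. f p * cexp2 \<alpha> \<beta> p \<partial>rct a b"
  note m1 = trace_field_measurable(1-3)[OF f1, THEN measurable_rct]
  note m2 = trace_field_measurable(1-3)[OF f2, THEN measurable_rct]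
  have i: "integrable (rct a b) (\<lambda>p. f p * cexp2 \<alpha> \<beta> p)" 
    if "f \<in> borel_measurable borel" "(\<integral>\<^sup>+p. ennreal ((norm (f p))\<^sup>2) \<partial>rct a b) < \<infinity>" for f \<alpha> \<beta>
    by (intro l2_pairing_integrable measurable_rct that borel_measurable_continuous_onI continuous_cexp2 continuous_l2_rct)
  note i1 = trace_field_measurable(1-3)[OF f1, THEN i] trace_field_l2[OF f1]
  note i2 = trace_field_measurable(1-3)[OF f2, THEN i] trace_field_l2[OF f2]
  have [measurable]: "cexp2 \<alpha> \<beta> \<in> borel_measurable (rct a b)" for \<alpha> \<beta>
    by (intro measurable_rct borel_measurable_continuous_onI continuous_cexp2)
  note [measurable] = m1 m2
  have t1: "- of_real \<alpha> * ?T u2 \<alpha> \<beta> - \<i> * (- of_real \<beta> * ?T u2 \<alpha> \<beta>) = \<i> * (ev - of_real m) * ?T u1 \<alpha> \<beta>" for \<alpha> \<beta>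
  proof -
    have "?T D1u2 \<alpha> \<beta> - \<i> * ?T D2u2 \<alpha> \<beta> = (\<integral>p. D1u2 p * cexp2 \<alpha> \<beta> p - \<i> * (D2u2 p * cexp2 \<alpha> \<beta> p) \<partial>rct a b)"
      using i2 by (subst Bochner_Integration.integral_diff) auto
    also have "\<dots> = (\<integral>p. \<i> * (ev - of_real m) * (u1 p * cexp2 \<alpha> \<beta> p) \<partial>rct a b)"
    proof (rule integral_cong_AE)
      show "AE p in rct a b. D1u2 p * cexp2 \<alpha> \<beta> p - \<i> * (D2u2 p * cexp2 \<alpha> \<beta> p) = \<i> * (ev - of_real m) * (u1 p * cexp2 \<alpha> \<beta> p)"
        using e1
      proof eventually_elim
        case (elim p)
        have "D1u2 p * cexp2 \<alpha> \<beta> p - \<i> * (D2u2 p * cexp2 \<alpha> \<beta> p) = (D1u2 p - \<i> * D2u2 p) * cexp2 \<alpha> \<beta> p"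
          by (simp only: left_diff_distrib mult.assoc)
        thus ?case unfolding elim by (simp only: mult.assoc)
      qed
    qed measurable
    finally show ?thesis by (simp add: zero_trace_exp_transform[OF pos f2 z2])
  qed
  have t2: "- of_real \<alpha> * ?T u1 \<alpha> \<beta> + \<i> * (- of_real \<beta> * ?T u1 \<alpha> \<beta>) = \<i> * (ev + of_real m) * ?T u2 \<alpha> \<beta>" for \<alpha> \<beta>
  proof -
    have "?T D1u1 \<alpha> \<beta> + \<i> * ?T D2u1 \<alpha> \<beta> = (\<integral>p. D1u1 p * cexp2 \<alpha> \<beta> p + \<i> * (D2u1 p * cexp2 \<alpha> \<beta> p) \<partial>rct a b)"
      using i1 by (subst Bochner_Integration.integral_add) auto
    also have "\<dots> = (\<integral>p. \<i> * (ev + of_real m) * (u2 p * cexp2 \<alpha> \<beta> p) \<partial>rct a b)"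
    proof (rule integral_cong_AE)
      show "AE p in rct a b. D1u1 p * cexp2 \<alpha> \<beta> p + \<i> * (D2u1 p * cexp2 \<alpha> \<beta> p) = \<i> * (ev + of_real m) * (u2 p * cexp2 \<alpha> \<beta> p)"
        using e2
      proof eventually_elim
        case (elim p)
        have "D1u1 p * cexp2 \<alpha> \<beta> p + \<i> * (D2u1 p * cexp2 \<alpha> \<beta> p) = (D1u1 p + \<i> * D2u1 p) * cexp2 \<alpha> \<beta> p"
          by (simp only: distrib_right mult.assoc)
        thus ?case unfolding elim by (simp only: mult.assoc)
      qed
    qed measurable
    finally show ?thesis by (simp add: zero_trace_exp_transform[OF pos f1 z1])
  qed
  \<comment> \<open>The norm is taken because \<open>ev\<close> is an arbitrary complex number here.
    For \<open>\<alpha> \<ge> N\<close> the summand 1 gives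
    \<open>\<alpha> \<le> \<alpha>\<^sup>2\<close> and makes \<open>\<alpha>\<^sup>2\<close> exceed
    that norm, which excludes a zero determinant.\<close>
  define N where "N = 1 + norm (ev\<^sup>2 - (of_real m)\<^sup>2)"
  have zero: "?T u1 \<alpha> \<beta> = 0 \<and> ?T u2 \<alpha> \<beta> = 0" if "\<alpha> \<ge> N" "\<beta> \<ge> N" for \<alpha> \<beta>
  proof -
    let ?U = "?T u1 \<alpha> \<beta>" and ?V = "?T u2 \<alpha> \<beta>"
    have 1: "(\<i> * of_real \<beta> - of_real \<alpha>) * ?V = \<i> * (ev - of_real m) * ?U"
      unfolding t1[of \<alpha> \<beta>, symmetric] by (simp add: algebra_simps)
    have 2: "(- \<i> * of_real \<beta> - of_real \<alpha>) * ?U = \<i> * (ev + of_real m) * ?V"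
      unfolding t2[of \<alpha> \<beta>, symmetric] by (simp add: algebra_simps)
    have "((of_real \<alpha>)\<^sup>2 + (of_real \<beta>)\<^sup>2 + (ev\<^sup>2 - (of_real m)\<^sup>2)) * ?U = 0"
      by (rule dirac_symbol_factor[OF 1 2])
    moreover have "(of_real \<alpha>)\<^sup>2 + (of_real \<beta>)\<^sup>2 + (ev\<^sup>2 - (of_real m)\<^sup>2) \<noteq> 0"
    proof
      assume "(of_real \<alpha>)\<^sup>2 + (of_real \<beta>)\<^sup>2 + (ev\<^sup>2 - (of_real m)\<^sup>2) = 0"
      hence "ev\<^sup>2 - (of_real m)\<^sup>2 = - of_real (\<alpha>\<^sup>2 + \<beta>\<^sup>2)" by (simp add: add_eq_0_iff)
      hence "norm (ev\<^sup>2 - (of_real m)\<^sup>2) = \<alpha>\<^sup>2 + \<beta>\<^sup>2" by (simp only: norm_minus_cancel norm_of_real) simp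
      moreover have "\<alpha> \<le> \<alpha>\<^sup>2" using that(1) by (intro self_le_power) (auto simp: N_def intro: order_trans[rotated])
      moreover have "0 \<le> \<beta>\<^sup>2" by simp
      ultimately show False using that unfolding N_def by linarith
    qed
    ultimately have U: "?U = 0" by simp
    hence "(\<i> * of_real \<beta> - of_real \<alpha>) * ?V = 0" using 1 by simp
    moreover have "\<i> * of_real \<beta> - of_real \<alpha> \<noteq> 0"
    proof
      assume "\<i> * of_real \<beta> - of_real \<alpha> = (0::complex)"
      hence "\<alpha> = 0" by (simp add: complex_eq_iff)
      thus False using that unfolding N_def by (smt (verit) norm_ge_zero)
    qed
    ultimately have "?V = 0" by (metis mult_eq_0_iff)
    with U show ?thesis by blast
  qed
  show "AE p in rct a b. u1 p = 0"
    by (rule AE_eq_0_if_exp_transform_0[OF trace_field_measurable(1)[OF f1] trace_field_l2(1)[OF f1], of N]) (use zero in blast)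
  show "AE p in rct a b. u2 p = 0"
    by (rule AE_eq_0_if_exp_transform_0[OF trace_field_measurable(1)[OF f2] trace_field_l2(1)[OF f2], of N]) (use zero in blast)
qed

section \<open>The boundary identity\<close>

text \<open>Both the boundary conditions and the differential system have the form
  \<open>k = c * h\<close> almost everywhere; mixed integrals thereby reduce to square
  norms.\<close>

lemma integral_cross_left:
  fixes h k :: "'a \<Rightarrow> complex"
  assumes [measurable]: "h \<in> borel_measurable M" "k \<in> borel_measurable M" and ae: "AE x in M. k x = c * h x"
  shows "(\<integral>x. k x * cnj (h x) \<partial>M) = c * of_real (\<integral>x. (norm (h x))\<^sup>2 \<partial>M)"
proof -
  have [measurable]: "cnj \<in> borel_measurable borel" 
    by (intro borel_measurable_continuous_onI continuous_intros)
  have "(\<integral>x. k x * cnj (h x) \<partial>M) = (\<integral>x. c * of_real ((norm (h x))\<^sup>2) \<partial>M)"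
  proof (rule integral_cong_AE)
    show "AE x in M. k x * cnj (h x) = c * of_real ((norm (h x))\<^sup>2)"
      using ae by eventually_elim (simp only: complex_norm_square mult.assoc)
  qed measurable
  also have "\<dots> = c * of_real (\<integral>x. (norm (h x))\<^sup>2 \<partial>M)" 
    by (simp only: integral_mult_right_zero integral_complex_of_real)
  finally show ?thesis .
qed

lemma integral_cross_right:
  fixes h k :: "'a \<Rightarrow> complex"
  assumes [measurable]: "h \<in> borel_measurable M" "k \<in> borel_measurable M" and ae: "AE x in M. k x = c * h x"
  shows "(\<integral>x. h x * cnj (k x) \<partial>M) = cnj c * of_real (\<integral>x. (norm (h x))\<^sup>2 \<partial>M)"
proof -
  have "(\<integral>x. h x * cnj (k x) \<partial>M) = cnj (\<integral>x. k x * cnj (h x) \<partial>M)"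
    unfolding Bochner_Integration.integral_cnj[symmetric] by (intro Bochner_Integration.integral_cong) (simp_all add: mult.commute)
  thus ?thesis by (simp add: integral_cross_left[OF assms])
qed

text \<open>Integrate the first equation against \<open>cnj u1\<close> and shift the derivatives by
  the Green formula; the conjugated second equation then appears, whence
  \<open>cnj (ev + of_real m)\<close>. On a side with normal \<open>(n1, n2)\<close> the boundary
  term is \<open>(n1 - \<i> * n2) * g2 * cnj g1\<close>. As
  \<open>(n1 - \<i> * n2) * (n1 + \<i> * n2) = 1\<close>, the boundary condition makes it
  \<open>\<i>\<close> times the squared modulus of \<open>g1\<close>, so all four sides contribute
  with the same sign.\<close>

lemma dirac_boundary_identity:
  fixes ev :: complex and m :: real
  assumes pos: "a \<ge> 0" "b \<ge> 0" and f1: "trace_field a b u1 D1u1 D2u1 g1" and f2: "trace_field a b u2 D1u2 D2u2 g2" 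
    and bc: "AE x in ivl a. g2 Top x = - 1 * g1 Top x" "AE x in ivl a. g2 Bottom x = 1 * g1 Bottom x"
      "AE y in ivl b. g2 Right y = \<i> * g1 Right y" "AE y in ivl b. g2 Left y = - \<i> * g1 Left y"
    and e1: "AE p in rct a b. D1u2 p - \<i> * D2u2 p = \<i> * (ev - of_real m) * u1 p"
    and e2: "AE p in rct a b. D1u1 p + \<i> * D2u1 p = \<i> * (ev + of_real m) * u2 p"
  shows "of_real ((\<integral>x. (norm (g1 Top x))\<^sup>2 \<partial>ivl a) + (\<integral>x. (norm (g1 Bottom x))\<^sup>2 \<partial>ivl a) + 
        (\<integral>y. (norm (g1 Right y))\<^sup>2 \<partial>ivl b) + (\<integral>y. (norm (g1 Left y))\<^sup>2 \<partial>ivl b)) =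
     (ev - of_real m) * of_real (\<integral>p. (norm (u1 p))\<^sup>2 \<partial>rct a b) - 
     cnj (ev + of_real m) * of_real (\<integral>p. (norm (u2 p))\<^sup>2 \<partial>rct a b)"
    (is "of_real (?T + ?B + ?R + ?L) = _ * of_real ?A1 - _ * of_real ?A2")
proof -
  note f1' = trace_field_cnj[OF f1]
  note [measurable] = trace_field_measurable(1-3)[OF f1, THEN measurable_rct, of a b] 
    trace_field_measurable(1-3)[OF f2, THEN measurable_rct, of a b]
    trace_field_measurable(4)[OF f1, THEN measurable_ivl] trace_field_measurable(4)[OF f2, THEN measurable_ivl]
  note l1 = trace_field_l2[OF f1] and l2 = trace_field_l2[OF f2] 
  note l1' = trace_field_l2[OF f1']
  note i = l2_pairing_integrable[OF _ _ l2(2) l1'(1)] l2_pairing_integrable[OF _ _ l2(3) l1'(1)]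
    l2_pairing_integrable[OF _ _ l2(1) l1'(2)] l2_pairing_integrable[OF _ _ l2(1) l1'(3)]
  have [measurable]: "cnj \<in> borel_measurable borel" 
    by (intro borel_measurable_continuous_onI continuous_intros)
  have G1: "(\<integral>p. D1u2 p * cnj (u1 p) \<partial>rct a b) + (\<integral>p. u2 p * cnj (D1u1 p) \<partial>rct a b) = \<i> * of_real ?R - (- \<i>) * of_real ?L"
    unfolding trace_field_green(1)[OF pos f2 f1']
    by (intro arg_cong2[of _ _ _ _ "(-)"] integral_cross_left bc) measurable
  have G2: "(\<integral>p. D2u2 p * cnj (u1 p) \<partial>rct a b) + (\<integral>p. u2 p * cnj (D2u1 p) \<partial>rct a b) = - 1 * of_real ?T - 1 * of_real ?B"
    unfolding trace_field_green(2)[OF pos f2 f1']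
    by (intro arg_cong2[of _ _ _ _ "(-)"] integral_cross_left bc) measurable
  have V1: "(\<integral>p. D1u2 p * cnj (u1 p) \<partial>rct a b) - \<i> * (\<integral>p. D2u2 p * cnj (u1 p) \<partial>rct a b) = \<i> * (ev - of_real m) * of_real ?A1"
  proof -
    have "(\<integral>p. D1u2 p * cnj (u1 p) \<partial>rct a b) - \<i> * (\<integral>p. D2u2 p * cnj (u1 p) \<partial>rct a b) = 
       (\<integral>p. D1u2 p * cnj (u1 p) - \<i> * (D2u2 p * cnj (u1 p)) \<partial>rct a b)"
      using i(1,2) by simp
    also have "\<dots> = (\<integral>p. (D1u2 p - \<i> * D2u2 p) * cnj (u1 p) \<partial>rct a b)"
      by (simp only: left_diff_distrib mult.assoc)
    also have "\<dots> = \<i> * (ev - of_real m) * of_real ?A1"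
      by (rule integral_cross_left[OF _ _ e1]) measurable
    finally show ?thesis .
  qed
  have V2: "(\<integral>p. u2 p * cnj (D1u1 p) \<partial>rct a b) - \<i> * (\<integral>p. u2 p * cnj (D2u1 p) \<partial>rct a b) = 
      cnj (\<i> * (ev + of_real m)) * of_real ?A2"
  proof -
    have "(\<integral>p. u2 p * cnj (D1u1 p) \<partial>rct a b) - \<i> * (\<integral>p. u2 p * cnj (D2u1 p) \<partial>rct a b) = 
       (\<integral>p. u2 p * cnj (D1u1 p) - \<i> * (u2 p * cnj (D2u1 p)) \<partial>rct a b)"
      using i(3,4) by simp
    also have "\<dots> = (\<integral>p. u2 p * cnj (D1u1 p + \<i> * D2u1 p) \<partial>rct a b)"
      by (intro Bochner_Integration.integral_cong refl) (simp add: algebra_simps)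
    also have "\<dots> = cnj (\<i> * (ev + of_real m)) * of_real ?A2"
      by (rule integral_cross_right[OF _ _ e2]) measurable
    finally show ?thesis .
  qed
  have "\<i> * of_real (?T + ?B + ?R + ?L) = (\<i> * of_real ?R - (- \<i>) * of_real ?L) - \<i> * (- 1 * of_real ?T - 1 * of_real ?B)"
    by (simp add: algebra_simps)
  also have "\<dots> = \<i> * (ev - of_real m) * of_real ?A1 + cnj (\<i> * (ev + of_real m)) * of_real ?A2"
    unfolding G1[symmetric] G2[symmetric] V1[symmetric] V2[symmetric] by (simp add: algebra_simps)
  also have "\<dots> = \<i> * ((ev - of_real m) * of_real ?A1 - cnj (ev + of_real m) * of_real ?A2)"
    by (simp add: algebra_simps)
  finally show ?thesis by (simp only: mult_cancel_left) simp
qed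

lemma AE_eq_0_if_integral_norm_square_0:
  fixes h :: "'a \<Rightarrow> complex"
  assumes [measurable]: "h \<in> borel_measurable M" and "(\<integral>\<^sup>+x. ennreal ((norm (h x))\<^sup>2) \<partial>M) < \<infinity>" 
    and "(\<integral>x. (norm (h x))\<^sup>2 \<partial>M) = 0"
  shows "AE x in M. h x = 0"
proof -
  have "integrable M (\<lambda>x. (norm (h x))\<^sup>2)"
    using assms(2) by (intro integrableI_bounded) auto
  hence "AE x in M. (norm (h x))\<^sup>2 = 0"
    using assms(3) by (subst (asm) integral_nonneg_eq_0_iff_AE) auto
  thus ?thesis by eventually_elim simp
qed

text \<open>At either value one term of the boundary identity vanishes and the other is
  \<open>- 2 * m\<close> times a square norm, which is where \<open>m \<ge> 0\<close> enters.
  Excluding these values allows each component to be recovered from the derivatives of the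
  other.\<close>

lemma dirac_eigenvalue_neq_mass:
  fixes ev :: complex and m :: real
  assumes pos: "a \<ge> 0" "b \<ge> 0" "m \<ge> 0" 
    and f1: "trace_field a b u1 D1u1 D2u1 g1" and f2: "trace_field a b u2 D1u2 D2u2 g2" 
    and bc: "AE x in ivl a. g2 Top x = - 1 * g1 Top x" "AE x in ivl a. g2 Bottom x = 1 * g1 Bottom x"
      "AE y in ivl b. g2 Right y = \<i> * g1 Right y" "AE y in ivl b. g2 Left y = - \<i> * g1 Left y"
    and e1: "AE p in rct a b. D1u2 p - \<i> * D2u2 p = \<i> * (ev - of_real m) * u1 p"
    and e2: "AE p in rct a b. D1u1 p + \<i> * D2u1 p = \<i> * (ev + of_real m) * u2 p"
    and nz: "\<not> (AE p in rct a b. u1 p = 0 \<and> u2 p = 0)"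
  shows "ev \<noteq> of_real m" "ev \<noteq> - of_real m"
proof -
  let ?T = "\<integral>x. (norm (g1 Top x))\<^sup>2 \<partial>ivl a" and ?B = "\<integral>x. (norm (g1 Bottom x))\<^sup>2 \<partial>ivl a"
  let ?R = "\<integral>y. (norm (g1 Right y))\<^sup>2 \<partial>ivl b" and ?L = "\<integral>y. (norm (g1 Left y))\<^sup>2 \<partial>ivl b"
  let ?A1 = "\<integral>p. (norm (u1 p))\<^sup>2 \<partial>rct a b" and ?A2 = "\<integral>p. (norm (u2 p))\<^sup>2 \<partial>rct a b"
  have id: "of_real (?T + ?B + ?R + ?L) = (ev - of_real m) * of_real ?A1 - cnj (ev + of_real m) * of_real ?A2"
    by (rule dirac_boundary_identity[OF pos(1,2) f1 f2 bc e1 e2])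
  have nn: "?T \<ge> 0" "?B \<ge> 0" "?R \<ge> 0" "?L \<ge> 0" "?A1 \<ge> 0" "?A2 \<ge> 0" by simp_all
  have contra: "\<not> ?T + ?B + ?R + ?L \<le> 0"
  proof
    assume "?T + ?B + ?R + ?L \<le> 0"
    hence z: "?T = 0" "?B = 0" "?R = 0" "?L = 0" using nn by linarith+
    note mg = trace_field_measurable(4)[OF f1, THEN measurable_ivl] 
    note l = trace_field_l2[OF f1]
    have z1: "AE x in ivl a. g1 Top x = 0" "AE x in ivl a. g1 Bottom x = 0"
      "AE y in ivl b. g1 Right y = 0" "AE y in ivl b. g1 Left y = 0"
      by (rule AE_eq_0_if_integral_norm_square_0[OF mg l(5) z(1)] AE_eq_0_if_integral_norm_square_0[OF mg l(4) z(2)]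
          AE_eq_0_if_integral_norm_square_0[OF mg l(7) z(3)] AE_eq_0_if_integral_norm_square_0[OF mg l(6) z(4)])+
    have z2: "AE x in ivl a. g2 Top x = 0" using bc(1) z1(1) by eventually_elim simp
    have z3: "AE x in ivl a. g2 Bottom x = 0" using bc(2) z1(2) by eventually_elim simp
    have z4: "AE x in ivl b. g2 Right x = 0" using bc(3) z1(3) by eventually_elim simp
    have z5: "AE x in ivl b. g2 Left x = 0" using bc(4) z1(4) by eventually_elim simp
    from dirac_zero_trace_unique[OF pos(1,2) f1 f2 z1 z2 z3 z4 z5 e1 e2] nz show False
      by (simp add: AE_conj_iff)
  qed
  show "ev \<noteq> of_real m"
  proof
    assume "ev = of_real m"
    with id have "complex_of_real (?T + ?B + ?R + ?L) = of_real (- (2 * m * ?A2))" by simp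
    hence "?T + ?B + ?R + ?L = - (2 * m * ?A2)" by (simp only: of_real_eq_iff)
    moreover have "2 * m * ?A2 \<ge> 0" using pos(3) nn(6) by simp
    ultimately show False using contra by linarith
  qed
  show "ev \<noteq> - of_real m"
  proof
    assume "ev = - of_real m"
    with id have "complex_of_real (?T + ?B + ?R + ?L) = of_real (- (2 * m * ?A1))" by simp
    hence "?T + ?B + ?R + ?L = - (2 * m * ?A1)" by (simp only: of_real_eq_iff)
    moreover have "2 * m * ?A1 \<ge> 0" using pos(3) nn(5) by simp
    ultimately show False using contra by linarith
  qed
qed

section \<open>Separation of variables\<close>

lemma ac_path_scale:
  assumes "ac_path b h d h0 h1"
  shows "ac_path b (\<lambda>y. p * h y) (\<lambda>y. p * d y) (p * h0) (p * h1)"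
  using ac_path_lincomb[OF assms assms, of p 0] by simp

text \<open>Selects a single line on which a factor is nonzero and all almost everywhere properties
  hold at once.\<close>

lemma not_AE_imp_ex:
  assumes "\<not> (AE x in M. P x)" "AE x in M. Q x"
  shows "\<exists>x\<in>space M. \<not> P x \<and> Q x"
proof (rule ccontr)
  assume "\<not> ?thesis"
  moreover have "AE x in M. x \<in> space M" by (rule AE_space)
  with assms(2) have "AE x in M. Q x \<and> x \<in> space M" by eventually_elim simp
  ultimately have "AE x in M. P x" by (auto elim: eventually_mono)
  with assms(1) show False by simp
qed

text \<open>
  On the lines through \<open>x\<close> and \<open>z\<close>, the combination \<open>\<phi> z * h x - \<phi> x * h z\<close> is a multiple of \<open>\<psi>\<close>, since the
  \<open>\<psi>'\<close> terms cancel; by the boundary condition its end values vanish, so the factor is zero.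
\<close>

lemma separated_log_derivative:
  fixes h E :: "real \<Rightarrow> real \<Rightarrow> complex"
  assumes b: "b > 0" and h: "AE x in ivl a. ac_path b (h x) (E x) (\<gamma>0 x) (\<gamma>1 x)"
    and p: "ac_path b \<psi> \<psi>' \<psi>0 \<psi>1"
    and g: "AE x in ivl a. \<gamma>0 x = \<beta>0 * (\<phi> x * \<psi>0)" "AE x in ivl a. \<gamma>1 x = \<beta>1 * (\<phi> x * \<psi>1)"
    and eq: "AE x in ivl a. AE y in ivl b. c * h x y = \<sigma> * \<phi>' x * \<psi> y + \<tau> * \<phi> x * \<psi>' y"
    and nz: "\<sigma> \<noteq> 0" "\<not> (AE x in ivl a. \<phi> x = 0)" "\<psi>0 \<noteq> 0 \<or> \<psi>1 \<noteq> 0"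
  shows "\<exists>k. AE x in ivl a. \<phi>' x = k * \<phi> x"
proof -
  define good where "good x \<longleftrightarrow> ac_path b (h x) (E x) (\<gamma>0 x) (\<gamma>1 x) \<and> \<gamma>0 x = \<beta>0 * (\<phi> x * \<psi>0) \<and> 
     \<gamma>1 x = \<beta>1 * (\<phi> x * \<psi>1) \<and> (AE y in ivl b. c * h x y = \<sigma> * \<phi>' x * \<psi> y + \<tau> * \<phi> x * \<psi>' y)" for x
  have good: "AE x in ivl a. good x"
    using h g eq unfolding good_def by eventually_elim blast
  obtain z where z: "\<phi> z \<noteq> 0" "good z" using not_AE_imp_ex[OF nz(2) good] by blast
  have "\<phi>' x = (\<phi>' z / \<phi> z) * \<phi> x" if x: "good x" for x
  proof -
    let ?\<kappa> = "\<sigma> * (\<phi> z * \<phi>' x - \<phi> x * \<phi>' z)"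
    have "AE y in ivl b. c * h x y = \<sigma> * \<phi>' x * \<psi> y + \<tau> * \<phi> x * \<psi>' y" 
      "AE y in ivl b. c * h z y = \<sigma> * \<phi>' z * \<psi> y + \<tau> * \<phi> z * \<psi>' y"
      using x z unfolding good_def by auto
    hence ae: "AE y in ivl b. (c * \<phi> z) * h x y + (- c * \<phi> x) * h z y = ?\<kappa> * \<psi> y"
    proof eventually_elim
      case (elim y)
      have "(c * \<phi> z) * h x y + (- c * \<phi> x) * h z y = \<phi> z * (c * h x y) - \<phi> x * (c * h z y)"
        by (simp add: algebra_simps)
      also have "\<dots> = ?\<kappa> * \<psi> y" unfolding elim by (simp add: algebra_simps)
      finally show ?case .
    qed
    have px: "ac_path b (h x) (E x) (\<beta>0 * (\<phi> x * \<psi>0)) (\<beta>1 * (\<phi> x * \<psi>1))"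
      and pz: "ac_path b (h z) (E z) (\<beta>0 * (\<phi> z * \<psi>0)) (\<beta>1 * (\<phi> z * \<psi>1))"
      using x z unfolding good_def by auto
    note u = ac_path_unique(1,2)[OF b ac_path_lincomb[OF px pz] ac_path_scale[OF p] ae]
    have "?\<kappa> * \<psi>0 = 0" "?\<kappa> * \<psi>1 = 0" unfolding u[symmetric] by (simp_all add: algebra_simps)
    hence "?\<kappa> = 0" using nz(3) by (metis mult_eq_0_iff)
    hence "\<phi> z * \<phi>' x = \<phi> x * \<phi>' z" using nz(1) by simp
    thus ?thesis using z(1) by (simp add: field_simps)
  qed
  with good show ?thesis by (intro exI[of _ "\<phi>' z / \<phi> z"]) (auto elim: eventually_mono)
qed

lemma trace_field_ac_path:
  assumes pos: "a > 0" "b > 0" and f: "trace_field a b f D1 D2 g"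
  shows "AE x in ivl a. ac_path b (\<lambda>y. f (x, y)) (\<lambda>y. D2 (x, y)) (g Bottom x) (g Top x)"
    "AE y in ivl b. ac_path a (\<lambda>x. f (x, y)) (\<lambda>x. D1 (x, y)) (g Left y) (g Right y)"
  using f line_limit_ac_path[OF pos(2), of a f D2 "g Bottom" "g Top"]
    line_limit_ac_path[OF pos(1), of b "\<lambda>p. f (prod.swap p)" "\<lambda>p. D1 (prod.swap p)" "g Left" "g Right"]
  unfolding trace_field_def by auto

lemma AE_rct_swapped: "AE p in rct a b. P p \<Longrightarrow> AE y in ivl b. AE x in ivl a. P (x,y)"
  using AE_rct[OF AE_rct_swap] by fastforce

text \<open>The formula for \<open>D2\<close> is obtained line by line in one direction and that for
  \<open>D1\<close> in the other. To be inserted into the same equation, both are needed in the same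
  order of quantifiers.\<close>

lemma AE_ivl_commute:
  fixes F G :: "real \<times> real \<Rightarrow> complex"
  assumes "F \<in> borel_measurable borel" "G \<in> borel_measurable borel"
  shows "(AE x in ivl a. AE y in ivl b. F (x,y) = G (x,y)) \<longleftrightarrow> (AE y in ivl b. AE x in ivl a. F (x,y) = G (x,y))"
proof -
  note [measurable] = assms[THEN measurable_rct, of a b, unfolded rct_def]
  show ?thesis by (rule rct.AE_commute) (simp, measurable)
qed

text \<open>\<open>f\<close> is the separated component and \<open>h\<close> the other one, so that
  both components are covered: the constants \<open>c\<close>, \<open>\<tau>\<close> and the
  boundary factors \<open>\<beta>\<close> are all that changes. The contradiction comes from two
  horizontal sides on which \<open>h\<close> is tied to \<open>f\<close> by different
  factors.\<close>

lemma separated_trace_field_contradiction: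
  fixes f h :: "real \<times> real \<Rightarrow> complex" and \<phi>t \<psi>t :: "real \<Rightarrow> complex"
  assumes pos: "a > 0" "b > 0" and F: "trace_field a b f D1 D2 gf" and H: "trace_field a b h E1 E2 gh"
    and bc: "AE x in ivl a. gh Top x = \<beta> Top * gf Top x" "AE x in ivl a. gh Bottom x = \<beta> Bottom * gf Bottom x"
      "AE y in ivl b. gh Right y = \<beta> Right * gf Right y" "AE y in ivl b. gh Left y = \<beta> Left * gf Left y"
    and \<beta>: "\<beta> Top \<noteq> \<beta> Bottom"
    and eq: "AE p in rct a b. c * h p = D1 p + \<tau> * D2 p" and c: "c \<noteq> 0" and \<tau>: "\<tau> \<noteq> 0"
    and sep: "AE p in rct a b. f p = \<phi>t (fst p) * \<psi>t (snd p)"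
    and nz: "\<not> ((AE x in ivl a. gf Top x = 0) \<and> (AE x in ivl a. gf Bottom x = 0) \<and> 
       (AE y in ivl b. gf Right y = 0) \<and> (AE y in ivl b. gf Left y = 0))"
  shows False
proof -
  have s1: "AE x in ivl a. AE y in ivl b. f (x,y) = \<phi>t x * \<psi>t y" using AE_rct[OF sep] by simp
  have s2: "AE y in ivl b. AE x in ivl a. f (x,y) = \<phi>t x * \<psi>t y" using AE_rct_swapped[OF sep] by simp
  note p1 = trace_field_ac_path(1)[OF pos F] and p2 = trace_field_ac_path(2)[OF pos F]
  note m = trace_field_measurable[OF F]
  have sect: "(\<lambda>y. q (x,y)) \<in> borel_measurable borel" "(\<lambda>x. q (x,y)) \<in> borel_measurable borel" 
    if "q \<in> borel_measurable borel" for q :: "real \<times> real \<Rightarrow> complex" and x y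
    by (rule measurable_compose[OF _ that], intro borel_measurable_continuous_onI continuous_intros)+
  have proj: "(\<lambda>p. q (fst p)) \<in> borel_measurable borel" "(\<lambda>p. q (snd p)) \<in> borel_measurable borel"
    if "q \<in> borel_measurable borel" for q :: "real \<Rightarrow> complex"
    by (rule measurable_compose[OF _ that], intro borel_measurable_continuous_onI continuous_intros)+
  \<comment> \<open>If \<open>f\<close> vanished, so would its traces by
    \<open>ac_path_zero\<close>, against \<open>nz\<close>. Hence neither given factor can vanish
    almost everywhere.\<close>
  have "\<not> ((AE x in ivl a. AE y in ivl b. f (x,y) = 0) \<and> (AE y in ivl b. AE x in ivl a. f (x,y) = 0))"
  proof safe
    assume z: "AE x in ivl a. AE y in ivl b. f (x,y) = 0" "AE y in ivl b. AE x in ivl a. f (x,y) = 0"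
    have "AE x in ivl a. gf Top x = 0 \<and> gf Bottom x = 0"
      using p1 z(1) by eventually_elim (use ac_path_zero[OF pos(2)] in blast)
    moreover have "AE y in ivl b. gf Right y = 0 \<and> gf Left y = 0"
      using p2 z(2) by eventually_elim (use ac_path_zero[OF pos(1)] in blast)
    ultimately show False using nz by (auto simp: AE_conj_iff)
  qed
  moreover have "(AE x in ivl a. AE y in ivl b. f (x,y) = 0) \<and> (AE y in ivl b. AE x in ivl a. f (x,y) = 0)"
    if z: "AE x in ivl a. \<phi>t x = 0"
  proof
    show "AE x in ivl a. AE y in ivl b. f (x,y) = 0" using s1 z by eventually_elim simp
    show "AE y in ivl b. AE x in ivl a. f (x,y) = 0" using s2 
    proof eventually_elim
      case (elim y) with z show ?case by eventually_elim simp
    qed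
  qed
  moreover have "(AE x in ivl a. AE y in ivl b. f (x,y) = 0) \<and> (AE y in ivl b. AE x in ivl a. f (x,y) = 0)"
    if z: "AE y in ivl b. \<psi>t y = 0"
  proof
    show "AE y in ivl b. AE x in ivl a. f (x,y) = 0" using s2 z by eventually_elim simp
    show "AE x in ivl a. AE y in ivl b. f (x,y) = 0" using s1
    proof eventually_elim
      case (elim y) with z show ?case by eventually_elim simp
    qed
  qed
  ultimately have nzt: "\<not> (AE x in ivl a. \<phi>t x = 0)" "\<not> (AE y in ivl b. \<psi>t y = 0)" by blast+
  have "AE x in ivl a. ac_path b (\<lambda>y. f (x, y)) (\<lambda>y. D2 (x, y)) (gf Bottom x) (gf Top x) \<and> 
     (AE y in ivl b. f (x,y) = \<phi>t x * \<psi>t y)" using p1 s1 by eventually_elim simp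
  from not_AE_imp_ex[OF nzt(1) this] obtain x0 where x0: "\<phi>t x0 \<noteq> 0" 
    "ac_path b (\<lambda>y. f (x0, y)) (\<lambda>y. D2 (x0, y)) (gf Bottom x0) (gf Top x0)" 
    "AE y in ivl b. f (x0,y) = \<phi>t x0 * \<psi>t y" by blast
  have "AE y in ivl b. ac_path a (\<lambda>x. f (x, y)) (\<lambda>x. D1 (x, y)) (gf Left y) (gf Right y) \<and> 
     (AE x in ivl a. f (x,y) = \<phi>t x * \<psi>t y)" using p2 s2 by eventually_elim simp
  from not_AE_imp_ex[OF nzt(2) this] obtain y0 where y0: "\<psi>t y0 \<noteq> 0" 
    "ac_path a (\<lambda>x. f (x, y0)) (\<lambda>x. D1 (x, y0)) (gf Left y0) (gf Right y0)" 
    "AE x in ivl a. f (x,y0) = \<phi>t x * \<psi>t y0" by blast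
  \<comment> \<open>The section of \<open>f\<close> through \<open>x0\<close> is a multiple of
    \<open>\<psi>t\<close> almost everywhere, but it comes with a derivative and end values;
    \<open>\<phi>\<close> is obtained in the same way from the section through
    \<open>y0\<close>.\<close>
  define \<psi> where "\<psi> y = 1 / \<phi>t x0 * f (x0, y)" for y
  define \<psi>' where "\<psi>' y = 1 / \<phi>t x0 * D2 (x0, y)" for y
  define \<psi>0 where "\<psi>0 = 1 / \<phi>t x0 * gf Bottom x0"
  define \<psi>1 where "\<psi>1 = 1 / \<phi>t x0 * gf Top x0"
  have P\<psi>: "ac_path b \<psi> \<psi>' \<psi>0 \<psi>1"
    unfolding \<psi>_def[abs_def] \<psi>'_def[abs_def] \<psi>0_def \<psi>1_def by (rule ac_path_scale[OF x0(2)])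
  define \<phi> where "\<phi> x = 1 / \<psi>t y0 * f (x, y0)" for x
  define \<phi>' where "\<phi>' x = 1 / \<psi>t y0 * D1 (x, y0)" for x
  define \<phi>0 where "\<phi>0 = 1 / \<psi>t y0 * gf Left y0"
  define \<phi>1 where "\<phi>1 = 1 / \<psi>t y0 * gf Right y0"
  have P\<phi>: "ac_path a \<phi> \<phi>' \<phi>0 \<phi>1"
    unfolding \<phi>_def[abs_def] \<phi>'_def[abs_def] \<phi>0_def \<phi>1_def by (rule ac_path_scale[OF y0(2)])
  have \<psi>t: "AE y in ivl b. \<psi>t y = \<psi> y" using x0(3) by eventually_elim (simp add: \<psi>_def x0(1))
  have \<phi>t: "AE x in ivl a. \<phi>t x = \<phi> x" using y0(3) by eventually_elim (simp add: \<phi>_def y0(1))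
  have n\<phi>: "\<not> (AE x in ivl a. \<phi> x = 0)"
  proof
    assume "AE x in ivl a. \<phi> x = 0"
    with \<phi>t have "AE x in ivl a. \<phi>t x = 0" by eventually_elim simp
    with nzt show False by blast
  qed
  have n\<psi>: "\<not> (AE y in ivl b. \<psi> y = 0)"
  proof
    assume "AE x in ivl b. \<psi> x = 0"
    with \<psi>t have "AE x in ivl b. \<psi>t x = 0" by eventually_elim simp
    with nzt show False by blast
  qed
  have mm: "\<psi> \<in> borel_measurable borel" "\<psi>' \<in> borel_measurable borel" 
    "\<phi> \<in> borel_measurable borel" "\<phi>' \<in> borel_measurable borel"
    unfolding \<psi>_def[abs_def] \<psi>'_def[abs_def] \<phi>_def[abs_def] \<phi>'_def[abs_def]
    by (intro borel_measurable_times measurable_const sect m; simp)+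
  \<comment> \<open>On almost every line \<open>f\<close> is the constant \<open>\<phi> x\<close>
    times \<open>\<psi>\<close>, so uniqueness identifies its derivative and traces with the scaled
    data of \<open>\<psi>\<close>.\<close>
  have "AE x in ivl a. (AE y in ivl b. D2 (x,y) = \<phi> x * \<psi>' y) \<and> gf Bottom x = \<phi> x * \<psi>0 \<and> gf Top x = \<phi> x * \<psi>1"
    using p1 s1 \<phi>t
  proof eventually_elim
    case (elim x)
    have ae: "AE y in ivl b. f (x,y) = \<phi> x * \<psi> y"
      using elim(2) \<psi>t unfolding elim(3) by eventually_elim simp
    from ac_path_unique[OF pos(2) elim(1) ac_path_scale[OF P\<psi>] ae] show ?case by blast
  qed
  hence d2: "AE x in ivl a. AE y in ivl b. D2 (x,y) = \<phi> x * \<psi>' y" 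
    and gB: "AE x in ivl a. gf Bottom x = \<phi> x * \<psi>0" and gT: "AE x in ivl a. gf Top x = \<phi> x * \<psi>1"
    by (auto simp: AE_conj_iff)
  have "AE y in ivl b. (AE x in ivl a. D1 (x,y) = \<psi> y * \<phi>' x) \<and> gf Left y = \<psi> y * \<phi>0 \<and> gf Right y = \<psi> y * \<phi>1"
    using p2 s2 \<psi>t
  proof eventually_elim
    case (elim y)
    have ae: "AE x in ivl a. f (x,y) = \<psi> y * \<phi> x"
      using elim(2) \<phi>t unfolding elim(3) by eventually_elim simp
    from ac_path_unique[OF pos(1) elim(1) ac_path_scale[OF P\<phi>] ae] show ?case by blast
  qed
  hence d1: "AE y in ivl b. AE x in ivl a. D1 (x,y) = \<psi> y * \<phi>' x" 
    and gL: "AE y in ivl b. gf Left y = \<psi> y * \<phi>0" and gR: "AE y in ivl b. gf Right y = \<psi> y * \<phi>1"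
    by (auto simp: AE_conj_iff)
  have d1': "AE x in ivl a. AE y in ivl b. D1 (x,y) = \<psi> y * \<phi>' x"
    using d1 AE_ivl_commute[OF m(2) borel_measurable_times[OF proj(2)[OF mm(1)] proj(1)[OF mm(4)]], where a = a and b = b] by simp
  have d2': "AE y in ivl b. AE x in ivl a. D2 (x,y) = \<phi> x * \<psi>' y"
    using d2 AE_ivl_commute[OF m(3) borel_measurable_times[OF proj(1)[OF mm(3)] proj(2)[OF mm(2)]], where a = a and b = b] by simp
  have eq1: "AE x in ivl a. AE y in ivl b. c * h (x,y) = 1 * \<phi>' x * \<psi> y + \<tau> * \<phi> x * \<psi>' y"
    using AE_rct[OF eq] d1' d2
  proof eventually_elim
    case (elim x) thus ?case by eventually_elim simp
  qed
  have eq2: "AE y in ivl b. AE x in ivl a. c * h (x,y) = \<tau> * \<psi>' y * \<phi> x + 1 * \<psi> y * \<phi>' x"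
    using AE_rct_swapped[OF eq] d1 d2'
  proof eventually_elim
    case (elim x) thus ?case by eventually_elim simp
  qed
  note ph = trace_field_ac_path[OF pos H]
  have hB: "AE x in ivl a. gh Bottom x = \<beta> Bottom * (\<phi> x * \<psi>0)" using bc(2) gB by eventually_elim simp
  have hT: "AE x in ivl a. gh Top x = \<beta> Top * (\<phi> x * \<psi>1)" using bc(1) gT by eventually_elim simp
  have hL: "AE y in ivl b. gh Left y = \<beta> Left * (\<psi> y * \<phi>0)" using bc(4) gL by eventually_elim simp
  have hR: "AE y in ivl b. gh Right y = \<beta> Right * (\<psi> y * \<phi>1)" using bc(3) gR by eventually_elim simp
  have k: "\<exists>k. AE x in ivl a. \<phi>' x = k * \<phi> x" if "\<psi>0 \<noteq> 0 \<or> \<psi>1 \<noteq> 0"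
    by (rule separated_log_derivative[OF pos(2) ph(1) P\<psi> hB hT eq1 _ n\<phi> that]) simp
  \<comment> \<open>The same lemma with the directions exchanged: \<open>\<tau>\<close> now
    multiplies the derivative that is to be determined, which is why it must be nonzero.\<close>
  have l: "\<exists>l. AE y in ivl b. \<psi>' y = l * \<psi> y" if "\<phi>0 \<noteq> 0 \<or> \<phi>1 \<noteq> 0"
    by (rule separated_log_derivative[OF pos(1) ph(2) P\<phi> hL hR eq2 \<tau> n\<psi> that])
  have e1: "\<phi>0 \<noteq> 0 \<and> \<phi>1 \<noteq> 0" if "\<exists>k. AE x in ivl a. \<phi>' x = k * \<phi> x"
    using that ac_path_exp[OF pos(1) P\<phi>] n\<phi> by blast
  have e2: "\<psi>0 \<noteq> 0 \<and> \<psi>1 \<noteq> 0" if "\<exists>l. AE y in ivl b. \<psi>' y = l * \<psi> y"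
    using that ac_path_exp[OF pos(2) P\<psi>] n\<psi> by blast
  have "\<psi>0 \<noteq> 0 \<or> \<psi>1 \<noteq> 0 \<or> \<phi>0 \<noteq> 0 \<or> \<phi>1 \<noteq> 0"
  proof (rule ccontr)
    assume "\<not> ?thesis"
    hence "AE x in ivl a. gf Top x = 0" "AE x in ivl a. gf Bottom x = 0" 
       "AE y in ivl b. gf Right y = 0" "AE y in ivl b. gf Left y = 0"
      using gT gB gR gL by auto
    with nz show False by blast
  qed
  \<comment> \<open>A cycle of implications: one nonzero end value of a factor makes the other
    factor exponential, hence nonzero at both of its ends, and this in turn does the same to the
    first factor.\<close>
  hence nn: "\<psi>0 \<noteq> 0" "\<psi>1 \<noteq> 0" "\<phi>0 \<noteq> 0" "\<phi>1 \<noteq> 0" using k l e1 e2 by metis+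
  obtain k where k: "AE x in ivl a. \<phi>' x = k * \<phi> x" using k nn by blast
  obtain l where l: "AE y in ivl b. \<psi>' y = l * \<psi> y" using l nn by blast
  have "AE x in ivl a. ac_path b (\<lambda>y. h (x, y)) (\<lambda>y. E2 (x, y)) (gh Bottom x) (gh Top x) \<and>
      gh Bottom x = \<beta> Bottom * (\<phi> x * \<psi>0) \<and> gh Top x = \<beta> Top * (\<phi> x * \<psi>1) \<and> \<phi>' x = k * \<phi> x \<and>
      (AE y in ivl b. c * h (x,y) = 1 * \<phi>' x * \<psi> y + \<tau> * \<phi> x * \<psi>' y)"
    using ph(1) hB hT k eq1 by eventually_elim blast
  from not_AE_imp_ex[OF n\<phi> this] obtain x where x: "\<phi> x \<noteq> 0" 
    "ac_path b (\<lambda>y. h (x, y)) (\<lambda>y. E2 (x, y)) (gh Bottom x) (gh Top x)"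
    "gh Bottom x = \<beta> Bottom * (\<phi> x * \<psi>0)" "gh Top x = \<beta> Top * (\<phi> x * \<psi>1)" "\<phi>' x = k * \<phi> x"
    "AE y in ivl b. c * h (x,y) = 1 * \<phi>' x * \<psi> y + \<tau> * \<phi> x * \<psi>' y" by blast
  \<comment> \<open>On the chosen line \<open>c * h\<close> is \<open>?K\<close> times
    \<open>\<psi>\<close>. Comparing end values and cancelling \<open>\<phi> x\<close>,
    \<open>\<psi>0\<close> and \<open>\<psi>1\<close> gives the same value for
    \<open>c * \<beta> Bottom\<close> and \<open>c * \<beta> Top\<close>.\<close>
  let ?K = "(k + \<tau> * l) * \<phi> x"
  have ae: "AE y in ivl b. c * h (x,y) = ?K * \<psi> y"
    using x(6) l
  proof eventually_elim
    case (elim y)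
    show ?case unfolding elim x(5) by (simp add: algebra_simps)
  qed
  note u = ac_path_unique(1,2)[OF pos(2) ac_path_scale[OF x(2)] ac_path_scale[OF P\<psi>] ae]
  have "c * \<beta> Bottom = k + \<tau> * l" "c * \<beta> Top = k + \<tau> * l"
    using u nn x(1) unfolding x(3,4) by simp_all
  hence "c * \<beta> Bottom = c * \<beta> Top" by simp
  with c \<beta> show False by simp
qed

section \<open>Traces in the Sobolev sense\<close>

lemma smooth_continuous: "smooth v \<Longrightarrow> continuous_on UNIV v"
  unfolding smooth_def by (metis Ck.simps(1))

lemma smooth_partial:
  assumes "smooth v"
  shows "v differentiable (at p)" "continuous_on UNIV (\<lambda>x. frechet_derivative v (at x) e)"
proof -
  have "Ck (Suc 0) v" using assms unfolding smooth_def by blast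
  thus "v differentiable (at p)" "continuous_on UNIV (\<lambda>x. frechet_derivative v (at x) e)"
    by (auto simp: differentiable_on_def)
qed

lemma smooth_line_derivative:
  fixes v :: "real \<times> real \<Rightarrow> complex"
  assumes "smooth v"
  shows "((\<lambda>t. v (x, t)) has_vector_derivative frechet_derivative v (at (x, y)) (0, 1)) (at y)"
    "((\<lambda>t. v (t, y)) has_vector_derivative frechet_derivative v (at (x, y)) (1, 0)) (at x)"
proof -
  have d: "(v has_derivative frechet_derivative v (at (x, y))) (at (x, y))"
    using smooth_partial(1)[OF assms] by (simp add: frechet_derivative_works)
  interpret bounded_linear "frechet_derivative v (at (x, y))" using d by (rule has_derivative_bounded_linear)
  have "((\<lambda>t. v (x, t)) has_derivative (\<lambda>t. frechet_derivative v (at (x, y)) (0, t))) (at y)"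
    using diff_chain_at[OF has_derivative_Pair[OF has_derivative_const has_derivative_ident] d]
    unfolding o_def .
  moreover have "((\<lambda>t. v (t, y)) has_derivative (\<lambda>t. frechet_derivative v (at (x, y)) (t, 0))) (at x)"
    using diff_chain_at[OF has_derivative_Pair[OF has_derivative_ident has_derivative_const] d]
    unfolding o_def .
  moreover have "(\<lambda>t. frechet_derivative v (at (x, y)) (0, t)) = (\<lambda>t. t *\<^sub>R frechet_derivative v (at (x, y)) (0, 1))"
    "(\<lambda>t. frechet_derivative v (at (x, y)) (t, 0)) = (\<lambda>t. t *\<^sub>R frechet_derivative v (at (x, y)) (1, 0))"
    by (simp_all add: scaleR[symmetric] fun_eq_iff)
  ultimately show "((\<lambda>t. v (x, t)) has_vector_derivative frechet_derivative v (at (x, y)) (0, 1)) (at y)"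
    "((\<lambda>t. v (t, y)) has_vector_derivative frechet_derivative v (at (x, y)) (1, 0)) (at x)"
    by (simp_all only: has_vector_derivative_def)
qed

lemma l2_lim_rectangle:
  assumes "(\<lambda>k. L2_dist_sq (rectangle a b) (v k) f) \<longlonglongrightarrow> 0" "AE p in rct a b. f p = f' p"
  shows "l2_lim (rct a b) v f'"
proof -
  have "L2_dist_sq (rectangle a b) (v k) f = (\<integral>\<^sup>+p. ennreal ((norm (v k p - f' p))\<^sup>2) \<partial>rct a b)" for k
    unfolding L2_dist_sq_def nn_integral_lebesgue_rectangle
    using assms(2) by (intro nn_integral_cong_AE) (auto elim: eventually_mono)
  with assms(1) show ?thesis unfolding l2_lim_def by simp
qed

lemma l2_lim_interval:
  assumes "(\<lambda>k. L2_dist_sq (interval l) (v k) f) \<longlonglongrightarrow> 0" "AE p in ivl l. f p = f' p"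
  shows "l2_lim (ivl l) v f'"
proof -
  have "L2_dist_sq (interval l) (v k) f = (\<integral>\<^sup>+p. ennreal ((norm (v k p - f' p))\<^sup>2) \<partial>ivl l)" for k
    unfolding L2_dist_sq_def nn_integral_lebesgue_interval
    using assms(2) by (intro nn_integral_cong_AE) (auto elim: eventually_mono)
  with assms(1) show ?thesis unfolding l2_lim_def by simp
qed

lemma l2_lim_swap:
  assumes "l2_lim (rct a b) v f" "\<And>k. v k \<in> borel_measurable borel" "f \<in> borel_measurable borel"
  shows "l2_lim (rct b a) (\<lambda>k p. v k (prod.swap p)) (\<lambda>p. f (prod.swap p))"
proof -
  have "(\<lambda>p. v k p - f p) \<in> borel_measurable borel" for k using assms by measurable
  from nn_integral_norm_swap[OF this] assms(1) show ?thesis unfolding l2_lim_def by simp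
qed

lemma W2_weak_partial:
  assumes "W2 1 \<Omega> f" "e \<in> Basis"
  shows "has_L2_weak_partial \<Omega> e f (weak_partial \<Omega> e f)"
proof -
  have "\<exists>g. has_L2_weak_partial \<Omega> e f g" using assms by auto
  thus ?thesis unfolding weak_partial_def by (rule someI_ex)
qed

lemma rectangle_sets: "rectangle a b \<in> sets lebesgue"
  unfolding rectangle_eq_box by simp

text \<open>One smooth sequence approximates the field, both weak derivatives and all four traces,
  so the sequence itself and its coordinate exchange witness the two line limits. The limits are
  replaced by Borel representatives, which leaves the distances unchanged.\<close>

lemma has_trace_trace_field:
  assumes tr: "has_trace a b f g"
  obtains f0 D1 D2 g0 where "trace_field a b f0 D1 D2 g0"
    "AE p in rct a b. f p = f0 p"
    "AE p in rct a b. weak_partial (rectangle a b) (1, 0) f p = D1 p"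
    "AE p in rct a b. weak_partial (rectangle a b) (0, 1) f p = D2 p"
    "\<And>s. AE t in lebesgue_on (side_dom a b s). g (side_param a b s t) = g0 s t"
proof -
  let ?R = "rectangle a b"
  have B: "(1, 0) \<in> (Basis :: (real \<times> real) set)" "(0, 1) \<in> (Basis :: (real \<times> real) set)"
    by (auto simp: Basis_prod_def)
  have W: "W2 1 ?R f" and sq: "\<And>s. square_integrable_on (\<lambda>t. g (side_param a b s t)) (side_dom a b s)"
    using tr unfolding has_trace_def by auto
  obtain v where v: "\<And>k. smooth (v k)" "(\<lambda>k. L2_dist_sq ?R (v k) f) \<longlonglongrightarrow> 0"
    "\<And>e. e \<in> Basis \<Longrightarrow> (\<lambda>k. L2_dist_sq ?R (\<lambda>x. frechet_derivative (v k) (at x) e) (weak_partial ?R e f)) \<longlonglongrightarrow> 0"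
    "\<And>s. (\<lambda>k. L2_dist_sq (side_dom a b s) (\<lambda>t. v k (side_param a b s t)) (\<lambda>t. g (side_param a b s t))) \<longlonglongrightarrow> 0"
    using tr unfolding has_trace_def by blast
  note wp = W2_weak_partial[OF W B(1), unfolded has_L2_weak_partial_def] W2_weak_partial[OF W B(2), unfolded has_L2_weak_partial_def]
  have meas: "f \<in> borel_measurable (lebesgue_on ?R)" "weak_partial ?R (1, 0) f \<in> borel_measurable (lebesgue_on ?R)"
     "weak_partial ?R (0, 1) f \<in> borel_measurable (lebesgue_on ?R)"
    using wp unfolding square_integrable_on_def by auto
  obtain f0 where f0: "f0 \<in> borel_measurable borel" "AE p in rct a b. f p = f0 p"
    using borel_representative[OF meas(1) rectangle_sets] unfolding AE_lebesgue_rectangle_iff by blast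
  obtain D1 where D1: "D1 \<in> borel_measurable borel" "AE p in rct a b. weak_partial ?R (1, 0) f p = D1 p"
    using borel_representative[OF meas(2) rectangle_sets] unfolding AE_lebesgue_rectangle_iff by blast
  obtain D2 where D2: "D2 \<in> borel_measurable borel" "AE p in rct a b. weak_partial ?R (0, 1) f p = D2 p"
    using borel_representative[OF meas(3) rectangle_sets] unfolding AE_lebesgue_rectangle_iff by blast
  \<comment> \<open>The sides are null sets in the plane, so representatives of the trace are chosen
    separately on each side, in its own parameter.\<close>
  have "\<exists>g0. g0 \<in> borel_measurable borel \<and> (AE t in lebesgue_on (side_dom a b s). g (side_param a b s t) = g0 t)" for s
  proof -
    have "side_dom a b s \<in> sets lebesgue" by (cases s) (auto simp: interval_def)
    with sq[of s] show ?thesis unfolding square_integrable_on_def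
      by (metis borel_representative)
  qed
  then obtain g0 where g0: "\<And>s. g0 s \<in> borel_measurable borel" 
     "\<And>s. AE t in lebesgue_on (side_dom a b s). g (side_param a b s t) = g0 s t" by metis
  note gs = g0(2)[of Top] g0(2)[of Bottom] g0(2)[of Right] g0(2)[of Left]
  note gs = gs[unfolded side_dom.simps side_param.simps AE_lebesgue_interval_iff]
  note vs = v(4)[of Top] v(4)[of Bottom] v(4)[of Right] v(4)[of Left]
  note vs = vs[unfolded side_dom.simps side_param.simps]
  note c = smooth_continuous[OF v(1)] smooth_partial(2)[OF v(1)]
  have cswap: "continuous_on UNIV (\<lambda>p. q (prod.swap p))" if "continuous_on UNIV q" for q :: "real \<times> real \<Rightarrow> complex"
    by (rule continuous_on_compose2[OF that]) (auto intro!: continuous_intros simp: prod.swap_def)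
  have L2: "l2_lim (rct a b) v f0" "l2_lim (rct a b) (\<lambda>k x. frechet_derivative (v k) (at x) (1,0)) D1"
     "l2_lim (rct a b) (\<lambda>k x. frechet_derivative (v k) (at x) (0,1)) D2"
    by (rule l2_lim_rectangle[OF v(2) f0(2)] l2_lim_rectangle[OF v(3)[OF B(1)] D1(2)] l2_lim_rectangle[OF v(3)[OF B(2)] D2(2)])+
  have "line_limit a b f0 D2 (g0 Bottom) (g0 Top)"
    unfolding line_limit_def
  proof (intro conjI exI allI)
    show "l2_lim (ivl a) (\<lambda>k x. v k (x, - b/2)) (g0 Bottom)" "l2_lim (ivl a) (\<lambda>k x. v k (x, b/2)) (g0 Top)"
      by (rule l2_lim_interval[OF vs(2) gs(2)] l2_lim_interval[OF vs(1) gs(1)])+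
    show "l2_lim (rct a b) v f0" "l2_lim (rct a b) (\<lambda>k x. frechet_derivative (v k) (at x) (0,1)) D2" by (rule L2)+
    show "((\<lambda>t. v k (x, t)) has_vector_derivative frechet_derivative (v k) (at (x, y)) (0, 1)) (at y)" for k x y
      by (rule smooth_line_derivative[OF v(1)])
  qed (rule c f0 D2 g0)+
  moreover have "line_limit b a (\<lambda>p. f0 (prod.swap p)) (\<lambda>p. D1 (prod.swap p)) (g0 Left) (g0 Right)"
    unfolding line_limit_def
  proof (intro conjI exI allI)
    show "l2_lim (ivl b) (\<lambda>k x. v k (prod.swap (x, - a/2))) (g0 Left)" "l2_lim (ivl b) (\<lambda>k x. v k (prod.swap (x, a/2))) (g0 Right)"
      using l2_lim_interval[OF vs(4) gs(4)] l2_lim_interval[OF vs(3) gs(3)] by simp_all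
    show "l2_lim (rct b a) (\<lambda>k p. v k (prod.swap p)) (\<lambda>p. f0 (prod.swap p))"
      "l2_lim (rct b a) (\<lambda>k p. frechet_derivative (v k) (at (prod.swap p)) (1,0)) (\<lambda>p. D1 (prod.swap p))" 
      by (intro l2_lim_swap L2 l2_lim_swap[OF L2(2)] borel_measurable_continuous_onI c f0 D1)+
    show "((\<lambda>t. v k (prod.swap (x, t))) has_vector_derivative frechet_derivative (v k) (at (prod.swap (x, y))) (1, 0)) (at y)" for k x y
      using smooth_line_derivative(2)[OF v(1)] by simp
    show "continuous_on UNIV (\<lambda>p. v k (prod.swap p))" 
      "continuous_on UNIV (\<lambda>p. frechet_derivative (v k) (at (prod.swap p)) (1,0))" for k
      by (rule cswap[OF c(1)] cswap[OF c(2)])+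
  qed (rule measurable_swap_borel f0 D1 g0)+
  ultimately have "trace_field a b f0 D1 D2 g0" unfolding trace_field_def by blast
  thus ?thesis using f0 D1 D2 g0 that by blast
qed

section \<open>Application to both components of a Dirac eigenfunction\<close>

theorem mainTheorem4:
  fixes a b m :: real and ev :: complex and u :: "real \<times> real \<Rightarrow> complex \<times> complex"
  assumes "a > 0" and "b > 0" and "m \<ge> 0"
    and "eigenvalue a b m ev"
    and "eigenfunction a b m ev u"
  shows "\<not> separated_variables a b (\<lambda>x. fst (u x)) \<and> \<not> separated_variables a b (\<lambda>x. snd (u x))"
proof -
  let ?W = "weak_partial (rectangle a b)" and ?u1 = "\<lambda>x. fst (u x)" and ?u2 = "\<lambda>x. snd (u x)"
  have dom: "u \<in> dirac_domain a b" and nz: "\<not> (AE x in rct a b. u x = (0, 0))"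
    and eig: "AE x in rct a b. dirac_op a b m u x = (ev * fst (u x), ev * snd (u x))"
    using assms(5) unfolding eigenfunction_def AE_lebesgue_rectangle_iff by auto
  obtain t1 t2 where tr: "has_trace a b ?u1 t1" "has_trace a b ?u2 t2"
    and bc: "\<And>s. AE t in lebesgue_on (side_dom a b s). t2 (side_param a b s t) = bc_factor s * t1 (side_param a b s t)"
    using dom unfolding dirac_domain_def by blast
  obtain u1 D1u1 D2u1 g1 where 1: "trace_field a b u1 D1u1 D2u1 g1" "AE p in rct a b. ?u1 p = u1 p"
    "AE p in rct a b. ?W (1, 0) ?u1 p = D1u1 p" "AE p in rct a b. ?W (0, 1) ?u1 p = D2u1 p"
    "\<And>s. AE t in lebesgue_on (side_dom a b s). t1 (side_param a b s t) = g1 s t"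
    by (rule has_trace_trace_field[OF tr(1)], rule that)
  obtain u2 D1u2 D2u2 g2 where 2: "trace_field a b u2 D1u2 D2u2 g2" "AE p in rct a b. ?u2 p = u2 p"
    "AE p in rct a b. ?W (1, 0) ?u2 p = D1u2 p" "AE p in rct a b. ?W (0, 1) ?u2 p = D2u2 p"
    "\<And>s. AE t in lebesgue_on (side_dom a b s). t2 (side_param a b s t) = g2 s t"
    by (rule has_trace_trace_field[OF tr(2)], rule that)
  have "AE t in lebesgue_on (side_dom a b s). g2 s t = bc_factor s * g1 s t" for s
    using bc[of s] 1(5)[of s] 2(5)[of s] by eventually_elim simp
  note this[of Top] this[of Bottom] this[of Right] this[of Left]
  note bc = this[unfolded side_dom.simps AE_lebesgue_interval_iff bc_factor_simps]
  have solve: "X = \<i> * z" if "- \<i> * X = z" for X z :: complex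
    using that by (metis (no_types) complex_i_mult_minus mult_minus_left mult_minus_right minus_minus)
  have e1: "AE p in rct a b. D1u2 p - \<i> * D2u2 p = \<i> * (ev - of_real m) * u1 p"
    using eig 1(2) 2(3,4)
  proof eventually_elim
    case (elim p)
    hence "of_real m * u1 p - \<i> * (D1u2 p - \<i> * D2u2 p) = ev * u1 p"
      unfolding dirac_op_def Let_def by simp
    hence "- \<i> * (D1u2 p - \<i> * D2u2 p) = (ev - of_real m) * u1 p"
      by (simp add: algebra_simps)
    from solve[OF this] show ?case by (simp only: mult.assoc)
  qed
  have e2: "AE p in rct a b. D1u1 p + \<i> * D2u1 p = \<i> * (ev + of_real m) * u2 p"
    using eig 2(2) 1(3,4)
  proof eventually_elim
    case (elim p)
    hence "- \<i> * (D1u1 p + \<i> * D2u1 p) - of_real m * u2 p = ev * u2 p"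
      unfolding dirac_op_def Let_def by simp
    hence "- \<i> * (D1u1 p + \<i> * D2u1 p) = (ev + of_real m) * u2 p"
      by (simp add: algebra_simps)
    from solve[OF this] show ?case by (simp only: mult.assoc)
  qed
  have nz: "\<not> (AE p in rct a b. u1 p = 0 \<and> u2 p = 0)"
  proof
    assume "AE p in rct a b. u1 p = 0 \<and> u2 p = 0"
    with 1(2) 2(2) have "AE p in rct a b. u p = (0, 0)" by eventually_elim (auto simp: prod_eq_iff)
    with nz show False by blast
  qed
  have pos: "a \<ge> 0" "b \<ge> 0" using assms by auto
  note ne = dirac_eigenvalue_neq_mass[OF pos assms(3) 1(1) 2(1) bc e1 e2 nz]
  \<comment> \<open>The boundary conditions solved for the first component, with reciprocal factors,
    for the case in which the second component is separated.\<close>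
  have bc': "AE x in ivl a. g1 Top x = - 1 * g2 Top x" "AE x in ivl a. g1 Bottom x = 1 * g2 Bottom x"
      "AE y in ivl b. g1 Right y = - \<i> * g2 Right y" "AE y in ivl b. g1 Left y = \<i> * g2 Left y"
    by (rule eventually_mono[OF bc(1)] eventually_mono[OF bc(2)] eventually_mono[OF bc(3)] eventually_mono[OF bc(4)]; simp)+
  \<comment> \<open>Zero traces of one component force zero traces of the other by the boundary
    condition, and then \<open>u\<close> would vanish by
    \<open>dirac_zero_trace_unique\<close>.\<close>
  have nt1: "\<not> ((AE x in ivl a. g1 Top x = 0) \<and> (AE x in ivl a. g1 Bottom x = 0) \<and> 
       (AE y in ivl b. g1 Right y = 0) \<and> (AE y in ivl b. g1 Left y = 0))"
  proof safe
    assume z: "AE x in ivl a. g1 Top x = 0" "AE x in ivl a. g1 Bottom x = 0"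
       "AE y in ivl b. g1 Right y = 0" "AE y in ivl b. g1 Left y = 0"
    have z2: "AE x in ivl a. g2 Top x = 0" using bc(1) z(1) by eventually_elim simp
    have z3: "AE x in ivl a. g2 Bottom x = 0" using bc(2) z(2) by eventually_elim simp
    have z4: "AE x in ivl b. g2 Right x = 0" using bc(3) z(3) by eventually_elim simp
    have z5: "AE x in ivl b. g2 Left x = 0" using bc(4) z(4) by eventually_elim simp
    from dirac_zero_trace_unique[OF pos 1(1) 2(1) z z2 z3 z4 z5 e1 e2] nz show False
      by (simp add: AE_conj_iff)
  qed
  have nt2: "\<not> ((AE x in ivl a. g2 Top x = 0) \<and> (AE x in ivl a. g2 Bottom x = 0) \<and> 
       (AE y in ivl b. g2 Right y = 0) \<and> (AE y in ivl b. g2 Left y = 0))"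
  proof safe
    assume z: "AE x in ivl a. g2 Top x = 0" "AE x in ivl a. g2 Bottom x = 0"
       "AE y in ivl b. g2 Right y = 0" "AE y in ivl b. g2 Left y = 0"
    have "AE x in ivl a. g1 Top x = 0" using bc'(1) z(1) by eventually_elim simp
    moreover have "AE x in ivl a. g1 Bottom x = 0" using bc'(2) z(2) by eventually_elim simp
    moreover have "AE x in ivl b. g1 Right x = 0" using bc'(3) z(3) by eventually_elim simp
    moreover have "AE x in ivl b. g1 Left x = 0" using bc'(4) z(4) by eventually_elim simp
    ultimately show False using nt1 by blast
  qed
  show ?thesis
  proof (intro conjI notI)
    assume "separated_variables a b ?u1"
    then obtain \<phi> \<psi> where "AE x in rct a b. fst (u x) = \<phi> (fst x) * \<psi> (snd x)"
      unfolding separated_variables_def AE_lebesgue_rectangle_iff by blast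
    with 1(2) have sep: "AE x in rct a b. u1 x = \<phi> (fst x) * \<psi> (snd x)" by eventually_elim simp
    have eq: "AE p in rct a b. \<i> * (ev + of_real m) * u2 p = D1u1 p + \<i> * D2u1 p"
      using e2 by eventually_elim simp
    have c: "\<i> * (ev + of_real m) \<noteq> 0" using ne(2) by (simp add: add_eq_0_iff2)
    show False
      by (rule separated_trace_field_contradiction[OF assms(1,2) 1(1) 2(1) _ _ _ _ _ eq c _ sep nt1, of bc_factor])
        (use bc in \<open>simp_all add: bc_factor_simps\<close>)
  next
    assume "separated_variables a b ?u2"
    then obtain \<phi> \<psi> where "AE x in rct a b. snd (u x) = \<phi> (fst x) * \<psi> (snd x)"
      unfolding separated_variables_def AE_lebesgue_rectangle_iff by blast
    with 2(2) have sep: "AE x in rct a b. u2 x = \<phi> (fst x) * \<psi> (snd x)" by eventually_elim simp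
    have eq: "AE p in rct a b. \<i> * (ev - of_real m) * u1 p = D1u2 p + (- \<i>) * D2u2 p"
      using e1 by eventually_elim simp
    have c: "\<i> * (ev - of_real m) \<noteq> 0" using ne(1) by simp
    \<comment> \<open>Here \<open>\<tau> = - \<i>\<close>, and the reciprocal factors at the top and
      bottom sides are still -1 and 1, hence distinct.\<close>
    show False
      by (rule separated_trace_field_contradiction[OF assms(1,2) 2(1) 1(1) _ _ _ _ _ eq c _ sep nt2, 
            of "\<lambda>s. inverse (bc_factor s)"])
        (use bc' in \<open>simp_all add: bc_factor_simps\<close>)
  qed
qed

end
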